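(* Let $n\ge 3$. The element $V$ (the volume of an $n$-simplex) is integral over the ring $\Lambda_2$ of Laurent polynomials in the areas $A_{ijk}$ of the $2$-faces of the simplex if and only if $n\ge 6$. Hence, for $n\ge 6$, $V$ is integral over $\widetilde{R}_2$.
   Context: Let $\ell_{ij}=\ell_{ji}$, $0\le i<j\le n$, be $\binom{n+1}{2}$ independent variables over $\mathbb{Q}$ (the edge lengths of an $n$-simplex with vertices $p_0,\dots,p_n$), put $s_{ij}=\ell_{ij}^2$, and let $\mathbb{F}$ be the algebraic closure of the field of rational functions $\mathbb{Q}(\ell_{ij})$. For pairwise distinct $i,j,k$ put $$S_{ijk}=\tfrac1{16}\left(2s_{ij}s_{jk}+2s_{jk}s_{ki}+2s_{ki}s_{ij}-s_{ij}^2-s_{jk}^2-s_{ki}^2\right),$$ and let $A_{ijk}=\sqrt{S_{ijk}}\in\mathbb{F}$ (area of the $2$-face $p_ip_jp_k$). Let $$W=\frac{(-1)^{n+1}}{2^n(n!)^2}\det M,$$ where $M$ is the symmetric $(n+2)\times(n+2)$ matrix with rows and columns indexed by $*,0,1,\dots,n$, with $M_{**}=0$, $M_{*i}=M_{i*}=1$, $M_{ii}=0$, $M_{ij}=s_{ij}$ for $i\ne j$ (Cayley--Menger formula for the square of the volume), and let $V=\sqrt{W}\in\mathbb{F}$. $\Lambda_2$ is the $\mathbb{Q}$-subalgebra of $\mathbb{F}$ generated by the elements $A_{ijk}$ and $A_{ijk}^{-1}$, $0\le i<j<k\le n$. $\widetilde{R}_2$ is the $\mathbb{Q}$-subalgebra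 of $\mathbb{F}$ consisting of all elements $a/b$, where $a$ and $b$ are polynomials with rational coefficients in the $A_{ijk}$ such that $b$ takes a non-zero value whenever the areas of the $2$-faces of a non-degenerate $n$-simplex in $\mathbb{R}^n$ are substituted for the $A_{ijk}$. *)

theory Defs
  imports
    "HOL-Analysis.Analysis"
    "HOL-Library.Poly_Mapping"
    "HOL-Computational_Algebra.Fraction_Field"
    "HOL-Computational_Algebra.Polynomial_Factorial"
    "HOL-Algebra.Algebraic_Closure_Type"
    "Jordan_Normal_Form.Determinant"
begin

text \<open>
  The dimension is \<open>n = CARD('n)\<close>, so that Euclidean n-space is \<open>real ^ 'n\<close>; the vertices of the
  simplex are labelled by the natural numbers \<open>0, \<dots>, n\<close>.  The type \<open>'n simplex_edge\<close> has exactly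
  one element for each of the \<open>(n + 1) choose 2\<close> edges.
\<close>

typedef ('n :: finite) simplex_edge = "{(i :: nat, j :: nat). i < j \<and> j \<le> CARD('n)}"
  morphisms edge_ends Edge
proof
  show "(0, 1) \<in> {(i :: nat, j :: nat). i < j \<and> j \<le> CARD('n)}"
    by (simp add: Suc_le_eq)
qed

text \<open>
  The order on edges is auxiliary: the library proves that \<open>poly_mapping\<close> is an integral domain
  only for linearly ordered exponents.
\<close>

instantiation simplex_edge :: (finite) linorder
begin

definition less_eq_simplex_edge :: "'a simplex_edge \<Rightarrow> 'a simplex_edge \<Rightarrow> bool" where
  "e \<le> e' \<longleftrightarrow> fst (edge_ends e) < fst (edge_ends e') \<or>
     fst (edge_ends e) = fst (edge_ends e') \<and> snd (edge_ends e) \<le> snd (edge_ends e')"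

definition less_simplex_edge :: "'a simplex_edge \<Rightarrow> 'a simplex_edge \<Rightarrow> bool" where
  "e < e' \<longleftrightarrow> fst (edge_ends e) < fst (edge_ends e') \<or>
     fst (edge_ends e) = fst (edge_ends e') \<and> snd (edge_ends e) < snd (edge_ends e')"

instance
  by standard
    (auto simp: less_eq_simplex_edge_def less_simplex_edge_def prod_eq_iff simp flip: edge_ends_inject)

end

text \<open>Needed so that \<open>of_rat\<close> embeds the rationals into the field below.\<close>

instance fract :: ("{idom, ring_char_0}") field_char_0
proof
  have *: "of_nat m = to_fract (of_nat m :: 'a)" for m
    by (induction m) simp_all
  show "inj (of_nat :: nat \<Rightarrow> 'a fract)"
    by (rule injI) (simp add: *)
qed

type_synonym 'n simplex_field = "(('n simplex_edge \<Rightarrow>\<^sub>0 nat) \<Rightarrow>\<^sub>0 rat) fract alg_closure"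

text \<open>The value is only meaningful for distinct \<open>i\<close>, \<open>j\<close> at most \<open>n\<close>.\<close>

definition edge_length :: "nat \<Rightarrow> nat \<Rightarrow> 'n :: finite simplex_field" where
  "edge_length i j = to_ac (to_fract
     (Poly_Mapping.single (Poly_Mapping.single (Edge (min i j, max i j)) 1) 1))"

definition sq_length :: "nat \<Rightarrow> nat \<Rightarrow> 'n :: finite simplex_field" where
  "sq_length i j = edge_length i j ^ 2"

text \<open>In the next three definitions \<open>s i j\<close> stands for the square of the length of an edge.\<close>

definition heron :: "(nat \<Rightarrow> nat \<Rightarrow> 'a :: field) \<Rightarrow> nat \<Rightarrow> nat \<Rightarrow> nat \<Rightarrow> 'a" where
  "heron s i j k = (1 / 16) *
     (2 * s i j * s j k + 2 * s j k * s k i + 2 * s k i * s i j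
      - (s i j)\<^sup>2 - (s j k)\<^sup>2 - (s k i)\<^sup>2)"

text \<open>Row and column \<open>0\<close> correspond to the index \<open>*\<close>, row and column \<open>i + 1\<close> to the vertex \<open>i\<close>.\<close>

definition cayley_menger_mat :: "nat \<Rightarrow> (nat \<Rightarrow> nat \<Rightarrow> 'a :: field) \<Rightarrow> 'a Matrix.mat" where
  "cayley_menger_mat n s = Matrix.mat (n + 2) (n + 2)
     (\<lambda>(a, b). if a = b then 0 else if a = 0 \<or> b = 0 then 1 else s (a - 1) (b - 1))"

definition cayley_menger :: "nat \<Rightarrow> (nat \<Rightarrow> nat \<Rightarrow> 'a :: field_char_0) \<Rightarrow> 'a" where
  "cayley_menger n s =
     (- 1) ^ (n + 1) / (2 ^ n * (fact n)\<^sup>2) * Determinant.det (cayley_menger_mat n s)"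

definition two_faces :: "nat \<Rightarrow> (nat \<times> nat \<times> nat) set" where
  "two_faces n = {(i, j, k). i < j \<and> j < k \<and> k \<le> n}"

definition rat_subalgebra :: "'a :: field_char_0 set \<Rightarrow> bool" where
  "rat_subalgebra R \<longleftrightarrow>
     range of_rat \<subseteq> R \<and> (\<forall>x\<in>R. \<forall>y\<in>R. x + y \<in> R) \<and> (\<forall>x\<in>R. \<forall>y\<in>R. x * y \<in> R)"

definition integral_over :: "'a :: field set \<Rightarrow> 'a \<Rightarrow> bool" where
  "integral_over R x \<longleftrightarrow>
     (\<exists>p :: 'a Polynomial.poly. Polynomial.lead_coeff p = 1 \<and> (\<forall>i. Polynomial.coeff p i \<in> R) \<and>
        Polynomial.poly p x = 0)"

definition area_laurent_ring ::
    "(nat \<times> nat \<times> nat \<Rightarrow> 'n :: finite simplex_field) \<Rightarrow> 'n simplex_field set" where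
  "area_laurent_ring A =
     rat_subalgebra hull (\<Union>t \<in> two_faces CARD('n). {A t, inverse (A t)})"

text \<open>Formal polynomials over the rationals in one variable for each 2-face of the n-simplex.\<close>

definition area_polys :: "nat \<Rightarrow> ((nat \<times> nat \<times> nat \<Rightarrow>\<^sub>0 nat) \<Rightarrow>\<^sub>0 rat) set" where
  "area_polys n = {q. \<forall>m \<in> Poly_Mapping.keys q. Poly_Mapping.keys m \<subseteq> two_faces n}"

definition eval_poly :: "('v \<Rightarrow> 'a :: field_char_0) \<Rightarrow> (('v \<Rightarrow>\<^sub>0 nat) \<Rightarrow>\<^sub>0 rat) \<Rightarrow> 'a" where
  "eval_poly f q = (\<Sum>m \<in> Poly_Mapping.keys q. of_rat (Poly_Mapping.lookup q m) *
     (\<Prod>v \<in> Poly_Mapping.keys m. f v ^ Poly_Mapping.lookup m v))"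

definition nondegenerate_simplex :: "(nat \<Rightarrow> real ^ 'n :: finite) \<Rightarrow> bool" where
  "nondegenerate_simplex p \<longleftrightarrow>
     inj_on p {..CARD('n)} \<and> \<not> affine_dependent (p ` {..CARD('n)})"

definition face_area :: "(nat \<Rightarrow> real ^ 'n :: finite) \<Rightarrow> nat \<times> nat \<times> nat \<Rightarrow> real" where
  "face_area p = (\<lambda>(i, j, k). sqrt (heron (\<lambda>a b. (dist (p a) (p b))\<^sup>2) i j k))"

definition area_localized_ring ::
    "(nat \<times> nat \<times> nat \<Rightarrow> 'n :: finite simplex_field) \<Rightarrow> 'n simplex_field set" where
  "area_localized_ring A =
     {eval_poly A a / eval_poly A b | a b.
        a \<in> area_polys CARD('n) \<and> b \<in> area_polys CARD('n) \<and>
        (\<forall>p :: nat \<Rightarrow> real ^ 'n.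
           nondegenerate_simplex p \<longrightarrow> eval_poly (face_area p) b \<noteq> 0)}"

end

theory Submission
  imports Defs "HOL-Real_Asymp.Real_Asymp"
begin

text \<open>
  Let \<open>s i j\<close> be the squared edge lengths, \<open>S\<close> the squared areas of the 2-faces and \<open>W\<close> the square of
  the volume \<open>V\<close>.  Integrality is tested at valuation rings: an element of a field is integral over a
  subring if and only if it lies in every valuation ring of the field that contains the subring
  (\<open>integral_if_mem_valuation_rings\<close>, \<open>mem_if_integral\<close>).  In a valuation ring \<open>B\<close> that contains the
  Laurent ring of the areas all \<open>S\<close> are units, although the \<open>s i j\<close> may lie outside \<open>B\<close>, that is, be
  infinite at the corresponding place.

  \<^bold>\<open>Seven or more vertices\<close> (\<open>cayley_menger_mem\<close>).  If all \<open>s i j\<close> are finite, so is \<open>W\<close>.  If an edge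
  is infinite but all tetrahedra have finite volume, project the other vertices along this edge, of
  squared length \<open>t\<close>, say.  The inner products of the projections have order at most \<open>1 / sqrt t\<close>,
  and \<open>W\<close> is \<open>t\<close> times their \<open>(n - 1)\<close>-rowed Gram determinant, up to a rational factor.  Finally,
  let some tetrahedron have infinite volume, and take one of largest volume.  Its four face normals
  have finite squared lengths, but their inner products may be infinite; let \<open>M\<close> be the largest one.
  Then \<open>D\<close>, which is 36 times the squared volume, has order at most \<open>M ^ (3/2)\<close>.  The six triangles
  spanned by an edge of the tetrahedron and a further vertex have unit areas.  Together with the choice of
  the tetrahedron this forces the further vertex to be near one of its vertices: its other barycentric coordinates have order at most
  \<open>1 / M\<close>, the square of its distance from the tetrahedron has order at most \<open>D / M\<^sup>2\<close>, and all
  inner products of the normals have exactly the order of \<open>M\<close> (\<open>N_small\<close>, \<open>all_big\<close>, \<open>near_vertex\<close>).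
  The triangles with two further vertices yield the same bound \<open>D / M\<^sup>2\<close> for the inner product of the
  components of these vertices orthogonal to the tetrahedron (\<open>cross_term_small\<close>).  Now \<open>W\<close> is, up to a
  rational factor, \<open>D\<close> times the \<open>(n - 3)\<close>-rowed Gram determinant of these components, and its order
  is at most \<open>D * (D / M\<^sup>2) ^ (n - 3)\<close>, hence at most \<open>M ^ ((6 - n) / 2)\<close>.  So the number six comes from
  comparing the volume of a large tetrahedron with the height of the simplex over it.

  \<^bold>\<open>At most six vertices\<close> (\<open>volume_not_integral\<close>).  The bound is attained by a real family of squared
  lengths (\<open>degen_sq\<close>): a large tetrahedron with opposite edges equal, all of whose faces are nearly
  degenerate, together with up to two vertices very close to vertices of the tetrahedron.  Along this
  family the areas stay between positive bounds, while the volume is unbounded.  If \<open>V\<close> were integral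
  over the Laurent ring, \<open>W\<close> would be integral over the ring generated by the \<open>S\<close> and their inverses, as
  one sees from valuation rings again.  The elements of that ring are bounded along the family, so \<open>W\<close>
  would be bounded as well.

  The areas of a non-degenerate simplex do not vanish, so the Laurent ring is contained in the localized
  ring, and integrality over the former implies integrality over the latter.
\<close>

section \<open>Valuation rings and integral elements\<close>

locale unital_subring =
  fixes R :: "'a :: field set"
  assumes one_mem [simp, intro]: "1 \<in> R"
    and diff_mem: "x \<in> R \<Longrightarrow> y \<in> R \<Longrightarrow> x - y \<in> R"
    and mult_mem: "x \<in> R \<Longrightarrow> y \<in> R \<Longrightarrow> x * y \<in> R"
begin

lemma zero_mem [simp, intro]: "0 \<in> R"
  using diff_mem[OF one_mem one_mem] by simp

lemma minus_mem: "x \<in> R \<Longrightarrow> - x \<in> R"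
  using diff_mem[of 0 x] by simp

lemma add_mem: "x \<in> R \<Longrightarrow> y \<in> R \<Longrightarrow> x + y \<in> R"
  using diff_mem[of x "- y"] minus_mem[of y] by simp

lemma power_mem: "x \<in> R \<Longrightarrow> x ^ k \<in> R"
  by (induction k) (auto intro: mult_mem)

lemma sum_mem: "(\<And>i. i \<in> I \<Longrightarrow> f i \<in> R) \<Longrightarrow> sum f I \<in> R"
  by (induction I rule: infinite_finite_induct) (auto intro: add_mem)

lemma prod_mem: "(\<And>i. i \<in> I \<Longrightarrow> f i \<in> R) \<Longrightarrow> prod f I \<in> R"
  by (induction I rule: infinite_finite_induct) (auto intro: mult_mem)

lemma of_nat_mem: "of_nat k \<in> R"
  by (induction k) (auto intro: add_mem)

lemma numeral_mem [simp]: "numeral k \<in> R"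
  using of_nat_mem[of "numeral k"] by simp

definition polys :: "'a Polynomial.poly set" where
  "polys = {p. \<forall>i. Polynomial.coeff p i \<in> R}"

lemma polys_const: "c \<in> R \<Longrightarrow> [:c:] \<in> polys"
  by (auto simp: polys_def coeff_pCons split: nat.splits)

lemma polys_diff: "p \<in> polys \<Longrightarrow> q \<in> polys \<Longrightarrow> p - q \<in> polys"
  by (auto simp: polys_def intro: diff_mem)

lemma polys_mult: "p \<in> polys \<Longrightarrow> q \<in> polys \<Longrightarrow> p * q \<in> polys"
  by (auto simp: polys_def coeff_mult intro!: sum_mem mult_mem)

lemma polys_monom: "c \<in> R \<Longrightarrow> Polynomial.monom c k \<in> polys"
  by (auto simp: polys_def)

lemma polys_sum: "(\<And>i. i \<in> I \<Longrightarrow> f i \<in> polys) \<Longrightarrow> sum f I \<in> polys"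
  by (auto simp: polys_def coeff_sum intro!: sum_mem)

definition adjoin :: "'a \<Rightarrow> 'a set" where
  "adjoin z = {Polynomial.poly p z | p. p \<in> polys}"

lemma unital_subring_adjoin: "unital_subring (adjoin z)"
proof
  show "1 \<in> adjoin z"
    unfolding adjoin_def using polys_const[of 1] by (auto intro!: exI[of _ "[:1:]"])
next
  fix x y assume "x \<in> adjoin z" "y \<in> adjoin z"
  then obtain p q where "p \<in> polys" "q \<in> polys" "x = Polynomial.poly p z" "y = Polynomial.poly q z"
    by (auto simp: adjoin_def)
  then show "x - y \<in> adjoin z" "x * y \<in> adjoin z"
    unfolding adjoin_def using polys_diff polys_mult
    by (auto simp flip: poly_diff poly_mult)
qed

lemma subset_adjoin: "R \<subseteq> adjoin z"
proof
  fix c assume "c \<in> R"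
  then show "c \<in> adjoin z"
    unfolding adjoin_def using polys_const[of c] by (auto intro!: exI[of _ "[:c:]"])
qed

lemma mem_adjoin: "z \<in> adjoin z"
  unfolding adjoin_def using polys_monom[of 1 1]
  by (auto simp: poly_monom intro!: exI[of _ "Polynomial.monom 1 1"])

end

locale valuation_ring = unital_subring +
  assumes mem_or_inverse_mem: "x \<in> R \<or> inverse x \<in> R"

text \<open>
  A polynomial expression of degree \<open>m\<close> for \<open>x\<close> in \<open>1 / x\<close> becomes a monic equation of degree \<open>m + 1\<close>
  after multiplication by \<open>x ^ m\<close>.
\<close>

lemma (in unital_subring) integral_if_mem_adjoin_inverse:
  assumes "x \<in> adjoin (inverse x)" "x \<noteq> 0"
  shows "integral_over R x"
proof -
  from assms(1) obtain p where p: "p \<in> polys" "x = Polynomial.poly p (inverse x)"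
    by (auto simp: adjoin_def)
  define m where "m = Polynomial.degree p"
  define q where "q = Polynomial.monom 1 (Suc m) - (\<Sum>i\<le>m. Polynomial.monom (Polynomial.coeff p i) (m - i))"
  have "x * x ^ m = (\<Sum>i\<le>m. Polynomial.coeff p i * inverse x ^ i) * x ^ m"
    using p(2) by (simp add: poly_altdef m_def)
  also have "\<dots> = (\<Sum>i\<le>m. Polynomial.coeff p i * x ^ (m - i))"
    unfolding sum_distrib_right
  proof (rule sum.cong)
    fix i assume "i \<in> {..m}"
    then have "x ^ m = x ^ i * x ^ (m - i)" by (simp flip: power_add)
    then show "Polynomial.coeff p i * inverse x ^ i * x ^ m = Polynomial.coeff p i * x ^ (m - i)"
      using assms(2) by (simp add: field_simps)
  qed simp
  finally have "Polynomial.poly q x = 0"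
    by (simp add: q_def poly_sum poly_monom)
  moreover have "q \<in> polys"
    unfolding q_def using p(1) by (intro polys_diff polys_monom polys_sum) (auto simp: polys_def)
  moreover have "Polynomial.lead_coeff q = 1"
  proof -
    have "Polynomial.degree (\<Sum>i\<le>m. Polynomial.monom (Polynomial.coeff p i) (m - i)) < Suc m"
      by (intro degree_sum_less) (auto intro: le_less_trans[OF degree_monom_le])
    then have "Polynomial.degree q = Suc m \<and> Polynomial.coeff q (Suc m) = 1"
      unfolding q_def
      by (metis (no_types, lifting) add.right_neutral add_diff_eq coeff_diff coeff_eq_0 coeff_monom degree_add_eq_left degree_minus degree_monom_eq diff_conv_add_uminus diff_zero zero_neq_one)
    then show ?thesis by simp
  qed
  ultimately show ?thesis
    unfolding integral_over_def polys_def by blast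
qed

text \<open>
  Divide a monic equation by a power of \<open>x\<close>: if \<open>1 / x\<close> lies in the ring, this expresses \<open>x\<close> through
  elements of the ring.
\<close>

lemma (in valuation_ring) mem_if_integral:
  assumes "integral_over R x"
  shows "x \<in> R"
proof (rule ccontr)
  assume x: "x \<notin> R"
  then have ix: "inverse x \<in> R" and "x \<noteq> 0" using mem_or_inverse_mem by auto
  from assms obtain p where p: "Polynomial.lead_coeff p = 1" "\<And>i. Polynomial.coeff p i \<in> R"
    "Polynomial.poly p x = 0"
    by (auto simp: integral_over_def)
  obtain d where d: "Polynomial.degree p = Suc d"
  proof (cases "Polynomial.degree p")
    case 0
    then have "p = 1" using p(1) by (metis degree_eq_zeroE lead_coeff_pCons(2) one_pCons)
    with p(3) show ?thesis by simp
  qed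
  have "0 = (\<Sum>i\<le>d. Polynomial.coeff p i * x ^ i) + x ^ Suc d"
    using p d by (simp add: poly_altdef)
  then have "x * x ^ d = - (\<Sum>i\<le>d. Polynomial.coeff p i * x ^ i)"
    by (simp add: eq_neg_iff_add_eq_0 add.commute)
  then have "x = - (\<Sum>i\<le>d. Polynomial.coeff p i * x ^ i) * inverse x ^ d"
    using \<open>x \<noteq> 0\<close> by (simp add: field_simps)
  also have "\<dots> = - (\<Sum>i\<le>d. Polynomial.coeff p i * inverse x ^ (d - i))"
    unfolding mult_minus_left sum_distrib_right
  proof (intro arg_cong[of _ _ uminus] sum.cong)
    fix i assume "i \<in> {..d}"
    then have "x ^ d = x ^ i * x ^ (d - i)" by (simp flip: power_add)
    then show "Polynomial.coeff p i * x ^ i * inverse x ^ d = Polynomial.coeff p i * inverse x ^ (d - i)"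
      using \<open>x \<noteq> 0\<close> by (simp add: field_simps)
  qed simp
  also have "\<dots> \<in> R"
    by (intro minus_mem sum_mem mult_mem power_mem p(2) ix)
  finally show False using x by simp
qed

text \<open>
  A subring that is maximal among those containing \<open>1 / x\<close> but not \<open>x\<close> is a valuation ring.  This is
  Chevalley's argument in the case where the prescribed ideal is generated by \<open>1 / x\<close>.
\<close>

locale maximal_avoiding = unital_subring +
  fixes x :: 'a
  assumes x_notin: "x \<notin> R" and inverse_x_mem: "inverse x \<in> R"
    and maximal: "unital_subring B \<Longrightarrow> R \<subseteq> B \<Longrightarrow> x \<notin> B \<Longrightarrow> B = R"
begin

lemma x_nonzero: "x \<noteq> 0"
  using x_notin by auto

definition ideal where
  "ideal = {inverse x * b | b. b \<in> R}"

lemma ideal_subset: "c \<in> ideal \<Longrightarrow> c \<in> R"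
  by (auto simp: ideal_def intro: mult_mem inverse_x_mem)

lemma ideal_diff: "c \<in> ideal \<Longrightarrow> d \<in> ideal \<Longrightarrow> c - d \<in> ideal"
  unfolding ideal_def by (auto simp flip: right_diff_distrib intro: diff_mem)

lemma ideal_add: "c \<in> ideal \<Longrightarrow> d \<in> ideal \<Longrightarrow> c + d \<in> ideal"
  unfolding ideal_def by (auto simp flip: distrib_left intro: add_mem)

lemma ideal_mult: "c \<in> R \<Longrightarrow> d \<in> ideal \<Longrightarrow> c * d \<in> ideal"
  unfolding ideal_def by (auto simp: mult.left_commute intro: mult_mem)

lemma zero_ideal: "0 \<in> ideal"
  unfolding ideal_def by (auto intro!: exI[of _ 0])

lemma one_notin_ideal: "1 \<notin> ideal"
proof
  assume "1 \<in> ideal"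
  then obtain b where "b \<in> R" "1 = inverse x * b" by (auto simp: ideal_def)
  then have "x = b" using x_nonzero by (simp add: field_simps)
  with \<open>b \<in> R\<close> x_notin show False by simp
qed

lemma mem_adjoin_if_notin:
  assumes "z \<notin> R"
  shows "x \<in> adjoin z"
proof (rule ccontr)
  assume "x \<notin> adjoin z"
  then have "adjoin z = R"
    by (rule maximal[OF unital_subring_adjoin subset_adjoin])
  with assms mem_adjoin[of z] show False by simp
qed

text \<open>
  This replaces locality in Chevalley's argument.  If \<open>1 - c\<close> were not invertible, maximality would put
  \<open>x\<close> into the ring extended by \<open>1 / (1 - c)\<close>, and hence \<open>x * (1 - c) ^ m\<close> into the ring itself.  But
  \<open>x * c\<close> lies in the ring, so \<open>x * (1 - c) ^ m\<close> differs from \<open>x\<close> by an element of the ring.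
\<close>

lemma unit_one_minus:
  assumes "c \<in> ideal"
  shows "inverse (1 - c) \<in> R"
proof (rule ccontr)
  assume "inverse (1 - c) \<notin> R"
  then have "x \<in> adjoin (inverse (1 - c))" by (rule mem_adjoin_if_notin)
  then obtain p where p: "p \<in> polys" "x = Polynomial.poly p (inverse (1 - c))"
    by (auto simp: adjoin_def)
  have c1: "1 - c \<noteq> 0" using assms one_notin_ideal by (cases "c = 1") auto
  have cR: "1 - c \<in> R" by (rule diff_mem[OF one_mem ideal_subset[OF assms]])
  define m where "m = Polynomial.degree p"
  have "x * (1 - c) ^ m = (\<Sum>i\<le>m. Polynomial.coeff p i * inverse (1 - c) ^ i) * (1 - c) ^ m"
    using p(2) by (simp add: poly_altdef m_def)
  also have "\<dots> = (\<Sum>i\<le>m. Polynomial.coeff p i * (1 - c) ^ (m - i))"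
    unfolding sum_distrib_right
  proof (rule sum.cong)
    fix i assume "i \<in> {..m}"
    then have "(1 - c) ^ m = (1 - c) ^ i * (1 - c) ^ (m - i)" by (simp flip: power_add)
    then show "Polynomial.coeff p i * inverse (1 - c) ^ i * (1 - c) ^ m = Polynomial.coeff p i * (1 - c) ^ (m - i)"
      using c1 by (simp add: field_simps)
  qed simp
  also have "\<dots> \<in> R"
    using p(1) by (intro sum_mem mult_mem power_mem cR) (auto simp: polys_def)
  finally have xR: "x * (1 - c) ^ m \<in> R" .
  have "x * (1 - c) ^ k - x \<in> R" for k
  proof (induction k)
    case (Suc k)
    from assms obtain b where b: "b \<in> R" "c = inverse x * b" by (auto simp: ideal_def)
    have "x * (1 - c) ^ Suc k - x = (x * (1 - c) ^ k - x) * (1 - c) - b"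
      using x_nonzero b(2) by (simp add: field_simps)
    also have "\<dots> \<in> R" by (intro diff_mem mult_mem Suc cR b)
    finally show ?case .
  qed simp
  from diff_mem[OF xR this[of m]] x_notin show False by simp
qed

definition ideal_polys :: "'a Polynomial.poly set" where
  "ideal_polys = {p. \<forall>i. Polynomial.coeff p i \<in> ideal}"

lemma ideal_poly_if_notin:
  assumes "z \<notin> R"
  shows "\<exists>p \<in> ideal_polys. Polynomial.poly p z = 1"
proof -
  from mem_adjoin_if_notin[OF assms] obtain p where p: "p \<in> polys" "x = Polynomial.poly p z"
    by (auto simp: adjoin_def)
  then have "Polynomial.smult (inverse x) p \<in> ideal_polys"
    unfolding ideal_polys_def ideal_def polys_def by auto
  moreover have "Polynomial.poly (Polynomial.smult (inverse x) p) z = 1"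
    using p(2) x_nonzero by simp
  ultimately show ?thesis by blast
qed

text \<open>
  The relation for \<open>1 / z\<close> can be solved for 1 because its constant term is \<open>1\<close> minus a unit.
  Multiplied by \<open>z ^ m\<close>, where \<open>m\<close> is the degree of \<open>p\<close>, it expresses \<open>z ^ m\<close> by lower powers of \<open>z\<close>, which are
  substituted into the leading term of the relation for \<open>z\<close>.
\<close>

lemma ideal_poly_lower_degree:
  assumes p: "p \<in> ideal_polys" "Polynomial.poly p z = 1"
    and q: "q \<in> ideal_polys" "Polynomial.poly q (inverse z) = 1"
    and le: "Polynomial.degree q \<le> Polynomial.degree p" and "z \<noteq> 0"
  shows "\<exists>r \<in> ideal_polys. Polynomial.poly r z = 1 \<and> Polynomial.degree r < Polynomial.degree p"
proof -
  define m k where "m = Polynomial.degree p" and "k = Polynomial.degree q"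
  define u where "u = inverse (1 - Polynomial.coeff q 0)"
  have q0: "Polynomial.coeff q 0 \<in> ideal" and pm: "Polynomial.coeff p m \<in> ideal"
    using p q by (auto simp: ideal_polys_def)
  have uR: "u \<in> R" unfolding u_def by (rule unit_one_minus[OF q0])
  have q01: "1 - Polynomial.coeff q 0 \<noteq> 0" using q0 one_notin_ideal by auto
  have m0: "m > 0"
  proof (rule ccontr)
    assume "\<not> m > 0"
    then have "p = [:Polynomial.coeff p 0:]" by (metis m_def degree_eq_zeroE coeff_pCons_0 not_gr_zero)
    then have "1 = Polynomial.coeff p 0" using p(2) by (metis mult_zero_right add.right_neutral poly_0 poly_pCons)
    then show False using p(1) one_notin_ideal unfolding ideal_polys_def by (metis mem_Collect_eq)
  qed
  define w where "w = (\<Sum>j\<in>{1..k}. Polynomial.monom (u * Polynomial.coeff q j) (m - j))"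
  have "1 = Polynomial.coeff q 0 + (\<Sum>j\<in>{1..k}. Polynomial.coeff q j * inverse z ^ j)"
    using q(2) by (simp add: poly_altdef k_def sum.atMost_shift sum.atLeast1_atMost_eq lessThan_Suc_atMost)
  then have "1 - Polynomial.coeff q 0 = (\<Sum>j\<in>{1..k}. Polynomial.coeff q j * inverse z ^ j)"
    by (simp add: algebra_simps)
  then have "1 = u * (\<Sum>j\<in>{1..k}. Polynomial.coeff q j * inverse z ^ j)"
    using q01 by (simp add: u_def field_simps)
  then have "z ^ m = (\<Sum>j\<in>{1..k}. u * Polynomial.coeff q j * (inverse z ^ j * z ^ m))"
    by (metis (no_types, lifting) mult.assoc mult_1 sum.cong sum_distrib_left sum_distrib_right)
  also have "\<dots> = Polynomial.poly w z"
    unfolding w_def poly_sum poly_monom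
  proof (rule sum.cong)
    fix j assume "j \<in> {1..k}"
    then have "z ^ m = z ^ j * z ^ (m - j)" using le by (simp add: m_def k_def flip: power_add)
    then show "u * Polynomial.coeff q j * (inverse z ^ j * z ^ m) = u * Polynomial.coeff q j * z ^ (m - j)"
      using \<open>z \<noteq> 0\<close> by (simp add: field_simps)
  qed simp
  finally have wz: "Polynomial.poly w z = z ^ m" ..
  define r where "r = p - Polynomial.monom (Polynomial.coeff p m) m + Polynomial.smult (Polynomial.coeff p m) w"
  have "Polynomial.poly r z = 1"
    by (simp add: r_def wz poly_monom p(2))
  moreover have "r \<in> ideal_polys"
  proof -
    have "Polynomial.coeff r i = Polynomial.coeff p i - (if m = i then Polynomial.coeff p m else 0)
       + Polynomial.coeff w i * Polynomial.coeff p m" for i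
      by (simp add: r_def mult.commute)
    moreover have "Polynomial.coeff q j \<in> R" for j
      using q(1) ideal_subset unfolding ideal_polys_def by blast
    then have "Polynomial.coeff w i \<in> R" for i
      unfolding w_def coeff_sum coeff_monom using uR by (auto intro!: sum_mem mult_mem)
    ultimately show ?thesis
      using p(1) pm by (auto simp: ideal_polys_def intro!: ideal_add ideal_diff ideal_mult zero_ideal)
  qed
  moreover have "Polynomial.degree r \<le> m - 1"
  proof (rule degree_le, intro allI impI)
    fix i assume i: "m - 1 < i"
    have "Polynomial.coeff w i = 0"
      unfolding w_def coeff_sum using i by (intro sum.neutral) auto
    moreover have "Polynomial.coeff p i = (if m = i then Polynomial.coeff p m else 0)"
      using i by (auto simp: m_def intro!: coeff_eq_0)
    ultimately show "Polynomial.coeff r i = 0" by (simp add: r_def)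
  qed
  ultimately show ?thesis using m0 unfolding m_def by (intro bexI[of _ r]) auto
qed

lemma valuation_ring: "valuation_ring R"
proof unfold_locales
  fix z show "z \<in> R \<or> inverse z \<in> R"
  proof (rule ccontr)
    assume "\<not> (z \<in> R \<or> inverse z \<in> R)"
    then have nz: "z \<notin> R" "inverse z \<notin> R" "z \<noteq> 0" by auto
    define rel where "rel y p \<longleftrightarrow> p \<in> ideal_polys \<and> Polynomial.poly p y = 1" for y p
    define p q where "p = arg_min Polynomial.degree (rel z)"
      and "q = arg_min Polynomial.degree (rel (inverse z))"
    have ex: "\<exists>p. rel z p" "\<exists>p. rel (inverse z) p"
      using ideal_poly_if_notin nz unfolding rel_def by blast+
    have p: "rel z p" "\<And>r. rel z r \<Longrightarrow> Polynomial.degree p \<le> Polynomial.degree r"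
      unfolding p_def using ex arg_min_natI arg_min_nat_le by metis+
    have q: "rel (inverse z) q" "\<And>r. rel (inverse z) r \<Longrightarrow> Polynomial.degree q \<le> Polynomial.degree r"
      unfolding q_def using ex arg_min_natI arg_min_nat_le by metis+
    show False
    proof (cases "Polynomial.degree q \<le> Polynomial.degree p")
      case True
      with ideal_poly_lower_degree[of p z q] p q nz show False
        unfolding rel_def by (meson not_less)
    next
      case False
      with ideal_poly_lower_degree[of q "inverse z" p] p q nz show False
        unfolding rel_def by (metis inverse_inverse_eq inverse_zero_imp_zero nle_le not_less)
    qed
  qed
qed

end

text \<open>
  If \<open>x\<close> is not integral, the ring extended by \<open>1 / x\<close> does not contain \<open>x\<close>, and Zorn's lemma enlarges it
  to a ring as above, a valuation ring without \<open>x\<close>.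
\<close>

theorem (in unital_subring) integral_if_mem_valuation_rings:
  assumes "\<And>B. valuation_ring B \<Longrightarrow> R \<subseteq> B \<Longrightarrow> x \<in> B"
  shows "integral_over R x"
proof (rule ccontr)
  assume not_int: "\<not> integral_over R x"
  have "x \<noteq> 0"
  proof
    assume "x = 0"
    then have "integral_over R x"
      unfolding integral_over_def
      by (intro exI[of _ "Polynomial.monom 1 1"]) (auto simp: poly_monom degree_monom_eq)
    with not_int show False ..
  qed
  define \<S> where "\<S> = {B. unital_subring B \<and> R \<subseteq> B \<and> inverse x \<in> B \<and> x \<notin> B}"
  have "\<exists>M\<in>\<S>. \<forall>B\<in>\<S>. M \<subseteq> B \<longrightarrow> B = M"
  proof (rule subset_Zorn_nonempty)
    have "adjoin (inverse x) \<in> \<S>"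
      using integral_if_mem_adjoin_inverse \<open>x \<noteq> 0\<close> not_int
        unital_subring_adjoin subset_adjoin mem_adjoin
      by (auto simp: \<S>_def)
    then show "\<S> \<noteq> {}" by blast
  next
    fix C assume C: "C \<noteq> {}" "subset.chain \<S> C"
    then have CS: "\<And>B. B \<in> C \<Longrightarrow> B \<in> \<S>" by (auto simp: subset.chain_def)
    have two: "\<exists>B\<in>C. a \<in> B \<and> b \<in> B" if "a \<in> \<Union>C" "b \<in> \<Union>C" for a b
      using that C(2) by (meson UnionE subset.chain_def subset_chain_def subsetD)
    have "unital_subring (\<Union>C)"
    proof
      show "1 \<in> \<Union>C" using C(1) CS unital_subring.one_mem unfolding \<S>_def by blast
    next
      fix a b assume "a \<in> \<Union>C" "b \<in> \<Union>C"
      with two obtain B where B: "B \<in> C" "a \<in> B" "b \<in> B" by blast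
      then interpret B: unital_subring B using CS by (auto simp: \<S>_def)
      show "a - b \<in> \<Union>C" "a * b \<in> \<Union>C" using B B.diff_mem B.mult_mem by blast+
    qed
    then show "\<Union>C \<in> \<S>" using C(1) CS unfolding \<S>_def by blast
  qed
  then obtain M where M: "M \<in> \<S>" "\<And>B. B \<in> \<S> \<Longrightarrow> M \<subseteq> B \<Longrightarrow> B = M" by blast
  have "maximal_avoiding M x"
    unfolding maximal_avoiding_def maximal_avoiding_axioms_def
    using M unfolding \<S>_def by blast
  then have "valuation_ring M" by (rule maximal_avoiding.valuation_ring)
  with assms[of M] M show False by (auto simp: \<S>_def)
qed

section \<open>Areas and volumes as polynomials in the squared edge lengths\<close>

text \<open>
  The inner product of the vectors from the point \<open>k\<close> to the points \<open>a\<close> and \<open>b\<close>.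
\<close>

definition gram :: "(nat \<Rightarrow> nat \<Rightarrow> 'a :: field_char_0) \<Rightarrow> nat \<Rightarrow> nat \<Rightarrow> nat \<Rightarrow> 'a" where
  "gram s k a b = (s k a + s k b - s a b) / 2"

text \<open>
  Four times the square of the area of a triangle: the squared length of the bivector spanned by two
  of its sides.
\<close>

definition face_sq :: "(nat \<Rightarrow> nat \<Rightarrow> 'a :: field_char_0) \<Rightarrow> nat \<Rightarrow> nat \<Rightarrow> nat \<Rightarrow> 'a" where
  "face_sq s a b c = gram s a b b * gram s a c c - (gram s a b c)\<^sup>2"

text \<open>
  In the tetrahedron \<open>a b c d\<close>, let every face have an outward normal whose squared length is \<open>face_sq\<close>
  of the face.  This is the inner product of the normals opposite to \<open>a\<close> and to \<open>b\<close>; the common edge of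
  these two faces is \<open>c d\<close>.
\<close>

definition normal_inner :: "(nat \<Rightarrow> nat \<Rightarrow> 'a :: field_char_0) \<Rightarrow> nat \<Rightarrow> nat \<Rightarrow> nat \<Rightarrow> nat \<Rightarrow> 'a" where
  "normal_inner s a b c d = gram s c d a * gram s c d b - gram s c d d * gram s c a b"

text \<open>
  The determinant of the symmetric matrix with diagonal \<open>u\<close>, \<open>v\<close>, \<open>w\<close> and the entry \<open>x\<close>, \<open>y\<close>, \<open>z\<close>
  off the diagonal in the minor complementary to \<open>u\<close>, \<open>v\<close>, \<open>w\<close>, respectively.
\<close>

definition det3 :: "'a :: field \<Rightarrow> 'a \<Rightarrow> 'a \<Rightarrow> 'a \<Rightarrow> 'a \<Rightarrow> 'a \<Rightarrow> 'a" where
  "det3 u v w x y z = u * v * w + 2 * x * y * z - u * x\<^sup>2 - v * y\<^sup>2 - w * z\<^sup>2"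

text \<open>
  The Gram determinant of a tetrahedron, which is 36 times its squared volume.
\<close>

definition tetra_sq :: "(nat \<Rightarrow> nat \<Rightarrow> 'a :: field_char_0) \<Rightarrow> nat \<Rightarrow> nat \<Rightarrow> nat \<Rightarrow> nat \<Rightarrow> 'a" where
  "tetra_sq s a b c d = det3 (gram s a b b) (gram s a c c) (gram s a d d)
     (gram s a c d) (gram s a b d) (gram s a b c)"

locale distances =
  fixes s :: "nat \<Rightarrow> nat \<Rightarrow> 'a :: field_char_0"
  assumes sym: "s a b = s b a" and diag [simp]: "s a a = 0"
begin

lemma gram_self: "gram s k a a = s k a"
  by (simp add: gram_def)

lemma gram_sym: "gram s k a b = gram s k b a"
  by (simp add: gram_def sym[of a b])

lemma gram_base [simp]: "gram s k k a = 0" "gram s k a k = 0"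
  by (simp_all add: gram_def sym[of a k])

lemma gram_change_base: "gram s k a b = gram s l a b - gram s l a k - gram s l b k + gram s l k k"
  by (simp add: gram_def sym[of l] sym[of k a] sym[of k b] field_simps)

lemma face_sq_eq_heron: "face_sq s a b c = 4 * heron s a b c"
  unfolding face_sq_def heron_def gram_def diag sym[of b a] sym[of c a] sym[of c b]
  by (simp add: field_simps power2_eq_square)

lemma face_sq_perm: "face_sq s a b c = face_sq s b a c" "face_sq s a b c = face_sq s a c b"
  unfolding face_sq_def gram_def diag sym[of b a] sym[of c a] sym[of c b]
  by (simp_all add: field_simps power2_eq_square)

lemma normal_inner_sym: "normal_inner s a b c d = normal_inner s b a c d"
  by (simp add: normal_inner_def gram_sym[of c a b])

lemma normal_inner_edge_sym: "normal_inner s a b c d = normal_inner s a b d c"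
  unfolding normal_inner_def gram_def diag sym[of b a] sym[of c a] sym[of c b] sym[of d a] sym[of d b] sym[of d c]
  by (simp add: field_simps power2_eq_square)

lemma tetra_sq_perm:
  "tetra_sq s a b c d = tetra_sq s b a c d" 
  "tetra_sq s a b c d = tetra_sq s a c b d" 
  "tetra_sq s a b c d = tetra_sq s a b d c" 
  unfolding tetra_sq_def det3_def gram_def diag sym[of b a] sym[of c a] sym[of c b] sym[of d a] sym[of d b] sym[of d c]
  by (simp_all add: field_simps power2_eq_square)

lemma normals_sum_zero:
  "normal_inner s a b c d + normal_inner s a c b d + normal_inner s a d b c = - face_sq s b c d"
  unfolding normal_inner_def face_sq_def gram_def diag sym[of b a] sym[of c a] sym[of c b] sym[of d a] sym[of d b] sym[of d c]
  by (simp add: field_simps power2_eq_square)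

text \<open>
  The Gram matrix of the normals opposite to \<open>b\<close>, \<open>c\<close>, \<open>d\<close> is the adjugate of the Gram matrix of the
  edges from \<open>k\<close>.  So the adjugate of the former is the latter times \<open>tetra_sq\<close>, which is expressed
  entrywise by this lemma and the next one, and the determinant of the former is the square of
  \<open>tetra_sq\<close>.
\<close>

lemma tetra_gram_diag:
  "tetra_sq s k b c d * gram s k b b =
     face_sq s k b d * face_sq s k b c - (normal_inner s c d k b)\<^sup>2"
  unfolding tetra_sq_def det3_def normal_inner_def face_sq_def gram_sym[of k c b] gram_sym[of k d b] gram_sym[of k d c]
  by (simp add: algebra_simps power2_eq_square)

lemma tetra_gram_off_diag:
  "tetra_sq s k b c d * gram s k b c =
     normal_inner s b d k c * normal_inner s c d k b - normal_inner s b c k d * face_sq s k b c"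
  unfolding tetra_sq_def det3_def normal_inner_def face_sq_def gram_sym[of k c b] gram_sym[of k d b] gram_sym[of k d c]
  by (simp add: algebra_simps power2_eq_square)

lemma tetra_sq_squared:
  "(tetra_sq s k b c d)\<^sup>2 = det3 (face_sq s k c d) (face_sq s k b d) (face_sq s k b c)
     (normal_inner s c d k b) (normal_inner s b d k c) (normal_inner s b c k d)"
  unfolding tetra_sq_def det3_def normal_inner_def face_sq_def gram_sym[of k c b] gram_sym[of k d b] gram_sym[of k d c]
  by (simp add: algebra_simps power2_eq_square)

end

section \<open>The divisibility preorder of a valuation ring\<close>

text \<open>
  Statements about orders of magnitude at a place are written with the preorder \<open>x \<le>\<^sub>v y\<close>: the quotient
  \<open>x / y\<close> is finite.  It behaves like the comparison of ultrametric absolute values.  As the ring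
  contains the rational numbers, numerals do not change the order of magnitude.
\<close>

locale char_zero_valuation_ring = valuation_ring R for R :: "'a :: field_char_0 set" +
  assumes of_rat_mem: "of_rat r \<in> R"
begin

definition vle :: "'a \<Rightarrow> 'a \<Rightarrow> bool" (infix "\<le>\<^sub>v" 50) where
  "x \<le>\<^sub>v y \<longleftrightarrow> (\<exists>r\<in>R. x = r * y)"

abbreviation vlt :: "'a \<Rightarrow> 'a \<Rightarrow> bool" (infix "<\<^sub>v" 50) where
  "x <\<^sub>v y \<equiv> \<not> y \<le>\<^sub>v x"

lemma vle_one [simp]: "x \<le>\<^sub>v 1 \<longleftrightarrow> x \<in> R"
  by (simp add: vle_def)

lemma vle_refl [simp, intro]: "x \<le>\<^sub>v x"
  unfolding vle_def by (auto intro: bexI[of _ 1])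

lemma vle_trans [trans]: "x \<le>\<^sub>v y \<Longrightarrow> y \<le>\<^sub>v z \<Longrightarrow> x \<le>\<^sub>v z"
  unfolding vle_def by (metis mult.assoc mult_mem)

lemma vle_zero [simp, intro]: "0 \<le>\<^sub>v x"
  unfolding vle_def by (auto intro: bexI[of _ 0])

lemma vle_zero_iff [simp]: "x \<le>\<^sub>v 0 \<longleftrightarrow> x = 0"
  by (auto simp: vle_def)

lemma vle_total: "x \<le>\<^sub>v y \<or> y \<le>\<^sub>v x"
proof (cases "x = 0 \<or> y = 0")
  case False
  consider "x / y \<in> R" | "y / x \<in> R"
    using mem_or_inverse_mem[of "x / y"] by auto
  then show ?thesis
    unfolding vle_def using False by cases (metis nonzero_eq_divide_eq)+
qed auto

lemma vlt_imp_vle: "x <\<^sub>v y \<Longrightarrow> x \<le>\<^sub>v y"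
  using vle_total by blast

lemma vlt_vle_trans [trans]: "x <\<^sub>v y \<Longrightarrow> y \<le>\<^sub>v z \<Longrightarrow> x <\<^sub>v z"
  using vle_trans by blast

lemma vle_vlt_trans [trans]: "x \<le>\<^sub>v y \<Longrightarrow> y <\<^sub>v z \<Longrightarrow> x <\<^sub>v z"
  using vle_trans by blast

lemma vle_minus [simp]: "- x \<le>\<^sub>v z \<longleftrightarrow> x \<le>\<^sub>v z" "z \<le>\<^sub>v - x \<longleftrightarrow> z \<le>\<^sub>v x"
  unfolding vle_def by (metis minus_mem minus_minus mult_minus_left mult_minus_right)+

lemma vle_add: "x \<le>\<^sub>v z \<Longrightarrow> y \<le>\<^sub>v z \<Longrightarrow> x + y \<le>\<^sub>v z"
  unfolding vle_def by (metis add_mem distrib_right)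

lemma vle_diff: "x \<le>\<^sub>v z \<Longrightarrow> y \<le>\<^sub>v z \<Longrightarrow> x - y \<le>\<^sub>v z"
  using vle_add[of x z "- y"] by simp

lemma vle_mult: "x \<le>\<^sub>v y \<Longrightarrow> u \<le>\<^sub>v v \<Longrightarrow> x * u \<le>\<^sub>v y * v"
  unfolding vle_def by (metis mult.assoc mult.left_commute mult_mem)

lemma vle_mult_left: "x \<le>\<^sub>v y \<Longrightarrow> z * x \<le>\<^sub>v z * y"
  by (rule vle_mult) auto

lemma vle_mult_mem: "r \<in> R \<Longrightarrow> x \<le>\<^sub>v y \<Longrightarrow> r * x \<le>\<^sub>v y"
  using vle_mult[of r 1 x y] by simp

lemma vle_cancel: "z \<noteq> 0 \<Longrightarrow> z * x \<le>\<^sub>v z * y \<longleftrightarrow> x \<le>\<^sub>v y"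
  by (auto simp: vle_def mult.left_commute)

lemma vle_power: "x \<le>\<^sub>v y \<Longrightarrow> x ^ k \<le>\<^sub>v y ^ k"
  by (induction k) (auto intro: vle_mult)

lemma vlt_mult: "x <\<^sub>v y \<Longrightarrow> u \<le>\<^sub>v v \<Longrightarrow> v \<noteq> 0 \<Longrightarrow> x * u <\<^sub>v y * v"
  by (metis mult.commute vle_cancel vle_mult_left vle_trans)

lemma vlt_mult_left: "x <\<^sub>v y \<Longrightarrow> z \<noteq> 0 \<Longrightarrow> z * x <\<^sub>v z * y"
  by (simp add: vle_cancel)

lemma vle_square_iff: "x\<^sup>2 \<le>\<^sub>v y\<^sup>2 \<longleftrightarrow> x \<le>\<^sub>v y"
proof
  assume *: "x\<^sup>2 \<le>\<^sub>v y\<^sup>2"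
  show "x \<le>\<^sub>v y"
  proof (rule ccontr)
    assume "y <\<^sub>v x"
    then have "y * y <\<^sub>v x * x" by (intro vlt_mult) (auto intro: vlt_imp_vle)
    with * show False by (simp add: power2_eq_square)
  qed
qed (rule vle_power)

lemma vlt_add: "x <\<^sub>v z \<Longrightarrow> y <\<^sub>v z \<Longrightarrow> x + y <\<^sub>v z"
  by (metis vle_add vle_total vle_vlt_trans)

lemma vlt_diff: "x <\<^sub>v z \<Longrightarrow> y <\<^sub>v z \<Longrightarrow> x - y <\<^sub>v z"
  using vlt_add[of z x "- y"] by simp

lemma vlt_square: "x <\<^sub>v y \<Longrightarrow> x\<^sup>2 <\<^sub>v y\<^sup>2"
  by (simp add: vle_square_iff)

lemma inverse_numeral_mem: "inverse (numeral k) \<in> R"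
  by (metis of_rat_inverse of_rat_mem of_rat_numeral_eq)

lemma vle_numeral_mult [simp]: "numeral k * x \<le>\<^sub>v z \<longleftrightarrow> x \<le>\<^sub>v z"
proof
  assume "numeral k * x \<le>\<^sub>v z"
  then have "inverse (numeral k) * (numeral k * x) \<le>\<^sub>v z"
    by (rule vle_mult_mem[OF inverse_numeral_mem])
  then show "x \<le>\<^sub>v z" by simp
qed (rule vle_mult_mem[OF numeral_mem])

lemma vle_divide_numeral [simp]: "x / numeral k \<le>\<^sub>v z \<longleftrightarrow> x \<le>\<^sub>v z"
  using vle_numeral_mult[of k "x / numeral k" z] by simp

lemma vle_numeral_mult_right [simp]: "z \<le>\<^sub>v numeral k * x \<longleftrightarrow> z \<le>\<^sub>v x"
proof -
  have "x \<le>\<^sub>v numeral k * x" "numeral k * x \<le>\<^sub>v x"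
    using vle_numeral_mult[of k x "numeral k * x"] by auto
  then show ?thesis using vle_trans by blast
qed

lemma vle_sum: "(\<And>i. i \<in> I \<Longrightarrow> f i \<le>\<^sub>v z) \<Longrightarrow> sum f I \<le>\<^sub>v z"
  by (induction I rule: infinite_finite_induct) (auto intro: vle_add)

lemma vle_max_exists:
  assumes "finite I" "I \<noteq> {}"
  shows "\<exists>i\<in>I. \<forall>j\<in>I. f j \<le>\<^sub>v f i"
  using assms
proof (induction I rule: finite_ne_induct)
  case (insert i I)
  then obtain m where m: "m \<in> I" "\<forall>j\<in>I. f j \<le>\<^sub>v f m" by blast
  show ?case
    using vle_total[of "f m" "f i"] m vle_trans by (metis insert_iff vle_refl)
qed auto

end

section \<open>A large tetrahedron of maximal volume and a fifth vertex\<close>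

text \<open>
  An enumeration of the vertices 0, 1, 2, 3 of the large tetrahedron.  Arguments about the tetrahedron
  are carried out for an arbitrary enumeration, which takes care of its symmetry.
\<close>

definition quad :: "nat \<Rightarrow> nat \<Rightarrow> nat \<Rightarrow> nat \<Rightarrow> bool" where
  "quad a b c d \<longleftrightarrow> a < 4 \<and> b < 4 \<and> c < 4 \<and> d < 4 \<and> distinct [a, b, c, d]"

lemma quad_swap:
  "quad a b c d \<Longrightarrow> quad b a c d"
  "quad a b c d \<Longrightarrow> quad a c b d"
  "quad a b c d \<Longrightarrow> quad a b d c"
  by (auto simp: quad_def)

lemma less_4_cases: "(a :: nat) < 4 \<longleftrightarrow> a = 0 \<or> a = 1 \<or> a = 2 \<or> a = 3"
  by auto

lemma quad_extend2:
  assumes "a < 4" "b < 4" "a \<noteq> b"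
  obtains c d where "quad a b c d"
proof -
  have "\<exists>c\<in>{0, 1, 2, 3}. \<exists>d\<in>{0, 1, 2, 3}. quad a b c d"
    using assms unfolding less_4_cases quad_def by (elim disjE) simp_all
  then show ?thesis using that by blast
qed

lemma quad_extend1:
  assumes "a < 4"
  obtains b c d where "quad a b c d"
proof -
  have "\<exists>b<4. a \<noteq> b" by (rule exI[of _ "if a = 0 then 1 else 0"]) simp
  then show ?thesis using quad_extend2[OF assms] that by blast
qed

lemma quad_set: "quad a b c d \<Longrightarrow> {..<4} = {a, b, c, d}"
proof -
  assume q: "quad a b c d"
  then have "{a, b, c, d} \<subseteq> {..<4}" "card {a, b, c, d} = card {..<4::nat}"
    by (auto simp: quad_def)
  then show ?thesis by (metis card_subset_eq finite_lessThan)
qed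

lemma quad_sum: "quad a b c d \<Longrightarrow> (\<Sum>i<4. f i) = f a + f b + f c + (f d :: 'a :: comm_monoid_add)"
  by (subst quad_set, assumption) (auto simp: quad_def add.assoc)

lemma quad_cases: "quad a b c d \<Longrightarrow> e < 4 \<Longrightarrow> e = a \<or> e = b \<or> e = c \<or> e = d"
  using quad_set by blast

text \<open>
  The data of a tetrahedron of infinite volume with finite areas: \<open>p a\<close> is the squared length of the
  normal opposite to the vertex \<open>a\<close>, \<open>x a b\<close> is the inner product of two normals, \<open>D\<close> is the Gram
  determinant and \<open>M\<close> is an \<open>x a b\<close> of largest order.  The normals sum to zero.
\<close>

locale big_tetra = char_zero_valuation_ring R for R :: "'a :: field_char_0 set" +
  fixes p :: "nat \<Rightarrow> 'a" and x :: "nat \<Rightarrow> nat \<Rightarrow> 'a" and D :: 'a and M :: 'a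
  assumes x_sym: "x a b = x b a"
    and p_mem: "a < 4 \<Longrightarrow> p a \<in> R"
    and x_sum: "quad a b c d \<Longrightarrow> x a b + x a c + x a d = - p a"
    and D_sq: "quad k b c d \<Longrightarrow> D\<^sup>2 = det3 (p b) (p c) (p d) (x c d) (x b d) (x b c)"
    and D_notin: "D \<notin> R"
    and M_max: "a < 4 \<Longrightarrow> b < 4 \<Longrightarrow> a \<noteq> b \<Longrightarrow> x a b \<le>\<^sub>v M"
    and M_attained: "\<exists>a b. a < 4 \<and> b < 4 \<and> a \<noteq> b \<and> x a b = M"
begin

lemma det3_vle:
  assumes "p1 \<in> R" "p2 \<in> R" "p3 \<in> R" "y1 \<le>\<^sub>v Y" "y2 \<le>\<^sub>v Y" "y3 \<le>\<^sub>v Y" "1 \<le>\<^sub>v Y"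
  shows "det3 p1 p2 p3 y1 y2 y3 \<le>\<^sub>v Y ^ 3"
proof -
  have "p1 * p2 * p3 \<le>\<^sub>v 1 ^ 3" using assms by (auto intro: mult_mem)
  also have "\<dots> \<le>\<^sub>v Y ^ 3" by (rule vle_power[OF assms(7)])
  finally have 1: "p1 * p2 * p3 \<le>\<^sub>v Y ^ 3" .
  have 2: "y1 * y2 * y3 \<le>\<^sub>v Y ^ 3"
    unfolding power3_eq_cube using assms by (intro vle_mult)
  have 3: "q * y\<^sup>2 \<le>\<^sub>v Y ^ 3" if "q \<in> R" "y \<le>\<^sub>v Y" for q y
  proof -
    have "q * y\<^sup>2 \<le>\<^sub>v Y * (Y * Y)"
      unfolding power2_eq_square using that assms vle_trans[of q 1 Y] by (intro vle_mult) auto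
    then show ?thesis by (simp add: power3_eq_cube mult.assoc)
  qed
  show ?thesis unfolding det3_def mult.assoc[of 2] using 1 2 3 assms
    by (auto simp: mult.assoc intro!: vle_add vle_diff)
qed

lemma M_notin: "M \<notin> R"
proof
  assume "M \<in> R"
  have "x a b \<le>\<^sub>v 1" if "a < 4" "b < 4" "a \<noteq> b" for a b
    using M_max[OF that] \<open>M \<in> R\<close> vle_trans[of "x a b" M 1] by simp
  moreover have q: "quad 0 1 2 3" by (simp add: quad_def)
  ultimately have "D\<^sup>2 \<le>\<^sub>v 1 ^ 3"
    unfolding D_sq[OF q] by (intro det3_vle p_mem) auto
  then have "D\<^sup>2 \<le>\<^sub>v 1\<^sup>2" by simp
  with D_notin show False by (simp only: vle_square_iff) simp
qed

lemma one_less_M: "1 <\<^sub>v M" and one_le_M: "1 \<le>\<^sub>v M"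
  using M_notin vlt_imp_vle[of 1 M] by auto

lemma M_nonzero: "M \<noteq> 0"
  using M_notin by auto

lemma D_sq_vle: "D\<^sup>2 \<le>\<^sub>v M ^ 3"
proof -
  have q: "quad 0 1 2 3" by (simp add: quad_def)
  show ?thesis unfolding D_sq[OF q] by (intro det3_vle p_mem M_max one_le_M) auto
qed

text \<open>
  The relations \<open>x_sum\<close> at \<open>a\<close> and \<open>b\<close> minus those at \<open>c\<close> and \<open>d\<close>.  So up to finite summands there are
  only three different inner products, one for each pair of opposite edges, and their sum is finite.
\<close>

lemma opposite:
  assumes "quad a b c d"
  shows "x a b - x c d \<le>\<^sub>v 1"
proof -
  have "p a = - (x a b + x a c + x a d)" "p b = - (x b a + x b c + x b d)"
    "p c = - (x c a + x c b + x c d)" "p d = - (x d a + x d b + x d c)"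
    using assms x_sum by (auto simp: quad_def)
  then have "2 * (x a b - x c d) = p c + p d - p a - p b"
    by (simp add: x_sym[of b a] x_sym[of c a] x_sym[of d a] x_sym[of c b] x_sym[of d b] x_sym[of d c])
  also have "\<dots> \<le>\<^sub>v 1"
    using assms by (auto simp: quad_def intro!: diff_mem add_mem p_mem)
  finally show ?thesis by (simp only: vle_numeral_mult)
qed

lemma opposite_big:
  assumes "quad a b c d" "M \<le>\<^sub>v x a b"
  shows "M \<le>\<^sub>v x c d"
proof (rule ccontr)
  assume "x c d <\<^sub>v M"
  moreover have "x a b - x c d <\<^sub>v M" using opposite[OF assms(1)] one_less_M by (rule vle_vlt_trans)
  ultimately have "(x a b - x c d) + x c d <\<^sub>v M" by (intro vlt_add)
  with assms(2) show False by simp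
qed

lemma big_at_vertex:
  assumes "a < 4"
  obtains b c d where "quad a b c d" "M \<le>\<^sub>v x a b" "M \<le>\<^sub>v x a c"
proof -
  obtain e f where ef: "e < 4" "f < 4" "e \<noteq> f" "x e f = M" using M_attained by blast
  obtain b where b: "b < 4" "b \<noteq> a" "M \<le>\<^sub>v x a b"
  proof (cases "a = e \<or> a = f")
    case True
    with ef that x_sym show ?thesis by (metis vle_refl)
  next
    case False
    obtain g h where q: "quad e f g h" using quad_extend2 ef by blast
    then have "M \<le>\<^sub>v x g h" using ef by (intro opposite_big[of e f g h]) auto
    moreover have "a = g \<or> a = h" using quad_cases[OF q assms] False by auto
    ultimately show ?thesis using q that x_sym by (metis quad_def distinct_length_2_or_more)
  qed
  obtain c d where q: "quad a b c d" using quad_extend2 assms b by metis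
  have "M \<le>\<^sub>v x a c \<or> M \<le>\<^sub>v x a d"
  proof (rule ccontr)
    assume "\<not> ?thesis"
    moreover have "p a <\<^sub>v M" using p_mem[OF assms] one_less_M vle_vlt_trans[of "p a" 1 M] by simp
    ultimately have "- (p a + x a c + x a d) <\<^sub>v M" unfolding vle_minus by (intro vlt_add) auto
    moreover have "x a b = - (p a + x a c + x a d)"
      using x_sum[OF q] by (simp add: algebra_simps eq_neg_iff_add_eq_0)
    ultimately show False using b by simp
  qed
  then show ?thesis using that q b quad_swap by blast
qed

end

text \<open>
  A fifth point with barycentric coordinates \<open>L a\<close> and with a component orthogonal to the tetrahedron of
  squared length \<open>N * D\<close>.  If \<open>c d\<close> is the edge complementary to \<open>a\<close>, \<open>b\<close>, the expression in \<open>area_mem\<close> and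
  \<open>area_unit\<close> is four times the squared area of the triangle formed by \<open>c d\<close> and the fifth point.  The
  expression in \<open>far\<close> is the squared volume of the tetrahedron with the vertex \<open>a\<close> replaced by the fifth
  point, divided by the squared volume of the original one; it is finite if the latter is maximal.
\<close>

locale companion = big_tetra +
  fixes L :: "nat \<Rightarrow> 'a" and N :: 'a
  assumes L_sum: "(\<Sum>a<4. L a) = 1"
    and far: "a < 4 \<Longrightarrow> (L a)\<^sup>2 + p a * N \<in> R"
    and area_mem: "a < 4 \<Longrightarrow> b < 4 \<Longrightarrow> a \<noteq> b \<Longrightarrow>
      (L a)\<^sup>2 * p b + (L b)\<^sup>2 * p a - 2 * (L a * L b * x a b) + N * (p a * p b - (x a b)\<^sup>2) \<in> R"
    and area_unit: "a < 4 \<Longrightarrow> b < 4 \<Longrightarrow> a \<noteq> b \<Longrightarrow>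
      1 \<le>\<^sub>v (L a)\<^sup>2 * p b + (L b)\<^sup>2 * p a - 2 * (L a * L b * x a b) + N * (p a * p b - (x a b)\<^sup>2)"
begin

text \<open>
  If \<open>N\<close> were infinite, \<open>far\<close> would bound all \<open>(L a)\<^sup>2\<close> by \<open>N\<close>, and the term \<open>N * (x a b)\<^sup>2\<close> of the area
  with the largest \<open>x a b\<close> could not be cancelled by the others.
\<close>

lemma N_mem: "N \<in> R"
proof (rule ccontr)
  assume "N \<notin> R"
  then have N: "1 <\<^sub>v N" "1 \<le>\<^sub>v N" "N \<noteq> 0" using vlt_imp_vle[of 1 N] by auto
  have L2: "(L a)\<^sup>2 \<le>\<^sub>v N" if "a < 4" for a
  proof -
    have "((L a)\<^sup>2 + p a * N) - p a * N \<le>\<^sub>v N"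
      using far[OF that] N vle_trans[of _ 1 N] p_mem[OF that]
      by (intro vle_diff vle_mult_mem) auto
    then show ?thesis by simp
  qed
  obtain a b where ab: "a < 4" "b < 4" "a \<noteq> b" and M: "x a b = M" using M_attained by blast
  have LL: "L a * L b \<le>\<^sub>v N"
  proof -
    have "(L a)\<^sup>2 * (L b)\<^sup>2 \<le>\<^sub>v N * N" using L2 ab by (intro vle_mult)
    then have "(L a * L b)\<^sup>2 \<le>\<^sub>v N\<^sup>2" by (simp add: power2_eq_square mult.assoc mult.left_commute)
    then show ?thesis by (simp only: vle_square_iff)
  qed
  define E where "E = (L a)\<^sup>2 * p b + (L b)\<^sup>2 * p a - 2 * (L a * L b * M) + N * (p a * p b - M\<^sup>2)"
  have E: "E \<le>\<^sub>v 1" using area_mem[OF ab] by (simp add: E_def M)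
  have NM: "N \<le>\<^sub>v N * M" using vle_mult_left[OF one_le_M, of N] by simp
  have "N * M * M = (L a)\<^sup>2 * p b + (L b)\<^sup>2 * p a - 2 * (L a * L b * M) + N * (p a * p b) - E"
    by (simp add: E_def algebra_simps power2_eq_square)
  also have "\<dots> \<le>\<^sub>v N * M"
  proof (intro vle_add vle_diff)
    show "(L a)\<^sup>2 * p b \<le>\<^sub>v N * M" "(L b)\<^sup>2 * p a \<le>\<^sub>v N * M"
      using L2 ab p_mem NM by (metis mult.commute vle_mult_mem vle_trans)+
    show "N * (p a * p b) \<le>\<^sub>v N * M"
      using ab p_mem NM by (metis mult.commute mult_mem vle_mult_mem vle_refl vle_trans)
    show "E \<le>\<^sub>v N * M" using E N NM vle_trans by blast
    show "2 * (L a * L b * M) \<le>\<^sub>v N * M"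
      unfolding vle_numeral_mult by (intro vle_mult LL vle_refl)
  qed
  finally have "(N * M) * M \<le>\<^sub>v (N * M) * 1" by simp
  then have "M \<le>\<^sub>v 1" using N M_nonzero by (subst (asm) vle_cancel) auto
  with M_notin show False by simp
qed

lemma L_mem: "a < 4 \<Longrightarrow> L a \<in> R"
proof -
  assume a: "a < 4"
  have "((L a)\<^sup>2 + p a * N) - p a * N \<in> R"
    using far[OF a] p_mem[OF a] N_mem by (intro diff_mem mult_mem)
  then have "(L a)\<^sup>2 \<le>\<^sub>v 1\<^sup>2" by simp
  then show "L a \<in> R" by (simp only: vle_square_iff) simp
qed

lemma near_quadric:
  assumes "a < 4" "b < 4" "a \<noteq> b"
  shows "2 * (L a * L b * x a b) + N * (x a b)\<^sup>2 \<le>\<^sub>v 1"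
proof -
  have "((L a)\<^sup>2 * p b + (L b)\<^sup>2 * p a + N * (p a * p b)) -
    ((L a)\<^sup>2 * p b + (L b)\<^sup>2 * p a - 2 * (L a * L b * x a b) + N * (p a * p b - (x a b)\<^sup>2)) \<in> R"
    using assms by (intro diff_mem add_mem mult_mem power_mem area_mem L_mem N_mem p_mem)
  then show ?thesis by (simp add: algebra_simps)
qed

text \<open>
  Suppose that \<open>N * M\<^sup>2\<close> is infinite.  By \<open>near_quadric\<close> the product \<open>2 * L a * L b\<close> then is \<open>- N * x a b\<close>
  to leading order whenever \<open>x a b\<close> has the order of \<open>M\<close>.  The product of all four coordinates is
  therefore \<open>(N * x a b)\<^sup>2 / 4\<close> to leading order for at least two of the three pairs of opposite edges,
  so that two of the three inner products agree up to sign.  If they were equal, the third one would be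
  \<open>-2\<close> times as large and would itself be subject to the same conclusion, although 4 is not 1.  If they
  are opposite, the coordinates cancel in pairs and cannot sum to 1.
\<close>

lemma N_small: "N * M\<^sup>2 \<in> R"
proof (rule ccontr)
  assume "N * M\<^sup>2 \<notin> R"
  then have big: "1 <\<^sub>v N * M\<^sup>2" by simp
  then have NM0: "N * M \<noteq> 0" "N \<noteq> 0" by auto
  have NMM: "N <\<^sub>v N * M" using vlt_mult_left[OF one_less_M NM0(2)] by simp
  \<comment> \<open>The relation \<open>near_quadric\<close> is divided by \<open>x e f\<close>, which has the order of \<open>M\<close>.\<close>
  have prod: "2 * (L e * L f) + N * x e f <\<^sub>v N * M" if "e < 4" "f < 4" "e \<noteq> f" "M \<le>\<^sub>v x e f" for e f
  proof
    assume "N * M \<le>\<^sub>v 2 * (L e * L f) + N * x e f"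
    then have "N * M * M \<le>\<^sub>v (2 * (L e * L f) + N * x e f) * x e f"
      using that by (intro vle_mult)
    also have "\<dots> = 2 * (L e * L f * x e f) + N * (x e f)\<^sup>2"
      by (simp add: algebra_simps power2_eq_square)
    also have "\<dots> \<le>\<^sub>v 1" using that by (intro near_quadric)
    finally show False using big by (simp add: power2_eq_square mult.assoc)
  qed
  have opp: "2 * (L e * L f) + N * x a b <\<^sub>v N * M" if "quad a b e f" "M \<le>\<^sub>v x a b" for a b e f
  proof -
    have "2 * (L e * L f) + N * x e f <\<^sub>v N * M"
      using that opposite_big[OF that] by (intro prod) (auto simp: quad_def)
    moreover have "N * (x a b - x e f) <\<^sub>v N * M"
      using vle_vlt_trans[OF vle_mult_left[OF opposite[OF that(1)], of N]] NMM by simp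
    ultimately have "(2 * (L e * L f) + N * x e f) + N * (x a b - x e f) <\<^sub>v N * M"
      by (rule vlt_add)
    then show ?thesis by (simp add: algebra_simps)
  qed
  define \<Lambda> where "\<Lambda> = 4 * (L 0 * L 1 * L 2 * L 3)"
  have \<Lambda>: "\<Lambda> = 4 * (L a * L b * L c * L d)" if "quad a b c d" for a b c d
  proof -
    have "prod L {a, b, c, d} = prod L {0, 1, 2, 3}"
      using quad_set[OF that] quad_set[of 0 1 2 3] by (simp add: quad_def)
    then show ?thesis using that by (simp add: \<Lambda>_def quad_def mult.assoc)
  qed
  have pair: "\<Lambda> - (N * x a b)\<^sup>2 <\<^sub>v (N * M)\<^sup>2" if "quad a b c d" "M \<le>\<^sub>v x a b" for a b c d
  proof -
    have 1: "2 * (L a * L b) + N * x a b <\<^sub>v N * M" "2 * (L c * L d) + N * x a b <\<^sub>v N * M"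
      using prod[of a b] opp[OF that] that by (auto simp: quad_def)
    have xM: "x a b \<le>\<^sub>v M" using that by (intro M_max) (auto simp: quad_def)
    have 2: "2 * (L a * L b) \<le>\<^sub>v N * M"
    proof -
      have "(2 * (L a * L b) + N * x a b) - N * x a b \<le>\<^sub>v N * M"
        using 1 xM by (intro vle_diff vle_mult_left) (auto intro: vlt_imp_vle)
      then show ?thesis by simp
    qed
    have "\<Lambda> - (N * x a b)\<^sup>2 = (2 * (L c * L d) + N * x a b) * (2 * (L a * L b)) -
        (2 * (L a * L b) + N * x a b) * (N * x a b)"
      unfolding \<Lambda>[OF that(1)] by (simp add: algebra_simps power2_eq_square)
    also have "\<dots> <\<^sub>v N * M * (N * M)"
      using 1 2 xM NM0 by (intro vlt_diff vlt_mult vle_mult_left)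
    finally show ?thesis by (simp add: power2_eq_square)
  qed
  have sq: "(x a b)\<^sup>2 - (x a c)\<^sup>2 <\<^sub>v M\<^sup>2" if "quad a b c d" "M \<le>\<^sub>v x a b" "M \<le>\<^sub>v x a c" for a b c d
  proof -
    have "(\<Lambda> - (N * x a c)\<^sup>2) - (\<Lambda> - (N * x a b)\<^sup>2) <\<^sub>v (N * M)\<^sup>2"
      by (rule vlt_diff[OF pair[OF quad_swap(2)[OF that(1)] that(3)] pair[OF that(1,2)]])
    moreover have "(\<Lambda> - (N * x a c)\<^sup>2) - (\<Lambda> - (N * x a b)\<^sup>2) = N\<^sup>2 * ((x a b)\<^sup>2 - (x a c)\<^sup>2)"
      by (simp add: power_mult_distrib algebra_simps)
    ultimately show ?thesis using NM0(2) by (simp add: power_mult_distrib vle_cancel)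
  qed
  define a :: nat where "a = 0"
  obtain b c d where q: "quad a b c d" and xb: "M \<le>\<^sub>v x a b" and xc: "M \<le>\<^sub>v x a c"
    by (rule big_at_vertex[of a]) (auto simp: a_def)
  have less: "a < 4" "b < 4" "c < 4" "d < 4" "a \<noteq> b" "a \<noteq> c" "a \<noteq> d" "b \<noteq> c" "b \<noteq> d" "c \<noteq> d"
    using q by (auto simp: quad_def)
  have pM: "p a <\<^sub>v M" using p_mem[OF less(1)] one_less_M vle_vlt_trans[of "p a" 1 M] by simp
  have "x a b - x a c <\<^sub>v M \<or> x a b + x a c <\<^sub>v M"
  proof (rule ccontr)
    assume "\<not> ?thesis"
    then have "M * M \<le>\<^sub>v (x a b - x a c) * (x a b + x a c)" by (intro vle_mult) auto
    also have "\<dots> = (x a b)\<^sup>2 - (x a c)\<^sup>2" by (simp add: algebra_simps power2_eq_square)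
    finally show False using sq[OF q xb xc] by (simp add: power2_eq_square)
  qed
  then show False
  proof
    assume eq: "x a b - x a c <\<^sub>v M"
    have p_eq: "p a = - (x a b + x a c + x a d)" using x_sum[OF q] by simp
    have zeq: "x a d + 2 * x a b = (x a b - x a c) - p a"
      by (simp add: p_eq)
    have zd: "x a d + 2 * x a b <\<^sub>v M"
      unfolding zeq by (rule vlt_diff[OF eq pM])
    have "M \<le>\<^sub>v x a d"
    proof (rule ccontr)
      assume "x a d <\<^sub>v M"
      with zd have "(x a d + 2 * x a b) - x a d <\<^sub>v M" by (rule vlt_diff)
      with xb show False by simp
    qed
    then have 1: "(x a b)\<^sup>2 - (x a d)\<^sup>2 <\<^sub>v M\<^sup>2" using xb by (intro sq[OF quad_swap(3)[OF q]])
    have 2: "(x a d + 2 * x a b) * (x a d - 2 * x a b) <\<^sub>v M * M"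
      using zd M_max less M_nonzero by (intro vlt_mult vle_diff) auto
    have "- 3 * (x a b)\<^sup>2 = ((x a b)\<^sup>2 - (x a d)\<^sup>2) + (x a d + 2 * x a b) * (x a d - 2 * x a b)"
      by (simp add: algebra_simps power2_eq_square)
    also have "\<dots> <\<^sub>v M\<^sup>2" using 1 2 by (intro vlt_add) (auto simp: power2_eq_square)
    finally have "(x a b)\<^sup>2 <\<^sub>v M\<^sup>2" by simp
    with xb show False by (simp add: vle_square_iff)
  next
    assume eq: "x a b + x a c <\<^sub>v M"
    have ab: "2 * (L a * L b) + N * x a b <\<^sub>v N * M" and ac: "2 * (L a * L c) + N * x a c <\<^sub>v N * M"
      using prod less xb xc by auto
    have cd: "2 * (L c * L d) + N * x a b <\<^sub>v N * M" and bd: "2 * (L b * L d) + N * x a c <\<^sub>v N * M"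
      using opp[OF q xb] opp[OF quad_swap(2)[OF q] xc] by auto
    have Neq: "N * (x a b + x a c) <\<^sub>v N * M" using eq NM0 by (intro vlt_mult_left)
    have "(2 * (L a * L b) + N * x a b) + (2 * (L b * L d) + N * x a c) - N * (x a b + x a c) <\<^sub>v N * M"
      by (rule vlt_diff[OF vlt_add[OF ab bd] Neq])
    also have "(2 * (L a * L b) + N * x a b) + (2 * (L b * L d) + N * x a c) - N * (x a b + x a c) =
        2 * (L b * (L a + L d))"
      by (simp add: algebra_simps)
    finally have 1: "L b * (L a + L d) <\<^sub>v N * M" by simp
    have "(2 * (L a * L b) + N * x a b) + (2 * (L a * L c) + N * x a c) - N * (x a b + x a c) <\<^sub>v N * M"
      by (rule vlt_diff[OF vlt_add[OF ab ac] Neq])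
    also have "(2 * (L a * L b) + N * x a b) + (2 * (L a * L c) + N * x a c) - N * (x a b + x a c) =
        2 * (L a * (L b + L c))"
      by (simp add: algebra_simps)
    finally have 2: "L a * (L b + L c) <\<^sub>v N * M" by simp
    have LM: "N * M \<le>\<^sub>v L a * L b"
    proof (rule ccontr)
      assume "L a * L b <\<^sub>v N * M"
      then have "2 * (L a * L b) <\<^sub>v N * M" by simp
      with ab have "(2 * (L a * L b) + N * x a b) - 2 * (L a * L b) <\<^sub>v N * M" by (rule vlt_diff)
      moreover have "N * M \<le>\<^sub>v N * x a b" using xb by (rule vle_mult_left)
      ultimately show False by simp
    qed
    with NM0 have "L a \<noteq> 0" "L b \<noteq> 0" by auto
    have "L b * (L a + L d) <\<^sub>v L b * L a" using 1 LM by (metis mult.commute vlt_vle_trans)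
    then have "L a + L d <\<^sub>v L a" using \<open>L b \<noteq> 0\<close> by (simp add: vle_cancel)
    also have "L a \<le>\<^sub>v 1" using L_mem less by simp
    finally have 3: "L a + L d <\<^sub>v 1" .
    have "L a * (L b + L c) <\<^sub>v L a * L b" using 2 LM by (metis vlt_vle_trans)
    then have "L b + L c <\<^sub>v L b" using \<open>L a \<noteq> 0\<close> by (simp add: vle_cancel)
    also have "L b \<le>\<^sub>v 1" using L_mem less by simp
    finally have "L b + L c <\<^sub>v 1" .
    with 3 have "(L a + L d) + (L b + L c) <\<^sub>v 1" by (rule vlt_add)
    moreover have "(L a + L d) + (L b + L c) = 1"
      using L_sum quad_sum[OF q, of L] by (simp add: algebra_simps)
    ultimately show False by simp
  qed
qed

lemma N_x_sq: "a < 4 \<Longrightarrow> b < 4 \<Longrightarrow> a \<noteq> b \<Longrightarrow> N * (x a b)\<^sup>2 \<in> R"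
proof -
  assume "a < 4" "b < 4" "a \<noteq> b"
  then have "N * (x a b)\<^sup>2 \<le>\<^sub>v N * M\<^sup>2" by (intro vle_mult_left vle_power M_max)
  also have "\<dots> \<le>\<^sub>v 1" using N_small by simp
  finally show ?thesis by simp
qed

lemma L_prod: "a < 4 \<Longrightarrow> b < 4 \<Longrightarrow> a \<noteq> b \<Longrightarrow> L a * L b * x a b \<in> R"
proof -
  assume ab: "a < 4" "b < 4" "a \<noteq> b"
  have "(2 * (L a * L b * x a b) + N * (x a b)\<^sup>2) - N * (x a b)\<^sup>2 \<le>\<^sub>v 1"
    using near_quadric[OF ab] N_x_sq[OF ab] by (intro vle_diff) auto
  then have "2 * (L a * L b * x a b) \<le>\<^sub>v 1" by simp
  then show ?thesis unfolding vle_numeral_mult by simp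
qed

lemma unit_coordinate: obtains a where "a < 4" "1 \<le>\<^sub>v L a"
proof -
  have "\<exists>a<4. 1 \<le>\<^sub>v L a"
  proof (rule ccontr)
    assume "\<not> ?thesis"
    then have "L 0 + L 1 + L 2 + L 3 <\<^sub>v 1" by (intro vlt_add) auto
    moreover have "quad 0 1 2 3" by (simp add: quad_def)
    then have "L 0 + L 1 + L 2 + L 3 = 1" using quad_sum[of 0 1 2 3 L] L_sum by simp
    ultimately show False by simp
  qed
  then show ?thesis using that by blast
qed

lemma L_x_mem:
  assumes "a < 4" "1 \<le>\<^sub>v L a" "b < 4" "b \<noteq> a"
  shows "L b * x a b \<in> R"
proof -
  have "1 * (L b * x a b) \<le>\<^sub>v L a * (L b * x a b)" using assms by (intro vle_mult) auto
  also have "\<dots> \<le>\<^sub>v 1" using L_prod[of a b] assms by (simp add: mult.assoc)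
  finally show ?thesis by simp
qed

text \<open>
  The coordinates at \<open>b\<close> and \<open>c\<close> and also \<open>N\<close> are infinitesimal, so in the area of the triangle formed
  by the edge \<open>a d\<close> and the fifth point only the summand \<open>N * (x b c)\<^sup>2\<close> can be a unit.
\<close>

lemma all_big_aux:
  assumes "a < 4" "1 \<le>\<^sub>v L a" "quad a b c d" "M \<le>\<^sub>v x a b" "M \<le>\<^sub>v x a c"
  shows "M \<le>\<^sub>v x b c"
proof (rule ccontr)
  assume small: "x b c <\<^sub>v M"
  have less: "a < 4" "b < 4" "c < 4" "d < 4" "a \<noteq> b" "a \<noteq> c" "a \<noteq> d" "b \<noteq> c" "b \<noteq> d" "c \<noteq> d"
    using assms by (auto simp: quad_def)
  have LM: "L e * M \<in> R" if "e < 4" "e \<noteq> a" "M \<le>\<^sub>v x a e" for e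
  proof -
    have "L e * M \<le>\<^sub>v L e * x a e" using that by (intro vle_mult_left)
    also have "\<dots> \<le>\<^sub>v 1" using L_x_mem[of a e] assms that by simp
    finally show ?thesis by simp
  qed
  have tiny: "y <\<^sub>v 1" if "y * M \<in> R" for y
  proof
    assume "1 \<le>\<^sub>v y"
    then have "1 * M \<le>\<^sub>v y * M" by (intro vle_mult) auto
    also have "\<dots> \<le>\<^sub>v 1" using that by simp
    finally show False using M_notin by simp
  qed
  have Lb: "L b * M \<in> R" and Lc: "L c * M \<in> R" using LM less assms by auto
  have "(L b)\<^sup>2 * p c <\<^sub>v 1" "(L c)\<^sup>2 * p b <\<^sub>v 1"
  proof -
    have "((L b)\<^sup>2 * p c) * M = (L b * M) * (L b * p c)" "((L c)\<^sup>2 * p b) * M = (L c * M) * (L c * p b)"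
      by (simp_all add: power2_eq_square)
    then show "(L b)\<^sup>2 * p c <\<^sub>v 1" "(L c)\<^sup>2 * p b <\<^sub>v 1"
      using Lb Lc less L_mem p_mem mult_mem by (metis tiny)+
  qed
  moreover have "2 * (L b * L c * x b c) <\<^sub>v 1"
  proof -
    have "L b * (L c * x b c) <\<^sub>v 1"
    proof
      assume "1 \<le>\<^sub>v L b * (L c * x b c)"
      also have "\<dots> \<le>\<^sub>v L b * (L c * M)" using small by (intro vle_mult_left) (rule vlt_imp_vle)
      also have "\<dots> \<le>\<^sub>v L b * 1" using Lc by (intro vle_mult_left) simp
      finally show False using tiny[OF Lb] by simp
    qed
    then show ?thesis by (simp add: mult.assoc)
  qed
  moreover have "N * (p b * p c) <\<^sub>v 1"
  proof (rule tiny)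
    have "N * M \<le>\<^sub>v N * M * M" using vle_mult_left[OF one_le_M, of "N * M"] by simp
    also have "\<dots> \<le>\<^sub>v 1" using N_small by (simp add: power2_eq_square mult.assoc)
    finally have "(N * M) * (p b * p c) \<in> R" using less p_mem by (intro mult_mem[OF _ mult_mem]) auto
    then show "N * (p b * p c) * M \<in> R" by (simp add: mult.commute mult.left_commute)
  qed
  moreover have "N * (x b c)\<^sup>2 <\<^sub>v 1"
  proof (cases "N = 0")
    case False
    then have "N * (x b c)\<^sup>2 <\<^sub>v N * M\<^sup>2" using small by (intro vlt_mult_left vlt_square)
    also have "N * M\<^sup>2 \<le>\<^sub>v 1" using N_small by simp
    finally show ?thesis .
  qed auto
  ultimately have "(L b)\<^sup>2 * p c + (L c)\<^sup>2 * p b - 2 * (L b * L c * x b c) +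
      (N * (p b * p c) - N * (x b c)\<^sup>2) <\<^sub>v 1"
    by (metis vlt_add vlt_diff)
  with area_unit[of b c] less show False by (simp add: algebra_simps)
qed

lemma all_big:
  assumes "e < 4" "f < 4" "e \<noteq> f"
  shows "M \<le>\<^sub>v x e f"
proof -
  obtain a where a: "a < 4" "1 \<le>\<^sub>v L a" by (rule unit_coordinate)
  obtain b c d where q: "quad a b c d" and big: "M \<le>\<^sub>v x a b" "M \<le>\<^sub>v x a c"
    by (rule big_at_vertex[OF a(1)])
  have bc: "M \<le>\<^sub>v x b c" by (rule all_big_aux[OF a q big])
  have "M \<le>\<^sub>v x c d" by (rule opposite_big[OF q big(1)])
  moreover have "M \<le>\<^sub>v x b d" by (rule opposite_big[OF quad_swap(2)[OF q] big(2)])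
  moreover have "quad b c a d" using q by (auto simp: quad_def)
  then have "M \<le>\<^sub>v x a d" using bc by (rule opposite_big)
  ultimately show ?thesis
    using quad_cases[OF q assms(1)] quad_cases[OF q assms(2)] assms(3) bc big x_sym by metis
qed

text \<open>
  The fifth point is near the vertex \<open>a\<close>.
\<close>

lemma near_vertex:
  obtains a where "a < 4" "1 \<le>\<^sub>v L a" "\<And>b. b < 4 \<Longrightarrow> b \<noteq> a \<Longrightarrow> L b * M \<in> R"
proof -
  obtain a where a: "a < 4" "1 \<le>\<^sub>v L a" by (rule unit_coordinate)
  have "L b * M \<in> R" if "b < 4" "b \<noteq> a" for b
  proof -
    have "L b * M \<le>\<^sub>v L b * x a b" using that a all_big[of a b] by (intro vle_mult_left) auto
    also have "\<dots> \<le>\<^sub>v 1" using L_x_mem[OF a that] by simp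
    finally show ?thesis by simp
  qed
  with a that show ?thesis by blast
qed

end

text \<open>
  In addition, \<open>q k a b\<close> is the inner product of the edges from the vertex \<open>k\<close> to \<open>a\<close> and to \<open>b\<close>.
\<close>

locale gram_tetra = big_tetra +
  fixes q :: "nat \<Rightarrow> nat \<Rightarrow> nat \<Rightarrow> 'a"
  assumes q_sym: "q k a b = q k b a"
    and q_base: "q k k b = 0"
    and p_gram: "quad k b c d \<Longrightarrow> p b = q k c c * q k d d - (q k c d)\<^sup>2"
    and x_gram: "quad k b c d \<Longrightarrow> x b c = q k d b * q k d c - q k d d * q k b c"
    and D_gram_diag: "quad k b c d \<Longrightarrow> D * q k b b = p c * p d - (x c d)\<^sup>2"
    and D_gram: "quad k b c d \<Longrightarrow> D * q k b c = x b d * x c d - x b c * p d"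
begin

lemma D_q_vle:
  assumes "k < 4" "b < 4" "c < 4"
  shows "D * q k b c \<le>\<^sub>v M\<^sup>2"
proof -
  have small: "y \<le>\<^sub>v M\<^sup>2" if "y \<in> R" for y
    using that vle_power[OF one_le_M, of 2] vle_trans[of y 1 "M\<^sup>2"] by simp
  have xx: "u * v \<le>\<^sub>v M\<^sup>2" if "u \<le>\<^sub>v M" "v \<le>\<^sub>v M" for u v
    using vle_mult[OF that] by (simp add: power2_eq_square)
  consider "b = k \<or> c = k" | "b \<noteq> k" "c = b" | "b \<noteq> k" "c \<noteq> k" "b \<noteq> c" by blast
  then show ?thesis
  proof cases
    case 1
    then have "q k b c = 0" using q_base q_sym[of k b k] by auto
    then show ?thesis by simp
  next
    case 2
    then obtain e f where "quad k b e f" using quad_extend2 assms by metis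
    note qd = this
    have "p e * p f \<le>\<^sub>v M\<^sup>2" using qd by (intro small mult_mem p_mem) (auto simp: quad_def)
    moreover have "(x e f)\<^sup>2 \<le>\<^sub>v M\<^sup>2" using qd by (intro vle_power M_max) (auto simp: quad_def)
    ultimately show ?thesis
      unfolding 2 D_gram_diag[OF qd] by (rule vle_diff)
  next
    case 3
    then obtain e f where "quad k b e f" using quad_extend2 assms by metis
    with 3 quad_cases[of k b e f c] assms obtain d where qd: "quad k b c d"
      using quad_swap(3) by blast
    have "x b c * p d \<le>\<^sub>v M * M"
      using qd vle_trans[of "p d" 1 M] one_le_M p_mem[of d]
      by (intro vle_mult M_max) (auto simp: quad_def)
    then show ?thesis
      using D_gram[OF qd] qd
      by (auto simp: quad_def power2_eq_square intro!: vle_diff vle_mult M_max)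
  qed
qed

text \<open>
  The inner product of the components in the tetrahedron of two vectors that start at the vertex \<open>k\<close> and
  lead to points with barycentric coordinates \<open>L\<close> and \<open>K\<close>.  The summands with index \<open>k\<close> vanish.
\<close>

definition form :: "nat \<Rightarrow> (nat \<Rightarrow> 'a) \<Rightarrow> (nat \<Rightarrow> 'a) \<Rightarrow> 'a" where
  "form k L K = (\<Sum>e<4. \<Sum>f<4. L e * K f * q k e f)"

lemma D_form: "D * form k L K = (\<Sum>(e, f) \<in> {..<4} \<times> {..<4}. L e * K f * (D * q k e f))"
  unfolding form_def sum_distrib_left sum.cartesian_product
  by (intro sum.cong) (auto simp: mult.commute mult.left_commute)

lemma D_form_vle:
  assumes "k < 4" "\<And>e. e < 4 \<Longrightarrow> L e \<in> R" "\<And>e. e < 4 \<Longrightarrow> K e \<in> R"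
  shows "D * form k L K \<le>\<^sub>v M\<^sup>2"
  unfolding D_form
  by (intro vle_sum, clarify) (use assms in \<open>auto intro!: vle_mult_mem[OF mult_mem] D_q_vle\<close>)

lemma D_form_vle_small:
  assumes "k < 4" "\<And>e. e < 4 \<Longrightarrow> e \<noteq> k \<Longrightarrow> L e * M \<in> R" "\<And>e. e < 4 \<Longrightarrow> K e \<in> R"
  shows "D * form k L K \<le>\<^sub>v M"
proof -
  have "M * (D * form k L K) \<le>\<^sub>v M * M"
    unfolding D_form sum_distrib_left
  proof (intro vle_sum, clarify)
    fix e f :: nat assume ef: "e < 4" "f < 4"
    show "M * (L e * K f * (D * q k e f)) \<le>\<^sub>v M * M"
    proof (cases "e = k")
      case False
      have "(L e * M * K f) * (D * q k e f) \<le>\<^sub>v M\<^sup>2"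
        by (rule vle_mult_mem[OF mult_mem D_q_vle]) (use assms ef False in auto)
      then show ?thesis by (simp add: power2_eq_square mult.commute mult.left_commute)
    qed (simp add: q_base)
  qed
  then show ?thesis using M_nonzero by (simp add: vle_cancel)
qed

lemma M_less_M_sq: "M <\<^sub>v M\<^sup>2"
  using vlt_mult_left[OF one_less_M M_nonzero] by (simp add: power2_eq_square)

lemma D_form_big:
  assumes "k < 4" "a < 4" "b < 4" "1 \<le>\<^sub>v L a" "1 \<le>\<^sub>v K b"
    and "\<And>e. e < 4 \<Longrightarrow> L e \<in> R" "\<And>e. e < 4 \<Longrightarrow> K e \<in> R"
    and "\<And>e. e < 4 \<Longrightarrow> e \<noteq> a \<Longrightarrow> L e * M \<in> R" "\<And>e. e < 4 \<Longrightarrow> e \<noteq> b \<Longrightarrow> K e * M \<in> R"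
    and "M\<^sup>2 \<le>\<^sub>v D * q k a b"
  shows "M\<^sup>2 \<le>\<^sub>v D * form k L K"
proof (rule ccontr)
  assume *: "D * form k L K <\<^sub>v M\<^sup>2"
  let ?t = "\<lambda>(e, f). L e * K f * (D * q k e f)"
  let ?P = "{..<4} \<times> {..<4} - {(a, b)}"
  have "M * sum ?t ?P \<le>\<^sub>v M * M"
    unfolding sum_distrib_left
  proof (intro vle_sum, unfold split_paired_all Diff_iff mem_Sigma_iff singleton_iff case_prod_conv, elim conjE)
    fix e f :: nat assume ne: "(e, f) \<noteq> (a, b)" and ef: "e \<in> {..<4}" "f \<in> {..<4}"
    have "L e * K f * M \<in> R"
    proof (cases "e = a")
      case True
      then have "L e * (K f * M) \<in> R" using ne ef assms by (intro mult_mem[of "L e" "K f * M"]) auto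
      then show ?thesis by (simp add: mult.assoc)
    next
      case False
      then have "K f * (L e * M) \<in> R" using ef assms by (intro mult_mem[of "K f" "L e * M"]) auto
      then show ?thesis by (simp add: mult.commute mult.left_commute)
    qed
    then have "(L e * K f * M) * (D * q k e f) \<le>\<^sub>v M\<^sup>2"
      by (rule vle_mult_mem[OF _ D_q_vle]) (use assms ef in auto)
    then show "M * (L e * K f * (D * q k e f)) \<le>\<^sub>v M * M"
      by (simp add: power2_eq_square mult.commute mult.left_commute)
  qed
  then have "sum ?t ?P \<le>\<^sub>v M" using M_nonzero by (simp add: vle_cancel)
  then have "sum ?t ?P <\<^sub>v M\<^sup>2" using M_less_M_sq by (rule vle_vlt_trans)
  with * have "D * form k L K - sum ?t ?P <\<^sub>v M\<^sup>2" by (rule vlt_diff)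
  moreover have "D * form k L K = ?t (a, b) + sum ?t ?P"
    unfolding D_form using assms(2,3) by (intro sum.remove) auto
  ultimately have "L a * K b * (D * q k a b) <\<^sub>v M\<^sup>2" by simp
  moreover have "1 * 1 * M\<^sup>2 \<le>\<^sub>v L a * K b * (D * q k a b)"
    using assms by (intro vle_mult)
  ultimately show False by simp
qed

text \<open>
  The bivector of two vectors starting at \<open>k\<close> is a combination of the normals opposite to \<open>b\<close>, \<open>c\<close>, \<open>d\<close>
  whose coefficients are the minors of the coordinates.  Its squared length is finite if the products
  of different minors compensate for the inner products of the normals.
\<close>

lemma wedge_mem:
  assumes qd: "quad k b c d"
    and mR: "L c * K d - L d * K c \<in> R" "L d * K b - L b * K d \<in> R" "L b * K c - L c * K b \<in> R"
    and mM: "(L c * K d - L d * K c) * (L d * K b - L b * K d) * M \<in> R"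
      "(L c * K d - L d * K c) * (L b * K c - L c * K b) * M \<in> R"
      "(L d * K b - L b * K d) * (L b * K c - L c * K b) * M \<in> R"
  shows "form k L L * form k K K - (form k L K)\<^sup>2 \<in> R"
proof -
  define u v w where "u = L c * K d - L d * K c" and "v = L d * K b - L b * K d" and "w = L b * K c - L c * K b"
  have qs: "quad k c b d" "quad k d c b" "quad k c d b" "quad k b d c" "quad k d b c"
    using qd by (auto simp: quad_def)
  have f: "form k f g = f b * g b * q k b b + f c * g c * q k c c + f d * g d * q k d d
     + (f b * g c + f c * g b) * q k b c + (f b * g d + f d * g b) * q k b d + (f c * g d + f d * g c) * q k c d" for f g
    unfolding form_def quad_sum[OF qd] q_base q_sym[of k _ k] q_sym[of k c b] q_sym[of k d b] q_sym[of k d c]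
    by (simp add: algebra_simps)
  have "form k L L * form k K K - (form k L K)\<^sup>2 =
      u\<^sup>2 * p b + v\<^sup>2 * p c + w\<^sup>2 * p d + 2 * (u * v * x b c + u * w * x b d + v * w * x c d)"
    unfolding f p_gram[OF qd] p_gram[OF qs(1)] p_gram[OF qs(2)] x_gram[OF qd] x_gram[OF qs(4)] x_gram[OF qs(3)]
      q_sym[of k c b] q_sym[of k d b] q_sym[of k d c] u_def v_def w_def
    by (simp add: algebra_simps power2_eq_square)
  also have "\<dots> \<in> R"
  proof -
    have xm: "y * x e f \<in> R" if "y * M \<in> R" "e < 4" "f < 4" "e \<noteq> f" for y e f
    proof -
      have "y * x e f \<le>\<^sub>v y * M" using that by (intro vle_mult_left M_max)
      also have "\<dots> \<le>\<^sub>v 1" using that by simp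
      finally show ?thesis by simp
    qed
    show ?thesis
      using qd mR mM by (auto simp: quad_def simp flip: u_def v_def w_def
        intro!: add_mem mult_mem[of 2] xm mult_mem[of _ "p _"] power_mem p_mem)
  qed
  finally show ?thesis .
qed

end

section \<open>Two further vertices\<close>

context gram_tetra
begin

text \<open>
  Here \<open>hL\<close>, \<open>hK\<close> and \<open>h\<close> are the inner products of the components, orthogonal to the tetrahedron, of two
  further points.  In the area of the triangle formed by these points and the vertex \<open>k\<close> all terms
  without \<open>h\<close> are finite; what remains is a quadratic polynomial in \<open>h\<close>.
\<close>

lemma quadric_mem:
  assumes "k < 4" "\<And>e. e < 4 \<Longrightarrow> L e \<in> R" "\<And>e. e < 4 \<Longrightarrow> K e \<in> R"
    and hL: "hL * M\<^sup>2 \<le>\<^sub>v D" and hK: "hK * M\<^sup>2 \<le>\<^sub>v D"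
    and area: "(form k L L + hL) * (form k K K + hK) - (form k L K + h)\<^sup>2 \<in> R"
    and qd: "quad k b c d"
    and small: "(L c * K d - L d * K c) * M \<in> R" "(L d * K b - L b * K d) * M \<in> R"
  shows "h * (h + 2 * form k L K) \<in> R"
proof -
  have D0: "D \<noteq> 0" using D_notin by auto
  have mixed: "form k f f * g \<in> R" if "\<And>e. e < 4 \<Longrightarrow> f e \<in> R" "g * M\<^sup>2 \<le>\<^sub>v D" for f g
  proof -
    have "(D * form k f f) * (g * M\<^sup>2) \<le>\<^sub>v M\<^sup>2 * D"
      using that assms by (intro vle_mult D_form_vle)
    then have "(M\<^sup>2 * D) * (form k f f * g) \<le>\<^sub>v (M\<^sup>2 * D) * 1"
      by (simp add: mult.commute mult.left_commute)
    then show ?thesis using D0 M_nonzero by (subst (asm) vle_cancel) auto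
  qed
  have "(hL * M\<^sup>2) * (hK * M\<^sup>2) \<le>\<^sub>v D * D" using hL hK by (intro vle_mult)
  also have "D * D \<le>\<^sub>v M ^ 3" using D_sq_vle by (simp add: power2_eq_square)
  finally have "M ^ 3 * (hL * hK * M) \<le>\<^sub>v M ^ 3 * 1"
    by (simp add: power2_eq_square power3_eq_cube mult.commute mult.left_commute)
  then have "hL * hK * M \<le>\<^sub>v 1" using M_nonzero by (subst (asm) vle_cancel) auto
  moreover have "hL * hK * 1 \<le>\<^sub>v hL * hK * M" using one_le_M by (intro vle_mult_left)
  ultimately have hh: "hL * hK \<in> R" using vle_trans[of "hL * hK" "hL * hK * M" 1] by simp
  have less: "b < 4" "c < 4" "d < 4" using qd by (auto simp: quad_def)
  have mR: "L e * K f - L f * K e \<in> R" if "e < 4" "f < 4" for e f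
    using that assms by (intro diff_mem mult_mem)
  have "form k L L * form k K K - (form k L K)\<^sup>2 \<in> R"
  proof (rule wedge_mem[OF qd])
    show "(L c * K d - L d * K c) * (L d * K b - L b * K d) * M \<in> R"
      using mult_mem[OF mR[of c d] small(2)] less by (simp add: mult.assoc)
    show "(L c * K d - L d * K c) * (L b * K c - L c * K b) * M \<in> R"
      using mult_mem[OF mR[of b c] small(1)] less by (simp add: mult.commute mult.left_commute)
    show "(L d * K b - L b * K d) * (L b * K c - L c * K b) * M \<in> R"
      using mult_mem[OF mR[of b c] small(2)] less by (simp add: mult.commute mult.left_commute)
  qed (use mR less in auto)
  then have "(form k L L * form k K K - (form k L K)\<^sup>2) + form k L L * hK + form k K K * hL + hL * hK -
      ((form k L L + hL) * (form k K K + hK) - (form k L K + h)\<^sup>2) \<in> R"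
    using assms hh by (intro diff_mem[OF _ area] add_mem mixed)
  then show ?thesis by (simp add: algebra_simps power2_eq_square)
qed

text \<open>
  The first point is near \<open>a\<close>, the second one near \<open>b\<close>.  The triangle with the vertex \<open>a\<close> and the
  triangle with a vertex \<open>k\<close> different from \<open>a\<close> and \<open>b\<close> both give a quadratic polynomial in \<open>h\<close> with
  finite value.  Their difference is linear in \<open>h\<close>, and its coefficient is dominated by the second
  triangle, since \<open>D * form k L K\<close> has at least the order of \<open>M\<^sup>2\<close> but \<open>D * form a L K\<close> at most that of \<open>M\<close>.
\<close>

lemma cross_term_small:
  assumes L: "\<And>e. e < 4 \<Longrightarrow> L e \<in> R" and K: "\<And>e. e < 4 \<Longrightarrow> K e \<in> R"
    and a: "a < 4" "1 \<le>\<^sub>v L a" "\<And>e. e < 4 \<Longrightarrow> e \<noteq> a \<Longrightarrow> L e * M \<in> R"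
    and b: "b < 4" "1 \<le>\<^sub>v K b" "\<And>e. e < 4 \<Longrightarrow> e \<noteq> b \<Longrightarrow> K e * M \<in> R"
    and hL: "hL * M\<^sup>2 \<le>\<^sub>v D" and hK: "hK * M\<^sup>2 \<le>\<^sub>v D"
    and big: "\<And>e f. e < 4 \<Longrightarrow> f < 4 \<Longrightarrow> e \<noteq> f \<Longrightarrow> M \<le>\<^sub>v x e f"
    and area: "\<And>k. k < 4 \<Longrightarrow> (form k L L + hL) * (form k K K + hK) - (form k L K + h)\<^sup>2 \<in> R"
  shows "h * M\<^sup>2 \<le>\<^sub>v D"
proof -
  have small: "(L e * K f - L f * K e) * M \<in> R"
    if "e < 4" "f < 4" "e \<noteq> a \<or> f \<noteq> b" "f \<noteq> a \<or> e \<noteq> b" for e f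
  proof -
    have *: "L e * K f * M \<in> R" if "e < 4" "f < 4" "e \<noteq> a \<or> f \<noteq> b" for e f
    proof (cases "e = a")
      case True
      then have "L e * (K f * M) \<in> R" using that by (intro mult_mem[of "L e" "K f * M"] L b) auto
      then show ?thesis by (simp add: mult.assoc)
    next
      case False
      then have "K f * (L e * M) \<in> R" using that by (intro mult_mem[of "K f" "L e * M"] K a) auto
      then show ?thesis by (simp add: mult.commute mult.left_commute)
    qed
    show ?thesis using diff_mem[OF *[of e f] *[of f e]] that by (auto simp: left_diff_distrib)
  qed
  have small2: "(L e * K f - L f * K e) * M \<in> R" if "e < 4" "f < 4" "e \<noteq> a" "f \<noteq> a" for e f
    using small that by blast
  have near: "h * (h + 2 * form a L K) \<in> R"
  proof -
    obtain c d e where qd: "quad a c d e" using quad_extend1 a by blast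
    then show ?thesis
      by (intro quadric_mem[OF a(1) L K hL hK area qd] small2) (auto simp: quad_def)
  qed
  \<comment> \<open>The leading term of \<open>D * form k L K\<close> is \<open>D * q k a b\<close> up to a unit.\<close>
  have "\<exists>k. k < 4 \<and> M\<^sup>2 \<le>\<^sub>v D * form k L K \<and> h * (h + 2 * form k L K) \<in> R"
  proof (cases "a = b")
    case True
    obtain k c d where qd: "quad a k c d" using quad_extend1 a by blast
    have less: "k < 4" "c < 4" "d < 4" "a \<noteq> k" "a \<noteq> c" "a \<noteq> d" "k \<noteq> c" "k \<noteq> d" "c \<noteq> d"
      using qd by (auto simp: quad_def)
    have qk: "quad k c d a" using less a by (auto simp: quad_def)
    have qk2: "quad k a c d" using qd by (rule quad_swap)
    have "M\<^sup>2 \<le>\<^sub>v D * q k a a"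
    proof (rule ccontr)
      assume "D * q k a a <\<^sub>v M\<^sup>2"
      moreover have "p c * p d <\<^sub>v M\<^sup>2"
        using vle_vlt_trans[OF _ vle_vlt_trans[OF one_le_M M_less_M_sq], of "p c * p d"] less
        by (simp add: mult_mem p_mem)
      ultimately have "p c * p d - D * q k a a <\<^sub>v M\<^sup>2" by (intro vlt_diff)
      then have "(x c d)\<^sup>2 <\<^sub>v M\<^sup>2" using D_gram_diag[OF qk2] by simp
      then show False using big[of c d] less by (simp add: vle_square_iff)
    qed
    then have "M\<^sup>2 \<le>\<^sub>v D * form k L K"
      using a b L K True less by (intro D_form_big[of k a a]) auto
    moreover have "h * (h + 2 * form k L K) \<in> R"
      by (rule quadric_mem[OF less(1) L K hL hK area qk]; (rule small)?) (use less a b True in auto)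
    ultimately show ?thesis using less by blast
  next
    case False
    obtain k d where qd: "quad a b k d" using quad_extend2 a b False by metis
    have less: "k < 4" "d < 4" "a \<noteq> k" "b \<noteq> k" "a \<noteq> d" "b \<noteq> d" "k \<noteq> d"
      using qd by (auto simp: quad_def)
    have qk: "quad k a b d" using less a b False by (auto simp: quad_def)
    have "M\<^sup>2 \<le>\<^sub>v D * q k a b"
    proof (rule ccontr)
      assume "D * q k a b <\<^sub>v M\<^sup>2"
      moreover have "x a b * p d <\<^sub>v M\<^sup>2"
      proof -
        have "x a b * p d \<le>\<^sub>v M * 1" using less a b False p_mem by (intro vle_mult M_max) auto
        then show ?thesis using vle_vlt_trans[OF _ M_less_M_sq] by simp
      qed
      ultimately have "D * q k a b + x a b * p d <\<^sub>v M\<^sup>2" by (intro vlt_add)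
      then have "x a d * x b d <\<^sub>v M\<^sup>2" using D_gram[OF qk] by simp
      moreover have "M * M \<le>\<^sub>v x a d * x b d" using less a b by (intro vle_mult big) auto
      ultimately show False by (simp add: power2_eq_square)
    qed
    then have "M\<^sup>2 \<le>\<^sub>v D * form k L K"
      using a b L K less by (intro D_form_big[of k a b]) auto
    moreover have "h * (h + 2 * form k L K) \<in> R"
      by (rule quadric_mem[OF less(1) L K hL hK area qk]; (rule small)?) (use less a b False in auto)
    ultimately show ?thesis using less by blast
  qed
  then obtain k where k: "k < 4" "M\<^sup>2 \<le>\<^sub>v D * form k L K" and far: "h * (h + 2 * form k L K) \<in> R"
    by blast
  have "D * form a L K \<le>\<^sub>v M" using a K by (intro D_form_vle_small) auto
  then have fa: "D * form a L K <\<^sub>v M\<^sup>2" using M_less_M_sq by (rule vle_vlt_trans)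
  have "M\<^sup>2 \<le>\<^sub>v D * (form k L K - form a L K)"
  proof (rule ccontr)
    assume "D * (form k L K - form a L K) <\<^sub>v M\<^sup>2"
    from vlt_add[OF this fa] k show False by (simp add: algebra_simps)
  qed
  then have "h * M\<^sup>2 \<le>\<^sub>v h * (D * (form k L K - form a L K))" by (rule vle_mult_left)
  also have "\<dots> = D * (h * (form k L K - form a L K))" by simp
  also have "\<dots> \<le>\<^sub>v D * 1"
  proof (intro vle_mult_left)
    have "2 * (h * (form k L K - form a L K)) = h * (h + 2 * form k L K) - h * (h + 2 * form a L K)"
      by (simp add: algebra_simps)
    also have "\<dots> \<le>\<^sub>v 1" using near far diff_mem by simp
    finally show "h * (form k L K - form a L K) \<le>\<^sub>v 1" unfolding vle_numeral_mult .
  qed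
  finally show ?thesis by simp
qed

end

section \<open>Determinants\<close>

text \<open>
  Determinants of matrices given by functions, so that submatrices are reindexed functions.
\<close>

abbreviation det_of :: "nat \<Rightarrow> (nat \<Rightarrow> nat \<Rightarrow> 'a :: comm_ring_1) \<Rightarrow> 'a" where
  "det_of n f \<equiv> Determinant.det (Matrix.mat n n (\<lambda>(i, j). f i j))"

lemma det_of_cong:
  assumes "\<And>i j. i < n \<Longrightarrow> j < n \<Longrightarrow> f i j = g i j"
  shows "det_of n f = det_of n g"
proof -
  have "Matrix.mat n n (\<lambda>(i, j). f i j) = Matrix.mat n n (\<lambda>(i, j). g i j)"
    using assms by (intro eq_matI) auto
  then show ?thesis by simp
qed

lemma det_of_Suc:
  fixes f :: "nat \<Rightarrow> nat \<Rightarrow> 'a :: comm_ring_1"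
  shows "det_of (Suc n) f = (\<Sum>j<Suc n. f 0 j * ((- 1) ^ j * det_of n (\<lambda>a b. f (Suc a) (if b < j then b else Suc b))))"
proof -
  let ?A = "Matrix.mat (Suc n) (Suc n) (\<lambda>(i, j). f i j)"
  have "det_of (Suc n) f = (\<Sum>j<Suc n. ?A $$ (0, j) * cofactor ?A 0 j)"
    by (rule laplace_expansion_row) auto
  also have "\<dots> = (\<Sum>j<Suc n. f 0 j * ((- 1) ^ j * det_of n (\<lambda>a b. f (Suc a) (if b < j then b else Suc b))))"
  proof (intro sum.cong refl)
    fix j assume j: "j \<in> {..<Suc n}"
    have "mat_delete ?A 0 j = Matrix.mat n n (\<lambda>(a, b). f (Suc a) (if b < j then b else Suc b))"
      unfolding mat_delete_def using j by (intro eq_matI) auto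
    then show "?A $$ (0, j) * cofactor ?A 0 j =
        f 0 j * ((- 1) ^ j * det_of n (\<lambda>a b. f (Suc a) (if b < j then b else Suc b)))"
      using j by (simp add: cofactor_def)
  qed
  finally show ?thesis .
qed

lemma det_of_0: "det_of 0 f = 1"
  by (rule det_dim_zero) auto

lemma det_of_1: "det_of 1 f = f 0 0"
  using det_of_Suc[of 0 f] by (simp add: det_of_0)

lemma det_of_2: "det_of 2 f = f 0 0 * f 1 1 - f 0 1 * f 1 0"
  unfolding numeral_2_eq_2 det_of_Suc[of "Suc 0"] det_of_1[unfolded One_nat_def]
  by simp

lemma det_of_3: "det_of 3 f = f 0 0 * (f 1 1 * f 2 2 - f 1 2 * f 2 1) - f 0 1 * (f 1 0 * f 2 2 - f 1 2 * f 2 0)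
   + f 0 2 * (f 1 0 * f 2 1 - f 1 1 * f 2 0)"
  unfolding numeral_3_eq_3 det_of_Suc[of "Suc (Suc 0)"] det_of_2[unfolded numeral_2_eq_2]
  by (simp add: numeral_2_eq_2 algebra_simps)

text \<open>
  The first \<open>k\<close> columns, multiplied by \<open>K\<close>, are subtracted from the others, which clears the upper right
  block and leaves the Schur complement.
\<close>

lemma det_of_schur:
  fixes G :: "nat \<Rightarrow> nat \<Rightarrow> 'a :: idom"
  assumes K: "\<And>a v. a < k \<Longrightarrow> v < m \<Longrightarrow> G a (k + v) = (\<Sum>b<k. G a b * K b v)"
  shows "det_of (k + m) G =
    det_of k G * det_of m (\<lambda>u v. G (k + u) (k + v) - (\<Sum>b<k. G (k + u) b * K b v))"
proof -
  let ?S = "\<lambda>u v. G (k + u) (k + v) - (\<Sum>b<k. G (k + u) b * K b v)"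
  define T where "T = Matrix.mat (k + m) (k + m)
    (\<lambda>(a, b). if a = b then 1 else if a < k \<and> k \<le> b then - K a (b - k) else 0)"
  define GM where "GM = Matrix.mat (k + m) (k + m) (\<lambda>(i, j). G i j)"
  have car: "T \<in> carrier_mat (k + m) (k + m)" "GM \<in> carrier_mat (k + m) (k + m)"
    by (auto simp: T_def GM_def)
  have "upper_triangular T" unfolding upper_triangular_def T_def by auto
  then have "Determinant.det T = prod_list (diag_mat T)"
    using car(1) by (rule det_upper_triangular)
  also have "diag_mat T = map (\<lambda>_. 1) [0..<k + m]"
    unfolding diag_mat_def T_def by (intro map_cong) auto
  also have "prod_list \<dots> = 1" by (induction "k + m") (auto simp: map_replicate_const)
  finally have T1: "Determinant.det T = 1" .
  have GT: "GM * T = four_block_mat (Matrix.mat k k (\<lambda>(i, j). G i j)) (0\<^sub>m k m)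
      (Matrix.mat m k (\<lambda>(i, j). G (k + i) j)) (Matrix.mat m m (\<lambda>(u, v). ?S u v))"
  proof (rule eq_matI)
    fix i j assume ij: "i < dim_row (four_block_mat (Matrix.mat k k (\<lambda>(i, j). G i j)) (0\<^sub>m k m)
      (Matrix.mat m k (\<lambda>(i, j). G (k + i) j)) (Matrix.mat m m (\<lambda>(u, v). ?S u v)))"
      "j < dim_col (four_block_mat (Matrix.mat k k (\<lambda>(i, j). G i j)) (0\<^sub>m k m)
      (Matrix.mat m k (\<lambda>(i, j). G (k + i) j)) (Matrix.mat m m (\<lambda>(u, v). ?S u v)))"
    then have ij: "i < k + m" "j < k + m" by auto
    have "(GM * T) $$ (i, j) = (\<Sum>c<k + m. G i c * T $$ (c, j))"
      using ij by (simp add: GM_def T_def scalar_prod_def lessThan_atLeast0)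
    also have "\<dots> = (if j < k then G i j else G i j - (\<Sum>b<k. G i b * K b (j - k)))"
    proof (cases "j < k")
      case True
      have "(\<Sum>c<k + m. G i c * T $$ (c, j)) = (\<Sum>c<k + m. if c = j then G i c else 0)"
        using ij True by (intro sum.cong) (auto simp: T_def)
      then show ?thesis using ij True by simp
    next
      case False
      have "(\<Sum>c<k + m. G i c * T $$ (c, j)) =
          (\<Sum>c<k + m. (if c = j then G i c else 0) - (if c < k then G i c * K c (j - k) else 0))"
        using ij False by (intro sum.cong) (auto simp: T_def)
      also have "\<dots> = G i j - (\<Sum>c<k + m. if c < k then G i c * K c (j - k) else 0)"
        using ij by (simp add: sum_subtractf)
      also have "(\<Sum>c<k + m. if c < k then G i c * K c (j - k) else 0) = (\<Sum>b<k. G i b * K b (j - k))"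
        by (subst sum.inter_filter[symmetric]) (auto intro!: sum.cong)
      finally show ?thesis using False by simp
    qed
    finally have e: "(GM * T) $$ (i, j) = \<dots>" .
    show "(GM * T) $$ (i, j) = four_block_mat (Matrix.mat k k (\<lambda>(i, j). G i j)) (0\<^sub>m k m)
      (Matrix.mat m k (\<lambda>(i, j). G (k + i) j)) (Matrix.mat m m (\<lambda>(u, v). ?S u v)) $$ (i, j)"
      unfolding e using ij K[of i "j - k"] by (auto simp: four_block_mat_def Let_def)
  qed (auto simp: GM_def T_def)
  have "Determinant.det GM = Determinant.det (GM * T)"
    using det_mult[OF car(2,1)] T1 by simp
  also have "\<dots> = det_of k G * det_of m ?S"
    unfolding GT by (rule det_four_block_mat_upper_right_zero) auto
  finally show ?thesis by (simp add: GM_def)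
qed

lemma det_of_smult: "det_of n (\<lambda>i j. c * f i j) = c ^ n * det_of n f"
proof -
  have "Matrix.mat n n (\<lambda>(i, j). c * f i j) = c \<cdot>\<^sub>m Matrix.mat n n (\<lambda>(i, j). f i j)"
    by (intro eq_matI) auto
  then show ?thesis by simp
qed

lemma det_of_permute:
  fixes f :: "nat \<Rightarrow> nat \<Rightarrow> 'a :: comm_ring_1"
  assumes "\<pi> permutes {0..<n}"
  shows "det_of n (\<lambda>i j. f (\<pi> i) (\<pi> j)) = det_of n f"
proof -
  have lt: "\<pi> i < n" if "i < n" for i using permutes_in_image[OF assms, of i] that by simp
  have rows: "det_of n (\<lambda>i j. g (\<pi> i) j) = of_int (sign \<pi>) * det_of n g" for g :: "nat \<Rightarrow> nat \<Rightarrow> 'a"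
  proof -
    have "Determinant.det (Matrix.mat n n (\<lambda>(i, j). Matrix.mat n n (\<lambda>(i, j). g i j) $$ (\<pi> i, j))) =
        of_int (sign \<pi>) * det_of n g"
      using det_permute_rows[of "Matrix.mat n n (\<lambda>(i, j). g i j)" n \<pi>] assms by simp
    also have "Determinant.det (Matrix.mat n n (\<lambda>(i, j). Matrix.mat n n (\<lambda>(i, j). g i j) $$ (\<pi> i, j))) =
        det_of n (\<lambda>i j. g (\<pi> i) j)"
      by (intro det_of_cong) (simp add: lt)
    finally show ?thesis .
  qed
  have transp: "det_of n g = det_of n (\<lambda>i j. g j i)" for g :: "nat \<Rightarrow> nat \<Rightarrow> 'a"
  proof -
    have "Matrix.mat n n (\<lambda>(i, j). g j i) = transpose_mat (Matrix.mat n n (\<lambda>(i, j). g i j))"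
      by (intro eq_matI) auto
    then show ?thesis using det_transpose[of "Matrix.mat n n (\<lambda>(i, j). g i j)" n] by simp
  qed
  have "det_of n (\<lambda>i j. f (\<pi> i) (\<pi> j)) = of_int (sign \<pi>) * det_of n (\<lambda>i j. f i (\<pi> j))"
    by (rule rows)
  also have "det_of n (\<lambda>i j. f i (\<pi> j)) = of_int (sign \<pi>) * det_of n f"
    unfolding transp[of "\<lambda>i j. f i (\<pi> j)"] transp[of f] by (rule rows)
  finally show ?thesis by (simp add: sign_def)
qed

context distances
begin

text \<open>
  The Schur complement of the rows and columns of \<open>*\<close> and of the vertex 0 in the Cayley-Menger matrix
  is \<open>-2\<close> times the Gram matrix of the edges from 0.
\<close>

lemma cayley_menger_eq_gram_det:
  "cayley_menger n s = det_of n (\<lambda>i j. gram s 0 (Suc i) (Suc j)) / (fact n)\<^sup>2"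
proof -
  let ?G = "\<lambda>a b. if a = b then 0 else if a = 0 \<or> b = 0 then 1 else s (a - 1) (b - 1)"
  have "Determinant.det (cayley_menger_mat n s) = det_of (2 + n) ?G"
    unfolding cayley_menger_mat_def by (simp add: add.commute)
  also have "\<dots> = det_of 2 ?G * det_of n (\<lambda>u v. ?G (2 + u) (2 + v) -
      (\<Sum>b<2. ?G (2 + u) b * (if b = 0 then s 0 (Suc v) else 1)))"
    by (rule det_of_schur) (auto simp: lessThan_nat_numeral less_2_cases_iff)
  also have "det_of n (\<lambda>u v. ?G (2 + u) (2 + v) -
      (\<Sum>b<2. ?G (2 + u) b * (if b = 0 then s 0 (Suc v) else 1))) =
      det_of n (\<lambda>u v. - 2 * gram s 0 (Suc u) (Suc v))"
    by (rule det_of_cong) (auto simp: gram_def lessThan_nat_numeral sym[of 0])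
  also have "\<dots> = (- 2) ^ n * det_of n (\<lambda>u v. gram s 0 (Suc u) (Suc v))"
    by (rule det_of_smult)
  also have "det_of 2 ?G = - 1"
    by (simp add: det_of_2)
  finally have "cayley_menger n s = (- 1) ^ (n + 1) * (- 1 * (- 2) ^ n) / (2 ^ n * (fact n)\<^sup>2) *
      det_of n (\<lambda>u v. gram s 0 (Suc u) (Suc v))"
    by (simp add: cayley_menger_def)
  also have "(- 1) ^ (n + 1) * (- 1 * (- 2) ^ n) = (2 ^ n :: 'a)"
    by (cases "even n") auto
  finally show ?thesis by simp
qed

end

lemma cayley_menger_permute:
  fixes s :: "nat \<Rightarrow> nat \<Rightarrow> 'a :: field_char_0"
  assumes "\<pi> permutes {0..n}"
  shows "cayley_menger n (\<lambda>i j. s (\<pi> i) (\<pi> j)) = cayley_menger n s"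
proof -
  \<comment> \<open>The row 0 belongs to \<open>*\<close> and stays in place.\<close>
  define \<rho> where "\<rho> a = (if a = 0 then 0 else Suc (\<pi> (a - 1)))" for a
  have "bij_betw (Suc \<circ> \<pi> \<circ> (\<lambda>a. a - 1)) {1..<n + 2} {1..<n + 2}"
  proof (intro bij_betw_trans)
    show "bij_betw (\<lambda>a. a - 1) {1..<n + 2} {0..n}"
      by (rule bij_betwI[of _ _ _ Suc]) auto
    show "bij_betw \<pi> {0..n} {0..n}" using assms by (rule permutes_imp_bij)
    show "bij_betw Suc {0..n} {1..<n + 2}"
      by (rule bij_betwI[of _ _ _ "\<lambda>a. a - 1"]) auto
  qed
  then have "bij_betw \<rho> {1..<n + 2} {1..<n + 2}"
    by (rule bij_betw_cong[THEN iffD1, rotated]) (auto simp: \<rho>_def)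
  moreover have "bij_betw \<rho> {0} {0}" by (auto simp: \<rho>_def)
  ultimately have "bij_betw \<rho> ({1..<n + 2} \<union> {0}) ({1..<n + 2} \<union> {0})"
    by (rule bij_betw_combine) auto
  moreover have set: "{1..<n + 2} \<union> {0} = {0..<n + 2}" by auto
  ultimately have "bij_betw \<rho> {0..<n + 2} {0..<n + 2}"
    by (simp add: set)
  then have perm: "\<rho> permutes {0..<n + 2}"
  proof (rule bij_imp_permutes)
    fix a assume "a \<notin> {0..<n + 2}"
    then have "a - 1 \<notin> {0..n}" "a > 0" by auto
    then show "\<rho> a = a" using permutes_not_in[OF assms] by (simp add: \<rho>_def)
  qed
  have inj: "\<pi> i = \<pi> j \<longleftrightarrow> i = j" for i j using permutes_inj[OF assms] by (auto simp: inj_def)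
  let ?G = "\<lambda>a b. if a = b then 0 else if a = 0 \<or> b = 0 then 1 else s (a - 1) (b - 1)"
  have "Determinant.det (cayley_menger_mat n (\<lambda>i j. s (\<pi> i) (\<pi> j))) = det_of (n + 2) (\<lambda>a b. ?G (\<rho> a) (\<rho> b))"
    unfolding cayley_menger_mat_def by (rule det_of_cong) (auto simp: \<rho>_def inj)
  also have "\<dots> = det_of (n + 2) ?G" by (rule det_of_permute[OF perm])
  finally show ?thesis by (simp add: cayley_menger_def cayley_menger_mat_def)
qed

context char_zero_valuation_ring
begin

text \<open>
  If all entries have order at most \<open>1 / sqrt M\<close>, the square of every summand of the determinant has order
  at most \<open>1 / M ^ m\<close>.
\<close>

lemma det_of_mem:
  assumes entry: "\<And>i j. i < m \<Longrightarrow> j < m \<Longrightarrow> (f i j)\<^sup>2 * M \<in> R"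
    and c: "c\<^sup>2 \<le>\<^sub>v M ^ m"
  shows "c * det_of m f \<in> R"
proof -
  have "c * (of_int (sign \<pi>) * (\<Prod>i = 0..<m. f i (\<pi> i))) \<in> R" if "\<pi> permutes {0..<m}" for \<pi>
  proof -
    have lt: "\<pi> i < m" if "i < m" for i using permutes_in_image[OF \<open>\<pi> permutes _\<close>, of i] that by simp
    have "(c * (\<Prod>i = 0..<m. f i (\<pi> i)))\<^sup>2 = c\<^sup>2 * (\<Prod>i = 0..<m. (f i (\<pi> i))\<^sup>2)"
      by (simp add: power_mult_distrib prod_power_distrib)
    also have "\<dots> \<le>\<^sub>v M ^ m * (\<Prod>i = 0..<m. (f i (\<pi> i))\<^sup>2)"
      by (intro vle_mult c vle_refl)
    also have "\<dots> = (\<Prod>i = 0..<m. (f i (\<pi> i))\<^sup>2 * M)"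
      by (simp add: prod.distrib mult.commute)
    also have "\<dots> \<le>\<^sub>v 1\<^sup>2" using lt by (auto intro!: prod_mem entry)
    finally have "c * (\<Prod>i = 0..<m. f i (\<pi> i)) \<in> R"
      by (simp only: vle_square_iff) simp
    then show ?thesis using minus_mem by (auto simp: sign_def)
  qed
  then show ?thesis
    by (subst det_def'[of _ m]) (auto simp: sum_distrib_left intro!: sum_mem)
qed

end

section \<open>The volume is finite at every valuation when there are at least seven vertices\<close>

lemma permutation_with_prefix:
  assumes "distinct ws" "set ws \<subseteq> {0..n}"
  obtains \<pi> where "\<pi> permutes {0..n}" "\<And>k. k < length ws \<Longrightarrow> \<pi> k = ws ! k"
proof -
  let ?m = "length ws"
  have len: "?m \<le> Suc n" using card_mono[OF _ assms(2)] assms(1) by (simp add: distinct_card)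
  have "card ({0..n} - {..<?m}) = card ({0..n} - set ws)"
    using len assms by (subst (1 2) card_Diff_subset) (auto simp: distinct_card)
  then obtain g where g: "bij_betw g ({0..n} - {..<?m}) ({0..n} - set ws)"
    using finite_same_card_bij[of "{0..n} - {..<?m}" "{0..n} - set ws"] by auto
  define \<pi> where "\<pi> k = (if k < ?m then ws ! k else if k \<le> n then g k else k)" for k
  have "bij_betw \<pi> {..<?m} (set ws)"
    using bij_betw_nth[OF assms(1) refl refl] by (rule bij_betw_cong[THEN iffD1, rotated]) (simp add: \<pi>_def)
  moreover have "bij_betw \<pi> ({0..n} - {..<?m}) ({0..n} - set ws)"
    using g by (rule bij_betw_cong[THEN iffD1, rotated]) (auto simp: \<pi>_def)
  ultimately have "bij_betw \<pi> ({..<?m} \<union> ({0..n} - {..<?m})) (set ws \<union> ({0..n} - set ws))"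
    by (rule bij_betw_combine) auto
  moreover have "{..<?m} \<union> ({0..n} - {..<?m}) = {0..n}" "set ws \<union> ({0..n} - set ws) = {0..n}"
    using len assms(2) by auto
  ultimately have "bij_betw \<pi> {0..n} {0..n}" by simp
  then have "\<pi> permutes {0..n}"
    by (rule bij_imp_permutes) (use len in \<open>auto simp: \<pi>_def\<close>)
  then show ?thesis by (rule that) (simp add: \<pi>_def)
qed

text \<open>
  Inner products of the projections along the edge \<open>k l\<close>.  Their product with \<open>s k l\<close> is the inner product
  of the bivectors of the faces \<open>k l i\<close> and \<open>k l j\<close>.
\<close>

lemma (in distances) line_schur_diag:
  "s k l \<noteq> 0 \<Longrightarrow> (gram s k i i - gram s k i l * (gram s k l i / s k l)) * s k l = face_sq s k l i"
  by (simp add: face_sq_def gram_self gram_sym[of k i l] field_simps power2_eq_square)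

lemma (in distances) line_schur_off_diag:
  assumes "s k l \<noteq> 0"
  shows "((gram s k i j - gram s k i l * (gram s k l j / s k l)) * s k l)\<^sup>2 =
    face_sq s k l i * face_sq s k l j - tetra_sq s k l i j * s k l"
proof -
  have e: "(gram s k i j - gram s k i l * (gram s k l j / s k l)) * s k l =
      gram s k i j * gram s k l l - gram s k l i * gram s k l j"
    using assms by (simp add: gram_self gram_sym[of k i l] field_simps)
  show ?thesis
    unfolding e unfolding gram_self[symmetric, of k l] face_sq_def tetra_sq_def det3_def
    by (simp add: algebra_simps power2_eq_square)
qed

text \<open>
  A simplex with at least seven vertices whose squared areas are units.
\<close>

locale unit_areas = char_zero_valuation_ring R + distances s
  for R :: "'a :: field_char_0 set" and s :: "nat \<Rightarrow> nat \<Rightarrow> 'a" +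
  fixes n :: nat
  assumes n: "6 \<le> n"
    and face_mem: "distinct [a, b, c] \<Longrightarrow> {a, b, c} \<subseteq> {0..n} \<Longrightarrow> face_sq s a b c \<in> R"
    and face_unit: "distinct [a, b, c] \<Longrightarrow> {a, b, c} \<subseteq> {0..n} \<Longrightarrow> 1 \<le>\<^sub>v face_sq s a b c"
begin

lemma inverse_mem_if_notin: "z \<notin> R \<Longrightarrow> inverse z \<in> R"
  using mem_or_inverse_mem by blast

lemma gram_det_mem_if_lengths_mem:
  assumes "\<And>i j. i \<le> n \<Longrightarrow> j \<le> n \<Longrightarrow> s i j \<in> R"
  shows "det_of n (\<lambda>i j. gram s 0 (Suc i) (Suc j)) \<in> R"
proof -
  have "gram s 0 (Suc i) (Suc j) \<le>\<^sub>v 1" if "i < n" "j < n" for i j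
    unfolding gram_def vle_divide_numeral using that assms by (auto intro!: diff_mem add_mem)
  then have "1 * det_of n (\<lambda>i j. gram s 0 (Suc i) (Suc j)) \<in> R"
    by (intro det_of_mem[where M = 1]) (auto intro: power_mem)
  then show ?thesis by simp
qed

text \<open>
  The Gram determinant is the infinite \<open>s 0 1\<close> times the Gram determinant of the projections along the
  edge \<open>0 1\<close>, whose entries have order at most \<open>1 / sqrt (s 0 1)\<close>.
\<close>

lemma gram_det_mem_if_tetra_mem:
  assumes big: "s 0 1 \<notin> R"
    and tetra: "\<And>i j. i \<in> {2..n} \<Longrightarrow> j \<in> {2..n} \<Longrightarrow> i \<noteq> j \<Longrightarrow> tetra_sq s 0 1 i j \<in> R"
  shows "det_of n (\<lambda>i j. gram s 0 (Suc i) (Suc j)) \<in> R"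
proof -
  define m where "m = n - 1"
  have m: "n = 1 + m" "2 \<le> m" using n by (auto simp: m_def)
  define t where "t = s 0 1"
  have t0: "t \<noteq> 0" and one_t: "1 \<le>\<^sub>v t" and inv: "inverse t \<in> R"
    using big vlt_imp_vle[of 1 t] inverse_mem_if_notin[of t] unfolding t_def[symmetric] by auto
  define e where "e i j = gram s 0 i j - gram s 0 i 1 * (gram s 0 1 j / t)" for i j
  have "det_of n (\<lambda>i j. gram s 0 (Suc i) (Suc j)) = det_of 1 (\<lambda>i j. gram s 0 (Suc i) (Suc j)) *
     det_of m (\<lambda>u v. gram s 0 (Suc (1 + u)) (Suc (1 + v)) -
       (\<Sum>b<1. gram s 0 (Suc (1 + u)) (Suc b) * (gram s 0 1 (Suc (Suc v)) / t)))"
    unfolding m(1) using t0 by (intro det_of_schur) (auto simp: gram_self t_def)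
  also have "\<dots> = t * det_of m (\<lambda>u v. e (u + 2) (v + 2))"
    unfolding det_of_1 by (simp add: e_def gram_self t_def)
  also have "\<dots> \<in> R"
  proof (rule det_of_mem[where M = t])
    have "1 ^ (m - 2) \<le>\<^sub>v t ^ (m - 2)" using one_t by (rule vle_power)
    then have "t\<^sup>2 * 1 ^ (m - 2) \<le>\<^sub>v t\<^sup>2 * t ^ (m - 2)" by (rule vle_mult_left)
    also have "t\<^sup>2 * t ^ (m - 2) = t ^ m" using m(2) by (metis power_add le_add_diff_inverse)
    finally show "t\<^sup>2 \<le>\<^sub>v t ^ m" by simp
  next
    fix u v assume uv: "u < m" "v < m"
    define i j where "i = u + 2" and "j = v + 2"
    have fR: "face_sq s 0 1 i \<in> R" "face_sq s 0 1 j \<in> R"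
      using uv m by (auto intro!: face_mem simp: i_def j_def)
    have "(e i j)\<^sup>2 * t = (e i j * t)\<^sup>2 * inverse t"
      using t0 by (simp add: field_simps power2_eq_square)
    also have "\<dots> \<in> R"
    proof (cases "u = v")
      case True
      then have "e i j * t = face_sq s 0 1 i"
        using line_schur_diag[of 0 1 i] t0 by (simp add: e_def t_def i_def j_def)
      then show ?thesis using fR inv by (simp add: mult_mem power_mem)
    next
      case False
      have "(e i j * t)\<^sup>2 * inverse t = face_sq s 0 1 i * face_sq s 0 1 j * inverse t - tetra_sq s 0 1 i j"
        using line_schur_off_diag[of 0 1 i j] t0 unfolding e_def t_def by (simp add: field_simps)
      moreover have "tetra_sq s 0 1 i j \<in> R"
        using uv m False by (intro tetra) (auto simp: i_def j_def)
      ultimately show ?thesis using fR inv by (simp add: diff_mem mult_mem)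
    qed
    finally show "(e (u + 2) (v + 2))\<^sup>2 * t \<in> R" by (simp add: i_def j_def)
  qed
  finally show ?thesis .
qed

end

context distances
begin

text \<open>
  The inner product of two normals of the tetrahedron with the vertices 0, 1, 2, 3, as a function of the
  two opposite vertices only.
\<close>

definition normals :: "nat \<Rightarrow> nat \<Rightarrow> 'a" where
  "normals a b = normal_inner s a b (Min ({..<4} - {a, b})) (Max ({..<4} - {a, b}))"

text \<open>
  The squared length of the normal opposite to \<open>a\<close>.  As the normals sum to zero, it is determined by their
  inner products; this form is visibly independent of an order of the other three vertices.
\<close>

definition opp_face :: "nat \<Rightarrow> 'a" where
  "opp_face a = - (\<Sum>b \<in> {..<4} - {a}. normals a b)"

lemma normals_eq: "quad a b c d \<Longrightarrow> normals a b = normal_inner s a b c d"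
proof -
  assume q: "quad a b c d"
  then have "{..<4} - {a, b} = {c, d}" using quad_set[OF q] by (auto simp: quad_def)
  then show ?thesis using normal_inner_edge_sym[of a b c d] by (auto simp: normals_def min_def max_def)
qed

lemma opp_face_eq: "quad a b c d \<Longrightarrow> opp_face a = face_sq s b c d"
proof -
  assume q: "quad a b c d"
  then have "{..<4} - {a} = {b, c, d}" using quad_set[OF q] by (auto simp: quad_def)
  moreover have qs: "quad a c b d" "quad a d b c" using q by (auto simp: quad_def)
  ultimately have "opp_face a = - (normal_inner s a b c d + normal_inner s a c b d + normal_inner s a d b c)"
    unfolding opp_face_def using q
    by (simp add: normals_eq[OF q] normals_eq[OF qs(1)] normals_eq[OF qs(2)] quad_def)
  then show ?thesis by (simp add: normals_sum_zero)
qed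

lemma normals_sum: "quad a b c d \<Longrightarrow> normals a b + normals a c + normals a d = - opp_face a"
proof -
  assume q: "quad a b c d"
  then have "quad a c b d" "quad a d b c" by (auto simp: quad_def)
  with q show ?thesis by (simp add: normals_eq opp_face_eq normals_sum_zero)
qed

lemma tetra_sq_quad: "quad a b c d \<Longrightarrow> tetra_sq s a b c d = tetra_sq s 0 1 2 3"
  unfolding quad_def less_4_cases by (elim conjE disjE) (simp_all add: tetra_sq_perm)

lemma normals_sym: "normals a b = normals b a"
  by (simp add: normals_def insert_commute normal_inner_sym[of a b])

end

locale max_tetra = unit_areas +
  assumes base_notin: "tetra_sq s 0 1 2 3 \<notin> R"
    and base_max: "distinct [a, b, c, d] \<Longrightarrow> {a, b, c, d} \<subseteq> {0..n} \<Longrightarrow>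
      tetra_sq s a b c d \<le>\<^sub>v tetra_sq s 0 1 2 3"
begin

definition \<Delta> :: 'a where "\<Delta> = tetra_sq s 0 1 2 3"

lemma \<Delta>_nonzero: "\<Delta> \<noteq> 0"
  using base_notin by (auto simp: \<Delta>_def)

lemma quad_le: "quad a b c d \<Longrightarrow> {a, b, c, d} \<subseteq> {0..n} \<and> distinct [a, b, c, d]"
  using n by (auto simp: quad_def)

lemma opp_face_mem: "a < 4 \<Longrightarrow> opp_face a \<in> R"
proof -
  assume "a < 4"
  then obtain b c d where q: "quad a b c d" by (rule quad_extend1)
  then show ?thesis using quad_le[OF q] by (auto simp: opp_face_eq intro!: face_mem)
qed

definition largest :: 'a where
  "largest = (SOME M. \<exists>e\<in>{e. e \<in> {..<4} \<times> {..<4} \<and> fst e \<noteq> snd e}. M = normals (fst e) (snd e) \<and>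
     (\<forall>f\<in>{e. e \<in> {..<4} \<times> {..<4} \<and> fst e \<noteq> snd e}. normals (fst f) (snd f) \<le>\<^sub>v M))"

lemma gram_tetra: "gram_tetra R opp_face normals \<Delta> largest (gram s)"
proof unfold_locales
  let ?P = "{e. e \<in> {..<4::nat} \<times> {..<4::nat} \<and> fst e \<noteq> snd e}"
  have "(0, 1) \<in> ?P" by simp
  then have ne: "?P \<noteq> {}" by blast
  have "\<exists>M. \<exists>e\<in>?P. M = normals (fst e) (snd e) \<and> (\<forall>f\<in>?P. normals (fst f) (snd f) \<le>\<^sub>v M)"
    using vle_max_exists[of ?P "\<lambda>e. normals (fst e) (snd e)"] ne by auto
  from someI_ex[OF this] have L: "\<exists>e\<in>?P. largest = normals (fst e) (snd e) \<and>
      (\<forall>f\<in>?P. normals (fst f) (snd f) \<le>\<^sub>v largest)"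
    unfolding largest_def .
  show "\<exists>a b. a < 4 \<and> b < 4 \<and> a \<noteq> b \<and> normals a b = largest" using L by fastforce
  show "normals a b \<le>\<^sub>v largest" if "a < 4" "b < 4" "a \<noteq> b" for a b
    using L that by fastforce
  show "\<Delta> \<notin> R" using base_notin by (simp add: \<Delta>_def)
  fix a b c d k
  show "normals a b = normals b a" by (rule normals_sym)
  show "a < 4 \<Longrightarrow> opp_face a \<in> R" by (rule opp_face_mem)
  show "gram s k a b = gram s k b a" by (rule gram_sym)
  show "gram s k k b = 0" by simp
  show "quad a b c d \<Longrightarrow> normals a b + normals a c + normals a d = - opp_face a" by (rule normals_sum)
  assume q: "quad k b c d"
  then have qs: "quad b c k d" "quad b k c d" "quad c d k b" "quad b d k c" "quad c k b d" "quad d k b c"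
    by (auto simp: quad_def)
  have D: "\<Delta> = tetra_sq s k b c d" using tetra_sq_quad[OF q] by (simp add: \<Delta>_def)
  note eqs = normals_eq[OF qs(1)] normals_eq[OF qs(3)] normals_eq[OF qs(4)]
    opp_face_eq[OF qs(2)] opp_face_eq[OF qs(5)] opp_face_eq[OF qs(6)]
  show "\<Delta>\<^sup>2 = det3 (opp_face b) (opp_face c) (opp_face d) (normals c d) (normals b d) (normals b c)"
    unfolding D eqs by (rule tetra_sq_squared)
  show "opp_face b = gram s k c c * gram s k d d - (gram s k c d)\<^sup>2"
    unfolding eqs by (simp add: face_sq_def)
  show "normals b c = gram s k d b * gram s k d c - gram s k d d * gram s k b c"
    unfolding eqs by (simp add: normal_inner_def)
  show "\<Delta> * gram s k b b = opp_face c * opp_face d - (normals c d)\<^sup>2"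
    unfolding D eqs by (rule tetra_gram_diag)
  show "\<Delta> * gram s k b c = normals b d * normals c d - normals b c * opp_face d"
    unfolding D eqs by (rule tetra_gram_off_diag)
qed

sublocale gram_tetra R opp_face normals \<Delta> largest "gram s"
  by (rule gram_tetra)

text \<open>
  The barycentric coordinates of the foot of the perpendicular from the point \<open>i\<close> to the span of
  \<open>0 1 2 3\<close>.  At the vertices 1, 2, 3 this is Cramer's rule, where the adjugate of the Gram matrix is
  the Gram matrix of the normals.
\<close>

definition coord :: "nat \<Rightarrow> nat \<Rightarrow> 'a" where
  "coord i b = (let c = (\<lambda>b. (\<Sum>c\<in>{1, 2, 3}. (if b = c then opp_face b else normals b c) * gram s 0 c i) / \<Delta>)
     in if b = 0 then 1 - c 1 - c 2 - c 3 else c b)"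

text \<open>
  The inner product of the components of \<open>i\<close> and \<open>j\<close> orthogonal to the tetrahedron.  The form chosen here
  is the entry of the Schur complement; the symmetric form is \<open>gram_form\<close>.
\<close>

definition perp :: "nat \<Rightarrow> nat \<Rightarrow> 'a" where
  "perp i j = gram s 0 i j - (\<Sum>a\<in>{1, 2, 3}. gram s 0 i a * coord j a)"

lemma coord_solves:
  assumes "a \<in> {1, 2, 3}"
  shows "gram s 0 a i = (\<Sum>b\<in>{1, 2, 3}. gram s 0 a b * coord i b)"
proof -
  have q: "quad 0 1 2 3" "quad 0 2 1 3" "quad 0 3 1 2" "quad 0 1 3 2" "quad 0 2 3 1"
    by (auto simp: quad_def)
  have D: "\<Delta> = det3 (gram s 0 1 1) (gram s 0 2 2) (gram s 0 3 3) (gram s 0 2 3) (gram s 0 1 3) (gram s 0 1 2)"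
    by (simp add: \<Delta>_def tetra_sq_def)
  note P = p_gram[OF q(1)] p_gram[OF q(2)] p_gram[OF q(3)] x_gram[OF q(1)] x_gram[OF q(4)] x_gram[OF q(5)]
    gram_sym[of 0 2 1] gram_sym[of 0 3 1] gram_sym[of 0 3 2]
  have C: "\<Delta> * coord i 1 = opp_face 1 * gram s 0 1 i + normals 1 2 * gram s 0 2 i + normals 1 3 * gram s 0 3 i"
    "\<Delta> * coord i 2 = normals 1 2 * gram s 0 1 i + opp_face 2 * gram s 0 2 i + normals 2 3 * gram s 0 3 i"
    "\<Delta> * coord i 3 = normals 1 3 * gram s 0 1 i + normals 2 3 * gram s 0 2 i + opp_face 3 * gram s 0 3 i"
    using \<Delta>_nonzero
    by (simp_all add: coord_def normals_sym[of 2 1] normals_sym[of 3 1] normals_sym[of 3 2] del: One_nat_def)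
  have "\<Delta> * gram s 0 a i = gram s 0 a 1 * (\<Delta> * coord i 1) + gram s 0 a 2 * (\<Delta> * coord i 2) +
      gram s 0 a 3 * (\<Delta> * coord i 3)"
    unfolding C unfolding P D det3_def using assms
    by (elim insertE emptyE; hypsubst)
      (simp_all add: gram_sym[of 0 2 1] gram_sym[of 0 3 1] gram_sym[of 0 3 2] algebra_simps power2_eq_square
        del: One_nat_def)
  also have "\<dots> = (\<Sum>b\<in>{1, 2, 3}. gram s 0 a b * (\<Delta> * coord i b))"
    by (simp add: add.assoc)
  also have "\<dots> = \<Delta> * (\<Sum>b\<in>{1, 2, 3}. gram s 0 a b * coord i b)"
    by (simp add: algebra_simps)
  finally show ?thesis using \<Delta>_nonzero by simp
qed

end

text \<open>
  The squared length of the bivector of \<open>la * a + lb * b + ld * d + w\<close> and \<open>d\<close>, where \<open>w\<close> is orthogonal to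
  \<open>a\<close>, \<open>b\<close>, \<open>d\<close> and has squared length \<open>h\<close>.
\<close>

lemma area_expansion:
  "(la * la * qaa + lb * lb * qbb + ld * ld * qdd + (la * lb + lb * la) * qab + (la * ld + ld * la) * qad
      + (lb * ld + ld * lb) * qbd + h) * qdd - (la * qad + lb * qbd + ld * qdd)\<^sup>2
    = la\<^sup>2 * (qaa * qdd - qad\<^sup>2) + lb\<^sup>2 * (qbb * qdd - qbd\<^sup>2)
      - 2 * (la * lb * (qad * qbd - qdd * qab)) + h * qdd"
  for la :: "'a :: comm_ring_1"
  by (simp add: algebra_simps power2_eq_square)

text \<open>
  Similarly, the Gram determinant of \<open>la * a + lc * c + ld * d + w\<close>, \<open>c\<close> and \<open>d\<close>.
\<close>

lemma volume_expansion:
  "det3 (la * la * qaa + lc * lc * qcc + ld * ld * qdd + (la * lc + lc * la) * qac + (la * ld + ld * la) * qad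
      + (lc * ld + ld * lc) * qcd + h) qcc qdd qcd (la * qad + lc * qcd + ld * qdd) (la * qac + ld * qcd + lc * qcc)
    = la\<^sup>2 * det3 qaa qcc qdd qcd qad qac + (qcc * qdd - qcd\<^sup>2) * h"
  for la :: "'a :: field"
  by (simp add: det3_def algebra_simps power2_eq_square)

context max_tetra
begin

lemma coord_sum: "(\<Sum>a<4. coord i a) = 1"
proof -
  have "quad 0 1 2 3" by (simp add: quad_def)
  from quad_sum[OF this, of "coord i"] show ?thesis by (simp add: coord_def Let_def)
qed

lemma sum_less_4: "f 0 = 0 \<Longrightarrow> (\<Sum>a<4. f a) = (\<Sum>a\<in>{1, 2, 3}. f a :: 'a)" for f :: "nat \<Rightarrow> 'a"
proof -
  assume "f 0 = 0"
  moreover have "quad 0 1 2 3" by (simp add: quad_def)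
  ultimately show ?thesis using quad_sum[of 0 1 2 3 f] by (simp add: add.assoc)
qed

lemma gram_zero_base:
  assumes "b < 4"
  shows "gram s 0 i b = (\<Sum>e<4. coord i e * gram s 0 e b)"
proof (cases "b = 0")
  case False
  then have "b \<in> {1, 2, 3}" using assms by auto
  from coord_solves[OF this, of i] show ?thesis
    by (subst sum_less_4) (simp_all add: gram_sym[of 0 _ b] mult.commute del: One_nat_def)
qed simp

lemma gram_zero_perp: "gram s 0 i j = (\<Sum>f<4. coord j f * gram s 0 i f) + perp i j"
  by (subst sum_less_4) (simp_all add: perp_def mult.commute)

text \<open>
  Since the coordinates sum to 1, the formulas with base point 0 hold for every vertex of the tetrahedron
  as base point.
\<close>

lemma gram_in_base:
  assumes "k < 4" "b < 4"
  shows "gram s k i b = (\<Sum>e<4. coord i e * gram s k e b)"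
proof -
  have "(\<Sum>e<4. coord i e * gram s k e b) = (\<Sum>e<4. coord i e * gram s 0 e b) -
      (\<Sum>e<4. coord i e * gram s 0 e k) - (\<Sum>e<4. coord i e) * gram s 0 b k + (\<Sum>e<4. coord i e) * gram s 0 k k"
    unfolding gram_change_base[of k _ b 0] sum_distrib_right sum_subtractf[symmetric] sum.distrib[symmetric]
    by (intro sum.cong) (simp_all add: algebra_simps)
  also have "\<dots> = gram s k i b"
    unfolding gram_zero_base[OF assms(1), symmetric] gram_zero_base[OF assms(2), symmetric] coord_sum
      gram_change_base[of k i b 0] by simp
  finally show ?thesis ..
qed

lemma gram_form: "k < 4 \<Longrightarrow> gram s k i j = form k (coord i) (coord j) + perp i j"
proof -
  assume k: "k < 4"
  have "form k (coord i) (coord j) = (\<Sum>f<4. coord j f * (\<Sum>e<4. coord i e * gram s k e f))"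
    unfolding form_def sum_distrib_left by (subst sum.swap) (simp add: mult.commute mult.left_commute)
  also have "\<dots> = (\<Sum>f<4. coord j f * gram s k i f)"
    by (intro sum.cong refl) (simp add: gram_in_base[OF k, of _ i])
  also have "\<dots> = (\<Sum>f<4. coord j f * gram s 0 i f) - (\<Sum>f<4. coord j f) * gram s 0 i k -
      (\<Sum>f<4. coord j f * gram s 0 f k) + (\<Sum>f<4. coord j f) * gram s 0 k k"
    unfolding gram_change_base[of k i _ 0] sum_distrib_right sum_subtractf[symmetric] sum.distrib[symmetric]
    by (intro sum.cong) (simp_all add: algebra_simps)
  also have "\<dots> = gram s 0 i j - perp i j - gram s 0 i k - gram s 0 j k + gram s 0 k k"
    unfolding gram_zero_base[OF k, symmetric] coord_sum gram_zero_perp[of i j] by simp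
  also have "\<dots> = gram s k i j - perp i j"
    by (simp add: gram_change_base[of k i j 0])
  finally show ?thesis by simp
qed


lemma form_expand:
  assumes "quad c a b d"
  shows "form c f g = f a * g a * gram s c a a + f b * g b * gram s c b b + f d * g d * gram s c d d
    + (f a * g b + f b * g a) * gram s c a b + (f a * g d + f d * g a) * gram s c a d
    + (f b * g d + f d * g b) * gram s c b d"
  unfolding form_def quad_sum[OF assms] gram_sym[of c b a] gram_sym[of c d a] gram_sym[of c d b]
  by (simp add: algebra_simps)

lemma gram_expand:
  assumes "quad c a b d"
  shows "gram s c i d = coord i a * gram s c a d + coord i b * gram s c b d + coord i d * gram s c d d"
proof -
  have "c < 4" "d < 4" using assms by (auto simp: quad_def)
  then show ?thesis unfolding gram_in_base[OF \<open>c < 4\<close> \<open>d < 4\<close>, of i] quad_sum[OF assms] by simp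
qed

lemma face_sq_companion:
  assumes "quad a b c d"
  shows "face_sq s i c d = (coord i a)\<^sup>2 * opp_face b + (coord i b)\<^sup>2 * opp_face a
    - 2 * (coord i a * coord i b * normals a b) + perp i i / \<Delta> * (opp_face a * opp_face b - (normals a b)\<^sup>2)"
proof -
  have q: "quad c a b d" "quad c b a d" "quad c d a b" using assms by (auto simp: quad_def)
  have e: "perp i i / \<Delta> * (opp_face a * opp_face b - (normals a b)\<^sup>2) = perp i i * gram s c d d"
    unfolding D_gram_diag[OF q(3), symmetric] using \<Delta>_nonzero by simp
  have f: "face_sq s i c d = gram s c i i * gram s c d d - (gram s c i d)\<^sup>2"
    using face_sq_perm(1)[of i c d] by (simp add: face_sq_def)
  have g: "gram s c i i = form c (coord i) (coord i) + perp i i"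
    using assms by (intro gram_form) (auto simp: quad_def)
  show ?thesis
    unfolding e f g unfolding gram_expand[OF q(1), of i] form_expand[OF q(1)] p_gram[OF q(1)] p_gram[OF q(2)] x_gram[OF q(1)]
      gram_sym[of c d a] gram_sym[of c d b]
    by (rule area_expansion)
qed

lemma tetra_sq_companion:
  assumes "quad a b c d"
  shows "tetra_sq s b i c d = (coord i a)\<^sup>2 * \<Delta> + opp_face a * perp i i"
proof -
  have q: "quad b a c d" "quad b a d c" using assms by (auto simp: quad_def)
  have D: "\<Delta> = tetra_sq s b a c d" using tetra_sq_quad[OF q(1)] by (simp add: \<Delta>_def)
  have g: "gram s b i i = form b (coord i) (coord i) + perp i i"
    using assms by (intro gram_form) (auto simp: quad_def)
  show ?thesis
    unfolding D unfolding tetra_sq_def unfolding g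
    unfolding gram_expand[OF q(1), of i] gram_expand[OF q(2), of i] form_expand[OF q(1)] p_gram[OF q(1)] gram_sym[of b d c]
    by (rule volume_expansion)
qed

lemma companion:
  assumes i: "i \<in> {4..n}"
  shows "companion R opp_face normals \<Delta> largest (coord i) (perp i i / \<Delta>)"
proof unfold_locales
  show "(\<Sum>a<4. coord i a) = 1" by (rule coord_sum)
next
  fix a :: nat assume "a < 4"
  then obtain b c d where q: "quad a b c d" by (rule quad_extend1)
  have "tetra_sq s b i c d \<le>\<^sub>v 1 * \<Delta>"
    using q i n unfolding \<Delta>_def mult_1 by (intro base_max) (auto simp: quad_def)
  then have "\<Delta> * ((coord i a)\<^sup>2 + opp_face a * (perp i i / \<Delta>)) \<le>\<^sub>v \<Delta> * 1"
    unfolding tetra_sq_companion[OF q] using \<Delta>_nonzero by (simp add: algebra_simps)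
  then have "(coord i a)\<^sup>2 + opp_face a * (perp i i / \<Delta>) \<le>\<^sub>v 1"
    using \<Delta>_nonzero by (subst (asm) vle_cancel)
  then show "(coord i a)\<^sup>2 + opp_face a * (perp i i / \<Delta>) \<in> R" by simp
next
  fix a b :: nat assume "a < 4" "b < 4" "a \<noteq> b"
  then obtain c d where q: "quad a b c d" by (rule quad_extend2)
  have *: "distinct [i, c, d]" "{i, c, d} \<subseteq> {0..n}" using q i n by (auto simp: quad_def)
  show "(coord i a)\<^sup>2 * opp_face b + (coord i b)\<^sup>2 * opp_face a - 2 * (coord i a * coord i b * normals a b) +
      perp i i / \<Delta> * (opp_face a * opp_face b - (normals a b)\<^sup>2) \<in> R"
    unfolding face_sq_companion[OF q, symmetric] using * by (rule face_mem)
  show "1 \<le>\<^sub>v (coord i a)\<^sup>2 * opp_face b + (coord i b)\<^sup>2 * opp_face a - 2 * (coord i a * coord i b * normals a b) +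
      perp i i / \<Delta> * (opp_face a * opp_face b - (normals a b)\<^sup>2)"
    unfolding face_sq_companion[OF q, symmetric] using * by (rule face_unit)
qed

lemma perp_diag_small:
  assumes "i \<in> {4..n}"
  shows "perp i i * largest\<^sup>2 \<le>\<^sub>v \<Delta>"
proof -
  interpret c: companion R opp_face normals \<Delta> largest "coord i" "perp i i / \<Delta>"
    by (rule companion[OF assms])
  have "\<Delta> * (perp i i / \<Delta> * largest\<^sup>2) \<le>\<^sub>v \<Delta> * 1"
    using c.N_small by (intro vle_mult_left) simp
  then show ?thesis using \<Delta>_nonzero by simp
qed

lemma perp_small:
  assumes i: "i \<in> {4..n}" and j: "j \<in> {4..n}"
  shows "perp i j * largest\<^sup>2 \<le>\<^sub>v \<Delta>"
proof (cases "i = j")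
  case True
  then show ?thesis using perp_diag_small i by simp
next
  case False
  interpret ci: companion R opp_face normals \<Delta> largest "coord i" "perp i i / \<Delta>"
    by (rule companion[OF i])
  interpret cj: companion R opp_face normals \<Delta> largest "coord j" "perp j j / \<Delta>"
    by (rule companion[OF j])
  obtain a where a: "a < 4" "1 \<le>\<^sub>v coord i a" "\<And>b. b < 4 \<Longrightarrow> b \<noteq> a \<Longrightarrow> coord i b * largest \<in> R"
    by (rule ci.near_vertex) blast
  obtain b where b: "b < 4" "1 \<le>\<^sub>v coord j b" "\<And>e. e < 4 \<Longrightarrow> e \<noteq> b \<Longrightarrow> coord j e * largest \<in> R"
    by (rule cj.near_vertex) blast
  show ?thesis
  proof (rule cross_term_small[where L = "coord i" and K = "coord j", OF ci.L_mem cj.L_mem a b perp_diag_small[OF i] perp_diag_small[OF j] ci.all_big])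
    fix k :: nat assume k: "k < 4"
    have "(form k (coord i) (coord i) + perp i i) * (form k (coord j) (coord j) + perp j j) -
        (form k (coord i) (coord j) + perp i j)\<^sup>2 = face_sq s k i j"
      using k by (simp add: face_sq_def gram_form)
    also have "\<dots> \<in> R" using i j k n False by (intro face_mem) auto
    finally show "(form k (coord i) (coord i) + perp i i) * (form k (coord j) (coord j) + perp j j) -
        (form k (coord i) (coord j) + perp i j)\<^sup>2 \<in> R" .
  qed
qed

text \<open>
  The Schur complement of the tetrahedron in the Gram matrix consists of the \<open>perp i j\<close>.  Their squares
  have order at most \<open>\<Delta>\<^sup>2 / largest ^ 4\<close>, hence at most \<open>1 / largest\<close>, and there are \<open>n - 3\<close> factors to
  compensate for \<open>\<Delta>\<^sup>2\<close>, which has order at most \<open>largest ^ 3\<close>.  This is where at least seven vertices are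
  needed.
\<close>

lemma gram_det_mem: "det_of n (\<lambda>i j. gram s 0 (Suc i) (Suc j)) \<in> R"
proof -
  define m where "m = n - 3"
  have m: "n = 3 + m" "3 \<le> m" using n by (auto simp: m_def)
  have three: "{..<3::nat} = {0, 1, 2}" by auto
  have "det_of n (\<lambda>i j. gram s 0 (Suc i) (Suc j)) = det_of 3 (\<lambda>i j. gram s 0 (Suc i) (Suc j)) *
     det_of m (\<lambda>u v. gram s 0 (Suc (3 + u)) (Suc (3 + v)) -
       (\<Sum>b<3. gram s 0 (Suc (3 + u)) (Suc b) * coord (v + 4) (Suc b)))"
    unfolding m(1)
  proof (rule det_of_schur)
    fix a v :: nat assume "a < 3" "v < m"
    then have "Suc a \<in> {1, 2, 3}" by auto
    from coord_solves[OF this, of "v + 4"]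
    show "gram s 0 (Suc a) (Suc (3 + v)) = (\<Sum>b<3. gram s 0 (Suc a) (Suc b) * coord (v + 4) (Suc b))"
      by (simp add: three numeral_eq_Suc add.commute add.left_commute)
  qed
  also have "det_of 3 (\<lambda>i j. gram s 0 (Suc i) (Suc j)) = \<Delta>"
    unfolding det_of_3 \<Delta>_def tetra_sq_def det3_def
    by (simp add: numeral_eq_Suc gram_sym[of 0 "Suc (Suc 0)" "Suc 0"] gram_sym[of 0 "Suc (Suc (Suc 0))" "Suc 0"]
        gram_sym[of 0 "Suc (Suc (Suc 0))" "Suc (Suc 0)"] algebra_simps power2_eq_square)
  also have "det_of m (\<lambda>u v. gram s 0 (Suc (3 + u)) (Suc (3 + v)) -
       (\<Sum>b<3. gram s 0 (Suc (3 + u)) (Suc b) * coord (v + 4) (Suc b))) = det_of m (\<lambda>u v. perp (u + 4) (v + 4))"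
    by (rule det_of_cong) (simp add: perp_def three numeral_eq_Suc add.commute add.left_commute)
  also have "\<Delta> * \<dots> \<in> R"
  proof (rule det_of_mem[where M = largest])
    have "1 ^ (m - 3) \<le>\<^sub>v largest ^ (m - 3)" using one_le_M by (rule vle_power)
    then have "\<Delta>\<^sup>2 * 1 ^ (m - 3) \<le>\<^sub>v largest ^ 3 * largest ^ (m - 3)" using D_sq_vle by (rule vle_mult[rotated])
    also have "largest ^ 3 * largest ^ (m - 3) = largest ^ m" using m(2) by (metis power_add le_add_diff_inverse)
    finally show "\<Delta>\<^sup>2 \<le>\<^sub>v largest ^ m" by simp
  next
    fix u v assume uv: "u < m" "v < m"
    define h where "h = perp (u + 4) (v + 4)"
    have "h * largest\<^sup>2 \<le>\<^sub>v \<Delta>" unfolding h_def using uv m by (intro perp_small) auto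
    then have "(h * largest\<^sup>2)\<^sup>2 \<le>\<^sub>v \<Delta>\<^sup>2" by (rule vle_power)
    also have "\<dots> \<le>\<^sub>v largest ^ 3" by (rule D_sq_vle)
    finally have "largest ^ 3 * (h\<^sup>2 * largest) \<le>\<^sub>v largest ^ 3 * 1"
      by (simp add: power2_eq_square power3_eq_cube mult.assoc mult.commute mult.left_commute)
    then have "h\<^sup>2 * largest \<le>\<^sub>v 1" using M_nonzero by (subst (asm) vle_cancel) auto
    then show "(perp (u + 4) (v + 4))\<^sup>2 * largest \<in> R" by (simp add: h_def)
  qed
  finally show ?thesis .
qed

end

lemma (in unit_areas) permuted: "\<pi> permutes {0..n} \<Longrightarrow> unit_areas R (\<lambda>i j. s (\<pi> i) (\<pi> j)) n"
proof unfold_locales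
  assume \<pi>: "\<pi> permutes {0..n}"
  have inj: "\<pi> i = \<pi> j \<longleftrightarrow> i = j" for i j using permutes_inj[OF \<pi>] by (auto simp: inj_def)
  have im: "\<pi> i \<in> {0..n} \<longleftrightarrow> i \<in> {0..n}" for i by (rule permutes_in_image[OF \<pi>])
  fix a b c
  show "s (\<pi> a) (\<pi> b) = s (\<pi> b) (\<pi> a)" by (rule sym)
  show "s (\<pi> a) (\<pi> a) = 0" by simp
  show "6 \<le> n" by (rule n)
  assume abc: "distinct [a, b, c]" "{a, b, c} \<subseteq> {0..n}"
  have "face_sq (\<lambda>i j. s (\<pi> i) (\<pi> j)) a b c = face_sq s (\<pi> a) (\<pi> b) (\<pi> c)"
    by (simp add: face_sq_def gram_def)
  moreover have "distinct [\<pi> a, \<pi> b, \<pi> c]" "{\<pi> a, \<pi> b, \<pi> c} \<subseteq> {0..n}"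
    using abc im by (auto simp: inj)
  ultimately show "face_sq (\<lambda>i j. s (\<pi> i) (\<pi> j)) a b c \<in> R" "1 \<le>\<^sub>v face_sq (\<lambda>i j. s (\<pi> i) (\<pi> j)) a b c"
    using face_mem face_unit by simp_all
qed

lemma (in unit_areas) cayley_menger_mem_if_permuted_gram_det_mem:
  assumes "\<pi> permutes {0..n}"
    and "det_of n (\<lambda>i j. gram (\<lambda>i j. s (\<pi> i) (\<pi> j)) 0 (Suc i) (Suc j)) \<in> R"
  shows "cayley_menger n s \<in> R"
proof -
  interpret p: unit_areas R "\<lambda>i j. s (\<pi> i) (\<pi> j)" n by (rule permuted[OF assms(1)])
  have "of_rat (fact n) = (fact n :: 'a)" by (metis of_nat_fact of_rat_of_nat_eq)
  then have "inverse ((fact n)\<^sup>2) \<in> R"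
    using of_rat_mem[of "inverse ((fact n)\<^sup>2)"] by (simp add: of_rat_inverse of_rat_power)
  then have "det_of n (\<lambda>i j. gram (\<lambda>i j. s (\<pi> i) (\<pi> j)) 0 (Suc i) (Suc j)) * inverse ((fact n)\<^sup>2) \<in> R"
    by (intro mult_mem assms)
  then show ?thesis
    unfolding cayley_menger_permute[OF assms(1), of s, symmetric] p.cayley_menger_eq_gram_det
    by (simp add: field_simps)
qed

text \<open>
  The three cases of the introduction; in the last two the vertices are renumbered so that the infinite
  edge is \<open>0 1\<close>, or a tetrahedron of largest volume is \<open>0 1 2 3\<close>.
\<close>

theorem (in unit_areas) cayley_menger_mem: "cayley_menger n s \<in> R"
proof -
  consider (tetra) a b c d where "distinct [a, b, c, d]" "{a, b, c, d} \<subseteq> {0..n}" "tetra_sq s a b c d \<notin> R"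
    | (lengths) "\<And>i j. i \<le> n \<Longrightarrow> j \<le> n \<Longrightarrow> s i j \<in> R"
    | (edge) i j where "i \<le> n" "j \<le> n" "s i j \<notin> R"
      "\<And>a b c d. distinct [a, b, c, d] \<Longrightarrow> {a, b, c, d} \<subseteq> {0..n} \<Longrightarrow> tetra_sq s a b c d \<in> R"
    by metis
  then show ?thesis
  proof cases
    case lengths
    then have "det_of n (\<lambda>i j. gram (\<lambda>i j. s (id i) (id j)) 0 (Suc i) (Suc j)) \<in> R"
      using gram_det_mem_if_lengths_mem by simp
    then show ?thesis by (rule cayley_menger_mem_if_permuted_gram_det_mem[OF permutes_id])
  next
    case edge
    have "i \<noteq> j" using edge(3) by auto
    then obtain \<pi> where \<pi>: "\<pi> permutes {0..n}" "\<And>k. k < length [i, j] \<Longrightarrow> \<pi> k = [i, j] ! k"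
      using permutation_with_prefix[of "[i, j]" n] edge by auto
    have \<pi>01: "\<pi> 0 = i" "\<pi> 1 = j" using \<pi>(2)[of 0] \<pi>(2)[of 1] by auto
    have inj: "\<pi> i = \<pi> j \<longleftrightarrow> i = j" for i j using permutes_inj[OF \<pi>(1)] by (auto simp: inj_def)
    have im: "\<pi> i \<in> {0..n} \<longleftrightarrow> i \<in> {0..n}" for i by (rule permutes_in_image[OF \<pi>(1)])
    interpret p: unit_areas R "\<lambda>i j. s (\<pi> i) (\<pi> j)" n by (rule permuted[OF \<pi>(1)])
    show ?thesis
    proof (rule cayley_menger_mem_if_permuted_gram_det_mem[OF \<pi>(1) p.gram_det_mem_if_tetra_mem])
      show "s (\<pi> 0) (\<pi> 1) \<notin> R" using edge \<pi>01 by simp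
      fix k l assume kl: "k \<in> {2..n}" "l \<in> {2..n}" "k \<noteq> l"
      have "tetra_sq (\<lambda>i j. s (\<pi> i) (\<pi> j)) 0 1 k l = tetra_sq s (\<pi> 0) (\<pi> 1) (\<pi> k) (\<pi> l)"
        by (simp add: tetra_sq_def gram_def)
      also have "\<dots> \<in> R"
        using kl im[of 0] im[of 1] im[of k] im[of l] n by (intro edge(4)) (auto simp: inj simp del: One_nat_def)
      finally show "tetra_sq (\<lambda>i j. s (\<pi> i) (\<pi> j)) 0 1 k l \<in> R" .
    qed
  next
    case tetra
    define T where "T = {w. length w = 4 \<and> distinct w \<and> set w \<subseteq> {0..n}}"
    define v where "v w = tetra_sq s (w ! 0) (w ! 1) (w ! 2) (w ! 3)" for w
    have "finite T"
      unfolding T_def by (rule finite_subset[OF _ finite_lists_length_eq[of "{0..n}" 4]]) auto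
    moreover have mem: "[a, b, c, d] \<in> T" using tetra by (simp add: T_def)
    ultimately obtain w where w: "w \<in> T" "\<And>w'. w' \<in> T \<Longrightarrow> v w' \<le>\<^sub>v v w"
      using vle_max_exists[of T v] by blast
    have "v [a, b, c, d] \<notin> R" using tetra by (simp add: v_def)
    then have vw: "v w \<notin> R" using w(2)[OF mem] vle_trans[of "v [a, b, c, d]" "v w" 1] by auto
    obtain \<pi> where \<pi>: "\<pi> permutes {0..n}" "\<And>k. k < length w \<Longrightarrow> \<pi> k = w ! k"
      using permutation_with_prefix[of w n] w(1) unfolding T_def by auto
    have inj: "\<pi> i = \<pi> j \<longleftrightarrow> i = j" for i j using permutes_inj[OF \<pi>(1)] by (auto simp: inj_def)
    have im: "\<pi> i \<in> {0..n} \<longleftrightarrow> i \<in> {0..n}" for i by (rule permutes_in_image[OF \<pi>(1)])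
    interpret p: unit_areas R "\<lambda>i j. s (\<pi> i) (\<pi> j)" n by (rule permuted[OF \<pi>(1)])
    have tv: "tetra_sq (\<lambda>i j. s (\<pi> i) (\<pi> j)) a b c d = v [\<pi> a, \<pi> b, \<pi> c, \<pi> d]" for a b c d
      by (simp add: tetra_sq_def gram_def v_def)
    have base: "tetra_sq (\<lambda>i j. s (\<pi> i) (\<pi> j)) 0 1 2 3 = v w"
      unfolding tv using \<pi>(2) w(1) by (simp add: v_def T_def)
    have "max_tetra R (\<lambda>i j. s (\<pi> i) (\<pi> j)) n"
    proof unfold_locales
      show "tetra_sq (\<lambda>i j. s (\<pi> i) (\<pi> j)) 0 1 2 3 \<notin> R" using vw base by simp
      fix a b c d assume "distinct [a, b, c, d]" "{a, b, c, d} \<subseteq> {0..n}"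
      then have "[\<pi> a, \<pi> b, \<pi> c, \<pi> d] \<in> T" using im by (auto simp: T_def inj)
      then show "tetra_sq (\<lambda>i j. s (\<pi> i) (\<pi> j)) a b c d \<le>\<^sub>v tetra_sq (\<lambda>i j. s (\<pi> i) (\<pi> j)) 0 1 2 3"
        unfolding base unfolding tv by (rule w(2))
    qed
    then show ?thesis
      by (intro cayley_menger_mem_if_permuted_gram_det_mem[OF \<pi>(1)] max_tetra.gram_det_mem)
  qed
qed

section \<open>Specializing the edge lengths to real functions\<close>

definition eval_monom :: "('v \<Rightarrow> 'a :: field_char_0) \<Rightarrow> ('v \<Rightarrow>\<^sub>0 nat) \<Rightarrow> 'a" where
  "eval_monom f m = (\<Prod>v \<in> Poly_Mapping.keys m. f v ^ Poly_Mapping.lookup m v)"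

lemma eval_monom_superset:
  assumes "finite K" "Poly_Mapping.keys m \<subseteq> K"
  shows "eval_monom f m = (\<Prod>v \<in> K. f v ^ Poly_Mapping.lookup m v)"
  unfolding eval_monom_def using assms
  by (intro prod.mono_neutral_left) (auto simp: in_keys_iff)

lemma eval_monom_add: "eval_monom f (m + m') = eval_monom f m * eval_monom f m'"
proof -
  let ?K = "Poly_Mapping.keys m \<union> Poly_Mapping.keys m'"
  have "eval_monom f (m + m') = (\<Prod>v \<in> ?K. f v ^ Poly_Mapping.lookup (m + m') v)"
    by (rule eval_monom_superset) (simp_all add: keys_add)
  also have "\<dots> = eval_monom f m * eval_monom f m'"
    by (simp add: eval_monom_superset[of ?K] lookup_add power_add prod.distrib)
  finally show ?thesis .
qed

lemma eval_monom_zero [simp]: "eval_monom f 0 = 1"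
  by (simp add: eval_monom_def)

lemma eval_poly_superset:
  assumes "finite K" "Poly_Mapping.keys q \<subseteq> K"
  shows "eval_poly f q = (\<Sum>m \<in> K. of_rat (Poly_Mapping.lookup q m) * eval_monom f m)"
  unfolding eval_poly_def eval_monom_def using assms
  by (intro sum.mono_neutral_left) (auto simp: in_keys_iff)

lemma eval_poly_zero [simp]: "eval_poly f 0 = 0"
  by (simp add: eval_poly_def)

lemma eval_poly_single: "eval_poly f (Poly_Mapping.single m c) = of_rat c * eval_monom f m"
  by (subst eval_poly_superset[of "{m}"]) auto

lemma eval_poly_one [simp]: "eval_poly f 1 = 1"
  using eval_poly_single[of f 0 1] by simp

lemma eval_poly_add [simp]: "eval_poly f (p + q) = eval_poly f p + eval_poly f q"
proof -
  let ?K = "Poly_Mapping.keys p \<union> Poly_Mapping.keys q"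
  have "eval_poly f (p + q) = (\<Sum>m \<in> ?K. of_rat (Poly_Mapping.lookup (p + q) m) * eval_monom f m)"
    by (rule eval_poly_superset) (simp_all add: keys_add)
  also have "\<dots> = eval_poly f p + eval_poly f q"
    by (simp add: eval_poly_superset[of ?K] lookup_add of_rat_add distrib_right sum.distrib)
  finally show ?thesis .
qed

lemma eval_poly_sum: "eval_poly f (\<Sum>i\<in>I. g i) = (\<Sum>i\<in>I. eval_poly f (g i))"
  by (induction I rule: infinite_finite_induct) auto

lemma poly_mapping_sum_single: "(\<Sum>m \<in> Poly_Mapping.keys p. Poly_Mapping.single m (Poly_Mapping.lookup p m)) = p"
proof (rule poly_mapping_eqI)
  fix k
  have "Poly_Mapping.lookup (\<Sum>m \<in> Poly_Mapping.keys p. Poly_Mapping.single m (Poly_Mapping.lookup p m)) k =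
      (\<Sum>m \<in> Poly_Mapping.keys p. if m = k then Poly_Mapping.lookup p m else 0)"
    unfolding lookup_sum by (intro sum.cong) (auto simp: lookup_single)
  also have "\<dots> = Poly_Mapping.lookup p k" by (auto simp: in_keys_iff)
  finally show "Poly_Mapping.lookup (\<Sum>m \<in> Poly_Mapping.keys p. Poly_Mapping.single m (Poly_Mapping.lookup p m)) k =
      Poly_Mapping.lookup p k" .
qed

lemma eval_poly_mult [simp]: "eval_poly f (p * q) = eval_poly f p * eval_poly f q"
proof -
  have "p * q = (\<Sum>m \<in> Poly_Mapping.keys p. Poly_Mapping.single m (Poly_Mapping.lookup p m)) *
      (\<Sum>m' \<in> Poly_Mapping.keys q. Poly_Mapping.single m' (Poly_Mapping.lookup q m'))"
    by (simp only: poly_mapping_sum_single)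
  also have "\<dots> = (\<Sum>m \<in> Poly_Mapping.keys p. \<Sum>m' \<in> Poly_Mapping.keys q.
      Poly_Mapping.single (m + m') (Poly_Mapping.lookup p m * Poly_Mapping.lookup q m'))"
    by (simp add: sum_product mult_single)
  finally have "eval_poly f (p * q) = (\<Sum>m \<in> Poly_Mapping.keys p. \<Sum>m' \<in> Poly_Mapping.keys q.
      of_rat (Poly_Mapping.lookup p m * Poly_Mapping.lookup q m') * eval_monom f (m + m'))"
    by (simp add: eval_poly_sum eval_poly_single)
  also have "\<dots> = eval_poly f p * eval_poly f q"
    by (simp add: eval_poly_superset[OF finite_keys subset_refl] sum_product eval_monom_add of_rat_mult
        mult.assoc mult.left_commute)
  finally show ?thesis .
qed

lemma eval_poly_uminus [simp]: "eval_poly f (- p) = - eval_poly f p"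
  using eval_poly_add[of f p "- p"] by (simp add: eq_neg_iff_add_eq_0 add.commute)

lemma eval_poly_diff [simp]: "eval_poly f (p - q) = eval_poly f p - eval_poly f q"
  using eval_poly_add[of f p "- q"] by simp

lemma eval_poly_of_nat [simp]: "eval_poly f (of_nat k) = of_nat k"
  by (induction k) auto

lemma eval_poly_of_int [simp]: "eval_poly f (of_int k) = of_int k"
  by (cases k) auto

text \<open>
  Polynomials in the edge lengths as elements of the algebraically closed field.
\<close>

definition embed_poly :: "(('n :: finite simplex_edge \<Rightarrow>\<^sub>0 nat) \<Rightarrow>\<^sub>0 rat) \<Rightarrow> 'n simplex_field" where
  "embed_poly P = to_ac (to_fract P)"

lemma embed_poly_simps [simp]: "embed_poly 0 = 0" "embed_poly 1 = 1" "embed_poly (P + Q) = embed_poly P + embed_poly Q"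
  "embed_poly (P * Q) = embed_poly P * embed_poly Q" "embed_poly (- P) = - embed_poly P"
  "embed_poly (P - Q) = embed_poly P - embed_poly Q"
  by (simp_all add: embed_poly_def)

lemma embed_poly_eq_0 [simp]: "embed_poly P = 0 \<longleftrightarrow> P = 0"
  by (simp add: embed_poly_def)

lemma embed_poly_of_int [simp]: "embed_poly (of_int k) = of_int k"
proof -
  have nat: "embed_poly (of_nat m) = of_nat m" for m by (induction m) auto
  show ?thesis by (cases k) (simp_all add: nat)
qed

lemma det_of_eq_sum:
  "det_of m f = (\<Sum>p\<in>{p. p permutes {0..<m}}. of_int (sign p) * (\<Prod>i = 0..<m. f i (p i)))"
proof -
  have "Matrix.mat m m (\<lambda>(i, j). f i j) \<in> carrier_mat m m" by simp
  from det_def'[OF this] show ?thesis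
    by (simp only:) (intro sum.cong arg_cong2[where f = "(*)"] prod.cong refl,
      auto dest: permutes_in_image)
qed

text \<open>
  A family of squared lengths with a real parameter \<open>T\<close>, considered for large \<open>T\<close>.  The values \<open>\<sigma> T i j\<close>
  are the squares, so the edge lengths themselves are specialized to square roots.
\<close>

locale specialization =
  fixes \<sigma> :: "real \<Rightarrow> nat \<Rightarrow> nat \<Rightarrow> real" and edge_type :: "'n :: finite itself"
  assumes \<sigma>_sym: "\<sigma> T i j = \<sigma> T j i"
    and \<sigma>_nonneg: "i \<le> CARD('n) \<Longrightarrow> j \<le> CARD('n) \<Longrightarrow> eventually (\<lambda>T. 0 \<le> \<sigma> T i j) at_top"
begin

definition lengths :: "real \<Rightarrow> 'n simplex_edge \<Rightarrow> real" where
  "lengths T e = sqrt (\<sigma> T (fst (edge_ends e)) (snd (edge_ends e)))"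

text \<open>
  The function \<open>g\<close> is eventually the value of \<open>x\<close> along the family.  Only rational functions of the edge
  lengths have values in this sense.  They form a ring, and the value of 0 is eventually 0, so equations
  between such elements specialize.
\<close>

definition spec :: "'n simplex_field \<Rightarrow> (real \<Rightarrow> real) \<Rightarrow> bool" where
  "spec x g \<longleftrightarrow> (\<exists>P Q. x = embed_poly P / embed_poly Q \<and>
     eventually (\<lambda>T. eval_poly (lengths T) Q \<noteq> 0 \<and> g T = eval_poly (lengths T) P / eval_poly (lengths T) Q) at_top)"

lemma specI:
  "x = embed_poly P / embed_poly Q \<Longrightarrow>
   eventually (\<lambda>T. eval_poly (lengths T) Q \<noteq> 0 \<and> g T = eval_poly (lengths T) P / eval_poly (lengths T) Q) at_top \<Longrightarrow>
   spec x g"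
  by (auto simp: spec_def)

lemma specE:
  assumes "spec x g"
  obtains P Q where "x = embed_poly P / embed_poly Q" "Q \<noteq> 0"
    "eventually (\<lambda>T. eval_poly (lengths T) Q \<noteq> 0 \<and> g T = eval_poly (lengths T) P / eval_poly (lengths T) Q) at_top"
proof -
  from assms obtain P Q where PQ: "x = embed_poly P / embed_poly Q"
    "eventually (\<lambda>T. eval_poly (lengths T) Q \<noteq> 0 \<and> g T = eval_poly (lengths T) P / eval_poly (lengths T) Q) at_top"
    by (auto simp: spec_def)
  moreover have "Q \<noteq> 0"
  proof
    assume "Q = 0"
    with PQ(2) have "eventually (\<lambda>T :: real. False) at_top" by simp
    then show False by simp
  qed
  ultimately show ?thesis using that by blast
qed

lemma spec_of_rat: "spec (of_rat r) (\<lambda>T. of_rat r)"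
proof -
  obtain a b where "quotient_of r = (a, b)" by force
  then have r: "r = of_int a / of_int b" and b: "b > 0"
    using quotient_of_div quotient_of_denom_pos by blast+
  show ?thesis
    by (rule specI[of _ "of_int a" "of_int b"]) (use b in \<open>simp_all add: r of_rat_divide\<close>)
qed

lemma spec_add: "spec x g \<Longrightarrow> spec y h \<Longrightarrow> spec (x + y) (\<lambda>T. g T + h T)"
proof -
  assume x: "spec x g" and y: "spec y h"
  obtain P Q where 1: "x = embed_poly P / embed_poly Q" "Q \<noteq> 0"
    and ev1: "eventually (\<lambda>T. eval_poly (lengths T) Q \<noteq> 0 \<and> g T = eval_poly (lengths T) P / eval_poly (lengths T) Q) at_top"
    using x by (rule specE)
  obtain P' Q' where 2: "y = embed_poly P' / embed_poly Q'" "Q' \<noteq> 0"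
    and ev2: "eventually (\<lambda>T. eval_poly (lengths T) Q' \<noteq> 0 \<and> h T = eval_poly (lengths T) P' / eval_poly (lengths T) Q') at_top"
    using y by (rule specE)
  show ?thesis
  proof (rule specI)
    show "x + y = embed_poly (P * Q' + P' * Q) / embed_poly (Q * Q')" unfolding 1(1) 2(1) using 1(2) 2(2) by (simp add: add_frac_eq)
    show "eventually (\<lambda>T. eval_poly (lengths T) (Q * Q') \<noteq> 0 \<and>
        g T + h T = eval_poly (lengths T) (P * Q' + P' * Q) / eval_poly (lengths T) (Q * Q')) at_top"
      using ev1 ev2 by eventually_elim (simp add: add_frac_eq)
  qed
qed

lemma spec_mult: "spec x g \<Longrightarrow> spec y h \<Longrightarrow> spec (x * y) (\<lambda>T. g T * h T)"
proof -
  assume x: "spec x g" and y: "spec y h"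
  obtain P Q where 1: "x = embed_poly P / embed_poly Q" "Q \<noteq> 0"
    and ev1: "eventually (\<lambda>T. eval_poly (lengths T) Q \<noteq> 0 \<and> g T = eval_poly (lengths T) P / eval_poly (lengths T) Q) at_top"
    using x by (rule specE)
  obtain P' Q' where 2: "y = embed_poly P' / embed_poly Q'" "Q' \<noteq> 0"
    and ev2: "eventually (\<lambda>T. eval_poly (lengths T) Q' \<noteq> 0 \<and> h T = eval_poly (lengths T) P' / eval_poly (lengths T) Q') at_top"
    using y by (rule specE)
  show ?thesis
  proof (rule specI)
    show "x * y = embed_poly (P * P') / embed_poly (Q * Q')" unfolding 1(1) 2(1) by simp
    show "eventually (\<lambda>T. eval_poly (lengths T) (Q * Q') \<noteq> 0 \<and>
        g T * h T = eval_poly (lengths T) (P * P') / eval_poly (lengths T) (Q * Q')) at_top"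
      using ev1 ev2 by eventually_elim simp
  qed
qed

lemma spec_inverse: "spec x g \<Longrightarrow> eventually (\<lambda>T. g T \<noteq> 0) at_top \<Longrightarrow> spec (inverse x) (\<lambda>T. inverse (g T))"
proof -
  assume x: "spec x g" and nz: "eventually (\<lambda>T. g T \<noteq> 0) at_top"
  obtain P Q where *: "x = embed_poly P / embed_poly Q"
    and ev: "eventually (\<lambda>T. eval_poly (lengths T) Q \<noteq> 0 \<and> g T = eval_poly (lengths T) P / eval_poly (lengths T) Q) at_top"
    using x by (rule specE)
  show ?thesis
  proof (rule specI)
    show "inverse x = embed_poly Q / embed_poly P" by (simp add: *)
    show "eventually (\<lambda>T. eval_poly (lengths T) P \<noteq> 0 \<and>
        inverse (g T) = eval_poly (lengths T) Q / eval_poly (lengths T) P) at_top"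
      using ev nz by eventually_elim simp
  qed
qed

lemma spec_zero_imp: "spec 0 g \<Longrightarrow> eventually (\<lambda>T. g T = 0) at_top"
proof -
  assume "spec 0 g"
  then obtain P Q where "0 = embed_poly P / embed_poly Q" "Q \<noteq> 0"
    and ev: "eventually (\<lambda>T. eval_poly (lengths T) Q \<noteq> 0 \<and> g T = eval_poly (lengths T) P / eval_poly (lengths T) Q) at_top"
    by (rule specE)
  then have "P = 0" by (metis divide_eq_0_iff embed_poly_eq_0)
  show ?thesis using ev by eventually_elim (simp add: \<open>P = 0\<close>)
qed

lemma spec_cong: "spec x g \<Longrightarrow> eventually (\<lambda>T. g T = h T) at_top \<Longrightarrow> spec x h"
proof -
  assume x: "spec x g" and gh: "eventually (\<lambda>T. g T = h T) at_top"
  obtain P Q where *: "x = embed_poly P / embed_poly Q"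
    and ev: "eventually (\<lambda>T. eval_poly (lengths T) Q \<noteq> 0 \<and> g T = eval_poly (lengths T) P / eval_poly (lengths T) Q) at_top"
    using x by (rule specE)
  show ?thesis
    by (rule specI[OF *]) (use ev gh in eventually_elim, simp)
qed

lemma spec_one: "spec 1 (\<lambda>T. 1)"
  using spec_of_rat[of 1] by simp

lemma spec_zero: "spec 0 (\<lambda>T. 0)"
  using spec_of_rat[of 0] by simp

lemma spec_numeral: "spec (numeral k) (\<lambda>T. numeral k)"
  using spec_of_rat[of "numeral k"] by (simp add: of_rat_numeral_eq)

lemma spec_minus: "spec x g \<Longrightarrow> spec (- x) (\<lambda>T. - g T)"
  using spec_mult[OF spec_of_rat[of "- 1"], of x g] by (simp add: of_rat_minus)

lemma spec_diff: "spec x g \<Longrightarrow> spec y h \<Longrightarrow> spec (x - y) (\<lambda>T. g T - h T)"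
  using spec_add[OF _ spec_minus, of x g y h] by simp

lemma spec_power: "spec x g \<Longrightarrow> spec (x ^ k) (\<lambda>T. g T ^ k)"
  by (induction k) (auto intro: spec_one spec_mult)

lemma spec_sum: "(\<And>i. i \<in> I \<Longrightarrow> spec (x i) (g i)) \<Longrightarrow> spec (\<Sum>i\<in>I. x i) (\<lambda>T. \<Sum>i\<in>I. g i T)"
  by (induction I rule: infinite_finite_induct) (auto intro: spec_zero spec_add)

lemma spec_prod: "(\<And>i. i \<in> I \<Longrightarrow> spec (x i) (g i)) \<Longrightarrow> spec (\<Prod>i\<in>I. x i) (\<lambda>T. \<Prod>i\<in>I. g i T)"
  by (induction I rule: infinite_finite_induct) (auto intro: spec_one spec_mult)

lemma spec_sq_length:
  assumes "i \<le> CARD('n)" "j \<le> CARD('n)" "i \<noteq> j"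
  shows "spec (sq_length i j) (\<lambda>T. \<sigma> T i j)"
proof -
  let ?e = "Edge (min i j, max i j) :: 'n simplex_edge"
  let ?P = "Poly_Mapping.single (Poly_Mapping.single ?e 1) 1 :: ('n simplex_edge \<Rightarrow>\<^sub>0 nat) \<Rightarrow>\<^sub>0 rat"
  have e: "edge_ends ?e = (min i j, max i j)"
    using assms by (intro Edge_inverse) auto
  have eP: "eval_poly (lengths T) ?P = sqrt (\<sigma> T i j)" for T
    using \<sigma>_sym[of T i j] e
    by (cases "i \<le> j") (simp_all add: eval_poly_single eval_monom_def lengths_def min_def max_def)
  have "spec (edge_length i j) (\<lambda>T. sqrt (\<sigma> T i j))"
  proof (rule specI)
    show "edge_length i j = embed_poly ?P / embed_poly 1"
      by (simp add: edge_length_def embed_poly_def)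
    show "eventually (\<lambda>T. eval_poly (lengths T) 1 \<noteq> 0 \<and>
        sqrt (\<sigma> T i j) = eval_poly (lengths T) ?P / eval_poly (lengths T) 1) at_top"
      by (simp only: eP) simp
  qed
  then have "spec (sq_length i j) (\<lambda>T. sqrt (\<sigma> T i j) ^ 2)"
    unfolding sq_length_def by (rule spec_power)
  then show ?thesis
    by (rule spec_cong) (use \<sigma>_nonneg[OF assms(1,2)] in eventually_elim, simp)
qed

lemma spec_heron:
  assumes "{i, j, k} \<subseteq> {0..CARD('n)}" "distinct [i, j, k]"
  shows "spec (heron sq_length i j k) (\<lambda>T. heron (\<sigma> T) i j k)"
  unfolding heron_def using assms
  by (intro spec_mult spec_add spec_diff spec_power spec_sq_length spec_numeral)
    (use spec_of_rat[of "1 / 16"] in \<open>auto simp: of_rat_divide of_rat_numeral_eq\<close>)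

lemma spec_det:
  assumes "\<And>i j. i < m \<Longrightarrow> j < m \<Longrightarrow> spec (f i j) (\<lambda>T. g T i j)"
  shows "spec (det_of m f) (\<lambda>T. det_of m (g T))"
proof -
  have "spec (\<Sum>p\<in>{p. p permutes {0..<m}}. of_int (sign p) * (\<Prod>i = 0..<m. f i (p i)))
      (\<lambda>T. \<Sum>p\<in>{p. p permutes {0..<m}}. of_int (sign p) * (\<Prod>i = 0..<m. g T i (p i)))"
  proof (intro spec_sum spec_mult spec_prod)
    fix p :: "nat \<Rightarrow> nat" show "spec (of_int (sign p)) (\<lambda>T. of_int (sign p))"
      using spec_of_rat[of "of_int (sign p)"] by simp
    fix i assume "p \<in> {p. p permutes {0..<m}}" "i \<in> {0..<m}"
    then show "spec (f i (p i)) (\<lambda>T. g T i (p i))"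
      using permutes_in_image[of p "{0..<m}" i] by (intro assms) auto
  qed
  then show ?thesis by (simp only: det_of_eq_sum)
qed

lemma spec_cayley_menger:
  "spec (cayley_menger (CARD('n)) sq_length) (\<lambda>T. cayley_menger (CARD('n)) (\<sigma> T))"
proof -
  let ?n = "CARD('n)"
  let ?G = "\<lambda>s a b. if a = b then 0 else if a = 0 \<or> b = 0 then 1 else s (a - 1) (b - 1)"
  let ?c = "(- 1) ^ (?n + 1) / (2 ^ ?n * (fact ?n)\<^sup>2) :: rat"
  have of_c: "of_rat ?c = ((- 1) ^ (?n + 1) / (2 ^ ?n * (fact ?n)\<^sup>2) :: 'a :: field_char_0)"
  proof -
    have "of_rat (fact ?n) = (fact ?n :: 'a)" by (metis of_nat_fact of_rat_of_nat_eq)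
    then show ?thesis by (simp add: of_rat_divide of_rat_mult of_rat_power of_rat_minus)
  qed
  have "spec (of_rat ?c * det_of (?n + 2) (?G sq_length)) (\<lambda>T. of_rat ?c * det_of (?n + 2) (?G (\<sigma> T)))"
  proof (intro spec_mult spec_of_rat spec_det)
    fix a b assume ab: "a < ?n + 2" "b < ?n + 2"
    consider "a = b" | "a \<noteq> b" "a = 0 \<or> b = 0" | "a \<noteq> b" "a \<noteq> 0" "b \<noteq> 0" by blast
    then show "spec (?G sq_length a b) (\<lambda>T. ?G (\<sigma> T) a b)"
    proof cases
      case 3
      then have "spec (sq_length (a - 1) (b - 1)) (\<lambda>T. \<sigma> T (a - 1) (b - 1))"
        using ab by (intro spec_sq_length) auto
      with 3 show ?thesis by simp
    qed (auto intro: spec_zero spec_one)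
  qed
  then show ?thesis
    unfolding of_c by (simp add: cayley_menger_def cayley_menger_mat_def)
qed

end

section \<open>A family of simplices with bounded areas and unbounded volume\<close>

text \<open>
  Opposite edges are equal, and the lengths are \<open>sqrt T\<close>, \<open>sqrt T\<close> and nearly \<open>2 * sqrt T\<close>.  The term
  \<open>1 / T\<close> makes the areas tend to a positive limit.
\<close>

definition long_sq :: "real \<Rightarrow> nat \<Rightarrow> nat \<Rightarrow> real" where
  "long_sq T i j = (if i = j then 0 else if i + j = 3 then 4 * T - 1 / T else T)"

text \<open>
  The vertices 4 and 5 are the vertices 0 and 1 displaced by vectors of squared length \<open>1 / T\<close> that are
  orthogonal to each other and to the tetrahedron.
\<close>

definition degen_sq :: "real \<Rightarrow> nat \<Rightarrow> nat \<Rightarrow> real" where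
  "degen_sq T i j = (if i = j then 0 else
     long_sq T (i mod 4) (j mod 4) + (if i < 4 then 0 else 1 / T) + (if j < 4 then 0 else 1 / T))"

lemma degen_sq_sym: "degen_sq T i j = degen_sq T j i"
  by (simp add: degen_sq_def long_sq_def add.commute)

lemma degen_sq_nonneg: "eventually (\<lambda>T. 0 \<le> degen_sq T i j) at_top"
proof -
  have "eventually (\<lambda>T :: real. T > 1) at_top" by (rule eventually_gt_at_top)
  then show ?thesis
  proof eventually_elim
    case (elim T)
    define u where "u = 1 / T"
    have "0 \<le> u" "u \<le> 1" using elim by (simp_all add: u_def)
    then show ?case
      using elim unfolding degen_sq_def long_sq_def u_def[symmetric] by (simp split: if_split)
  qed
qed

lemma degen_sq_values:
  "degen_sq T 0 1 = T"
  "degen_sq T 0 2 = T"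
  "degen_sq T 0 3 = 4 * T - 1 / T"
  "degen_sq T 0 4 = 1 / T"
  "degen_sq T 0 5 = T + 1 / T"
  "degen_sq T 1 2 = 4 * T - 1 / T"
  "degen_sq T 1 3 = T"
  "degen_sq T 1 4 = T + 1 / T"
  "degen_sq T 1 5 = 1 / T"
  "degen_sq T 2 3 = T"
  "degen_sq T 2 4 = T + 1 / T"
  "degen_sq T 2 5 = 4 * T - 1 / T + 1 / T"
  "degen_sq T 3 4 = 4 * T - 1 / T + 1 / T"
  "degen_sq T 3 5 = T + 1 / T"
  "degen_sq T 4 5 = T + 1 / T + 1 / T"
  by (simp_all add: degen_sq_def long_sq_def)

lemma two_faces_5:
  assumes *: "(i, j, k) \<in> two_faces 5"
  shows "(i, j, k) \<in> {(0, 1, 2), (0, 1, 3), (0, 1, 4), (0, 1, 5), (0, 2, 3), (0, 2, 4), (0, 2, 5), (0, 3, 4), (0, 3, 5), (0, 4, 5),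
     (1, 2, 3), (1, 2, 4), (1, 2, 5), (1, 3, 4), (1, 3, 5), (1, 4, 5), (2, 3, 4), (2, 3, 5), (2, 4, 5), (3, 4, 5)}"
proof -
  from * have "i = 0 \<or> i = 1 \<or> i = 2 \<or> i = 3" "j = 1 \<or> j = 2 \<or> j = 3 \<or> j = 4" "k = 2 \<or> k = 3 \<or> k = 4 \<or> k = 5"
    by (auto simp: two_faces_def)
  with * show "(i, j, k) \<in> {(0, 1, 2), (0, 1, 3), (0, 1, 4), (0, 1, 5), (0, 2, 3), (0, 2, 4), (0, 2, 5), (0, 3, 4), (0, 3, 5), (0, 4, 5),
     (1, 2, 3), (1, 2, 4), (1, 2, 5), (1, 3, 4), (1, 3, 5), (1, 4, 5), (2, 3, 4), (2, 3, 5), (2, 4, 5), (3, 4, 5)}"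
    by (elim disjE) (simp_all add: two_faces_def)
qed

text \<open>
  For \<open>u = 1 / T\<close> each squared area is a polynomial in \<open>T * u\<close> and \<open>u\<^sup>2\<close>, the terms with \<open>T\<^sup>2\<close> cancel.
\<close>

lemma degen_face:
  assumes "(i, j, k) \<in> two_faces 5" "1 \<le> T"
  shows "1 / 8 \<le> heron (degen_sq T) i j k \<and> heron (degen_sq T) i j k \<le> 100"
proof -
  define u where "u = 1 / T"
  have "0 \<le> u" "u \<le> 1" using assms(2) by (simp_all add: u_def)
  then have "u * u \<le> 1" by (intro mult_le_one)
  then have u: "T * u = 1" "0 \<le> u * u" "u * u \<le> 1"
    using assms(2) by (simp_all add: u_def)
  have h: "heron (degen_sq T) i j k = (1 / 16) * (2 * degen_sq T i j * degen_sq T j k + 2 * degen_sq T j k * degen_sq T i k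
      + 2 * degen_sq T i k * degen_sq T i j - (degen_sq T i j)\<^sup>2 - (degen_sq T j k)\<^sup>2 - (degen_sq T i k)\<^sup>2)" for i j k
    by (simp add: heron_def degen_sq_sym[of T k i])
  show ?thesis
    using two_faces_5[OF assms(1)] u
    unfolding insert_iff empty_iff prod.inject
    by (elim disjE conjE; hypsubst?; unfold h degen_sq_values u_def[symmetric]; simp add: algebra_simps power2_eq_square)
qed

text \<open>
  With \<open>m\<close> displaced vertices the Schur complement of the tetrahedron is \<open>1 / T\<close> times the unit matrix.
  The matrix \<open>K\<close> says that vertex 5 lies above vertex 1, while vertex 4 lies above the base point 0.
\<close>

lemma degen_gram_det:
  assumes "m \<le> 2"
  shows "det_of (3 + m) (\<lambda>i j. gram (degen_sq T) 0 (Suc i) (Suc j)) =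
    - ((2 * T - 1 / T) * (4 * T - 1 / T)\<^sup>2 / 2) * (1 / T) ^ m"
proof -
  let ?K = "\<lambda>b v. if v = 1 \<and> b = 0 then 1 else 0 :: real"
  interpret distances "degen_sq T"
    by unfold_locales (simp_all add: degen_sq_sym degen_sq_def)
  define u where "u = 1 / T"
  note D = degen_sq_def[of T, folded u_def] long_sq_def[of T, folded u_def]
  have three: "{..<3::nat} = {0, 1, 2}" by auto
  have "det_of (3 + m) (\<lambda>i j. gram (degen_sq T) 0 (Suc i) (Suc j)) =
      det_of 3 (\<lambda>i j. gram (degen_sq T) 0 (Suc i) (Suc j)) *
      det_of m (\<lambda>a b. gram (degen_sq T) 0 (Suc (3 + a)) (Suc (3 + b)) -
        (\<Sum>c<3. gram (degen_sq T) 0 (Suc (3 + a)) (Suc c) * ?K c b))"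
  proof (rule det_of_schur)
    fix a v :: nat assume "a < 3" "v < m"
    then have "a = 0 \<or> a = 1 \<or> a = 2" "v = 0 \<or> v = 1" using assms by auto
    then show "gram (degen_sq T) 0 (Suc a) (Suc (3 + v)) = (\<Sum>b<3. gram (degen_sq T) 0 (Suc a) (Suc b) * ?K b v)"
      unfolding three
      by (elim disjE) (simp_all add: gram_def D)
  qed
  also have "det_of 3 (\<lambda>i j. gram (degen_sq T) 0 (Suc i) (Suc j)) = - ((2 * T - 1 / T) * (4 * T - 1 / T)\<^sup>2 / 2)"
    unfolding det_of_3 u_def[symmetric] by (simp add: gram_def D) (simp add: field_simps power2_eq_square)
  also have "det_of m (\<lambda>a b. gram (degen_sq T) 0 (Suc (3 + a)) (Suc (3 + b)) -
        (\<Sum>c<3. gram (degen_sq T) 0 (Suc (3 + a)) (Suc c) * ?K c b)) = det_of m (\<lambda>a b. if a = b then u else 0)"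
  proof (rule det_of_cong)
    fix a b assume "a < m" "b < m"
    then have "a = 0 \<or> a = 1" "b = 0 \<or> b = 1" using assms by auto
    then show "gram (degen_sq T) 0 (Suc (3 + a)) (Suc (3 + b)) -
        (\<Sum>c<3. gram (degen_sq T) 0 (Suc (3 + a)) (Suc c) * ?K c b) = (if a = b then u else 0)"
      unfolding three
      by (elim disjE) (simp_all add: gram_def D)
  qed
  also have "\<dots> = (1 / T) ^ m"
    unfolding u_def[symmetric]
  proof -
    have "m = 0 \<or> m = 1 \<or> m = 2" using assms by auto
    then show "det_of m (\<lambda>a b. if a = b then u else 0) = u ^ m"
      by (elim disjE) (simp_all add: det_of_0 det_of_1[unfolded One_nat_def] det_of_2 power2_eq_square)
  qed
  finally show ?thesis .
qed

lemma degen_cayley_menger_unbounded: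
  assumes "3 \<le> n" "n \<le> 5"
  shows "filterlim (\<lambda>T. \<bar>cayley_menger n (degen_sq T)\<bar>) at_top at_top"
proof -
  define m where "m = n - 3"
  have m: "n = 3 + m" "m = 0 \<or> m = 1 \<or> m = 2" using assms by (auto simp: m_def)
  have cm: "cayley_menger n (degen_sq T) = - ((2 * T - 1 / T) * (4 * T - 1 / T)\<^sup>2 / 2) * (1 / T) ^ m / (fact n)\<^sup>2" for T
  proof -
    interpret distances "degen_sq T"
      by unfold_locales (simp_all add: degen_sq_sym degen_sq_def)
    have "m \<le> 2" using m(2) by auto
    then show ?thesis unfolding cayley_menger_eq_gram_det m(1) by (subst degen_gram_det) simp_all
  qed
  have abs: "\<bar>- x * y / z\<bar> = \<bar>x * y\<bar> * inverse z" if "z > 0" for x y z :: real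
    using that by (simp add: abs_mult divide_inverse)
  have e: "\<bar>cayley_menger n (degen_sq T)\<bar> = \<bar>(2 * T - 1 / T) * (4 * T - 1 / T)\<^sup>2 / 2 * (1 / T) ^ m\<bar> * inverse ((fact n)\<^sup>2)" for T
    unfolding cm by (rule abs) simp
  have "filterlim (\<lambda>T :: real. \<bar>(2 * T - 1 / T) * (4 * T - 1 / T)\<^sup>2 / 2 * (1 / T) ^ m\<bar>) at_top at_top"
    using m(2)
  proof (elim disjE)
    assume "m = 0"
    show ?thesis unfolding \<open>m = 0\<close> by real_asymp
  next
    assume "m = 1"
    show ?thesis unfolding \<open>m = 1\<close> by real_asymp
  next
    assume "m = 2"
    show ?thesis unfolding \<open>m = 2\<close> by real_asymp
  qed
  then show ?thesis
    unfolding e by (rule filterlim_at_top_mult_tendsto_pos[OF tendsto_const, rotated]) simp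
qed

section \<open>The main result\<close>

lemma rat_subalgebra_hull: "rat_subalgebra (rat_subalgebra hull S)" for S :: "'a :: field_char_0 set"
proof (rule hull_in)
  fix T :: "'a set set" assume T: "\<forall>R\<in>T. rat_subalgebra R"
  have "of_rat r \<in> R" "x \<in> R \<Longrightarrow> y \<in> R \<Longrightarrow> x + y \<in> R" "x \<in> R \<Longrightarrow> y \<in> R \<Longrightarrow> x * y \<in> R"
    if "R \<in> T" for r R x y
    using bspec[OF T that] by (auto simp: rat_subalgebra_def)
  then show "rat_subalgebra (\<Inter>T)" unfolding rat_subalgebra_def by auto
qed

lemma rat_subalgebra_unital_subring:
  assumes "rat_subalgebra R"
  shows "unital_subring R"
proof
  have rat: "of_rat r \<in> R" for r using assms by (auto simp: rat_subalgebra_def)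
  show "1 \<in> R" using rat[of 1] by simp
  show "x * y \<in> R" if "x \<in> R" "y \<in> R" for x y
    using assms that by (auto simp: rat_subalgebra_def)
  have "- 1 \<in> R" using rat[of "- 1"] by (simp add: of_rat_minus)
  then show "x - y \<in> R" if "x \<in> R" "y \<in> R" for x y
    using assms that unfolding rat_subalgebra_def by (metis mult_minus1 diff_conv_add_uminus)
qed

lemma rat_subalgebra_valuation_ring:
  assumes "rat_subalgebra R" "R \<subseteq> B" "valuation_ring B"
  shows "char_zero_valuation_ring B"
proof -
  interpret valuation_ring B by fact
  show ?thesis
    by unfold_locales (use assms(1,2) in \<open>auto simp: rat_subalgebra_def\<close>)
qed

lemma integral_over_mono: "integral_over R x \<Longrightarrow> R \<subseteq> B \<Longrightarrow> integral_over B x"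
  unfolding integral_over_def by blast

lemma (in char_zero_valuation_ring) one_vle_square_if_unit:
  assumes "inverse x \<in> R" "x \<noteq> 0"
  shows "1 \<le>\<^sub>v x\<^sup>2"
proof -
  have "(inverse x)\<^sup>2 * x\<^sup>2 \<le>\<^sub>v x\<^sup>2"
    by (intro vle_mult_mem power_mem assms(1) vle_refl)
  then show ?thesis using assms(2) by (simp flip: power_mult_distrib)
qed

lemma (in char_zero_valuation_ring) mem_if_square_mem: "x\<^sup>2 \<in> R \<Longrightarrow> x \<in> R"
  using vle_square_iff[of x 1] by simp

text \<open>
  The value of \<open>sq_length\<close> on the diagonal carries no meaning; here it is replaced by 0.
\<close>

definition vertex_dist :: "nat \<Rightarrow> nat \<Rightarrow> 'n :: finite simplex_field" where
  "vertex_dist i j = (if i = j then 0 else sq_length i j)"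

lemma distances_vertex_dist: "distances vertex_dist"
  by unfold_locales (simp_all add: vertex_dist_def sq_length_def edge_length_def min.commute max.commute)

lemma cayley_menger_vertex_dist:
  "cayley_menger n (vertex_dist :: nat \<Rightarrow> nat \<Rightarrow> 'n :: finite simplex_field) = cayley_menger n sq_length"
proof -
  have "cayley_menger_mat n (vertex_dist :: nat \<Rightarrow> nat \<Rightarrow> 'n simplex_field) = cayley_menger_mat n sq_length"
    unfolding cayley_menger_mat_def by (intro eq_matI) (auto simp: vertex_dist_def)
  then show ?thesis by (simp add: cayley_menger_def)
qed

text \<open>
  Specialize all edge lengths to 1.
\<close>

lemma heron_sq_length_nonzero:
  assumes "{i, j, k} \<subseteq> {0..CARD('n :: finite)}" "distinct [i, j, k]"
  shows "heron (sq_length :: nat \<Rightarrow> nat \<Rightarrow> 'n simplex_field) i j k \<noteq> 0"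
proof
  interpret specialization "\<lambda>_ _ _. 1" "TYPE('n)"
    by unfold_locales simp_all
  assume "heron (sq_length :: nat \<Rightarrow> nat \<Rightarrow> 'n simplex_field) i j k = 0"
  with spec_heron[OF assms] have "spec 0 (\<lambda>T. heron (\<lambda>_ _. 1) i j k)" by simp
  from spec_zero_imp[OF this] show False by (simp add: heron_def)
qed

lemma (in distances) face_sq_sorted:
  assumes "distinct [a, b, c]" "{a, b, c} \<subseteq> {0..n}"
  obtains i j k where "(i, j, k) \<in> two_faces n" "face_sq s a b c = face_sq s i j k"
proof -
  consider "a < b" "b < c" | "a < c" "c < b" | "b < a" "a < c" | "b < c" "c < a" | "c < a" "a < b" | "c < b" "b < a"
    using assms(1) by fastforce
  then show ?thesis
  proof cases
    case 1 with assms show ?thesis by (intro that[of a b c]) (auto simp: two_faces_def)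
  next
    case 2 with assms show ?thesis by (intro that[of a c b]) (auto simp: two_faces_def face_sq_perm(2)[of a b c])
  next
    case 3 with assms show ?thesis by (intro that[of b a c]) (auto simp: two_faces_def face_sq_perm(1)[of a b c])
  next
    case 4 with assms show ?thesis
      by (intro that[of b c a]) (auto simp: two_faces_def face_sq_perm(1)[of a b c] face_sq_perm(2)[of b a c])
  next
    case 5 with assms show ?thesis
      by (intro that[of c a b]) (auto simp: two_faces_def face_sq_perm(2)[of a b c] face_sq_perm(1)[of a c b])
  next
    case 6 with assms show ?thesis
      by (intro that[of c b a])
        (auto simp: two_faces_def face_sq_perm(2)[of a b c] face_sq_perm(1)[of a c b] face_sq_perm(2)[of c a b])
  qed
qed

locale simplex_areas =
  fixes A :: "nat \<times> nat \<times> nat \<Rightarrow> 'n :: finite simplex_field" and V :: "'n simplex_field"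
  assumes area_sq: "(i, j, k) \<in> two_faces CARD('n) \<Longrightarrow> (A (i, j, k))\<^sup>2 = heron sq_length i j k"
    and volume_sq: "V\<^sup>2 = cayley_menger CARD('n) sq_length"
begin

lemma area_nonzero: "t \<in> two_faces CARD('n) \<Longrightarrow> A t \<noteq> 0"
proof (cases t)
  case (fields i j k)
  assume "t \<in> two_faces CARD('n)"
  then have t: "(i, j, k) \<in> two_faces CARD('n)" by (simp add: fields)
  then have "heron (sq_length :: nat \<Rightarrow> nat \<Rightarrow> 'n simplex_field) i j k \<noteq> 0"
    by (intro heron_sq_length_nonzero) (auto simp: two_faces_def)
  then show ?thesis using area_sq[OF t] by (auto simp: fields)
qed

lemma rat_subalgebra_area_laurent_ring: "rat_subalgebra (area_laurent_ring A)"
  unfolding area_laurent_ring_def by (rule rat_subalgebra_hull)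

lemma generators_mem: "t \<in> two_faces CARD('n) \<Longrightarrow> A t \<in> area_laurent_ring A \<and> inverse (A t) \<in> area_laurent_ring A"
  unfolding area_laurent_ring_def by (auto intro!: subsetD[OF hull_subset])

lemma volume_integral:
  assumes "CARD('n) \<ge> 6"
  shows "integral_over (area_laurent_ring A) V"
proof (rule unital_subring.integral_if_mem_valuation_rings)
  show "unital_subring (area_laurent_ring A)"
    by (rule rat_subalgebra_unital_subring[OF rat_subalgebra_area_laurent_ring])
  fix B :: "'n simplex_field set" assume B: "valuation_ring B" "area_laurent_ring A \<subseteq> B"
  interpret char_zero_valuation_ring B
    by (rule rat_subalgebra_valuation_ring[OF rat_subalgebra_area_laurent_ring B(2,1)])
  let ?s = "vertex_dist :: nat \<Rightarrow> nat \<Rightarrow> 'n simplex_field" and ?l = "sq_length :: nat \<Rightarrow> nat \<Rightarrow> 'n simplex_field"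
  interpret distances "vertex_dist :: nat \<Rightarrow> nat \<Rightarrow> 'n simplex_field"
    by (rule distances_vertex_dist)
  have face: "face_sq ?s i j k \<in> B \<and> vle 1 (face_sq ?s i j k)"
    if t: "(i, j, k) \<in> two_faces CARD('n)" for i j k
  proof -
    have "face_sq ?s i j k = 4 * heron ?l i j k"
      using t unfolding face_sq_eq_heron by (simp add: heron_def vertex_dist_def two_faces_def)
    also have "\<dots> = 4 * (A (i, j, k))\<^sup>2" using area_sq[OF t] by simp
    finally have f: "face_sq ?s i j k = 4 * (A (i, j, k))\<^sup>2" .
    have mem: "A (i, j, k) \<in> B" "inverse (A (i, j, k)) \<in> B"
      using generators_mem[OF t] B(2) by auto
    have "vle 1 ((A (i, j, k))\<^sup>2)"
      using mem(2) area_nonzero[OF t] by (rule one_vle_square_if_unit)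
    then show ?thesis unfolding f vle_numeral_mult_right using mem by (simp add: mult_mem power_mem)
  qed
  have "unit_areas B ?s CARD('n)"
  proof (intro unit_areas.intro unit_areas_axioms.intro)
    show "char_zero_valuation_ring B" "distances ?s"
      by unfold_locales
    show "6 \<le> CARD('n)" by (rule assms)
    fix a b c :: nat assume abc: "distinct [a, b, c]" "{a, b, c} \<subseteq> {0..CARD('n)}"
    from abc obtain i j k where t: "(i, j, k) \<in> two_faces CARD('n)"
      and e: "face_sq ?s a b c = face_sq ?s i j k"
      by (rule face_sq_sorted)
    show "face_sq ?s a b c \<in> B"
      "vle 1 (face_sq ?s a b c)"
      using face[OF t] unfolding e by blast+
  qed
  then have "cayley_menger CARD('n) ?s \<in> B"
    by (rule unit_areas.cayley_menger_mem)
  then have "V\<^sup>2 \<in> B" by (simp add: volume_sq cayley_menger_vertex_dist)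
  then show "V \<in> B" by (rule mem_if_square_mem)
qed

end

lemma area_polys_closed:
  assumes "a \<in> area_polys n" "b \<in> area_polys n"
  shows "a + b \<in> area_polys n" "a * b \<in> area_polys n"
proof -
  show "a + b \<in> area_polys n"
    using assms subsetD[OF keys_add[of a b]] by (fastforce simp: area_polys_def)
  have "Poly_Mapping.keys m \<subseteq> two_faces n" if m: "m \<in> Poly_Mapping.keys (a * b)" for m
  proof -
    obtain u v where "u \<in> Poly_Mapping.keys a" "v \<in> Poly_Mapping.keys b" "m = u + v"
      using subsetD[OF keys_mult m] by auto
    then show ?thesis using assms keys_add[of u v] unfolding area_polys_def by blast
  qed
  then show "a * b \<in> area_polys n" by (simp add: area_polys_def)
qed

text \<open>
  The squared area is the defect in the Cauchy-Schwarz inequality for two sides, which vanishes only for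
  collinear points.
\<close>

lemma face_area_nonzero:
  fixes p :: "nat \<Rightarrow> real ^ 'n :: finite"
  assumes p: "nondegenerate_simplex p" and t: "t \<in> two_faces CARD('n)"
  shows "face_area p t \<noteq> 0"
proof (cases t)
  case (fields i j k)
  with t have ijk: "i < j" "j < k" "k \<le> CARD('n)" by (auto simp: two_faces_def)
  define u v where "u = p i - p j" and "v = p k - p j"
  have ne: "p i \<noteq> p j" "p i \<noteq> p k" "p j \<noteq> p k"
    using p ijk unfolding nondegenerate_simplex_def by (auto dest: inj_onD)
  have "\<not> affine_dependent {p i, p j, p k}"
    using p ijk affine_dependent_subset[of "{p i, p j, p k}" "p ` {..CARD('n)}"]
    unfolding nondegenerate_simplex_def by auto
  then have "\<not> collinear {p i, p j, p k}"
    using ne by (simp add: collinear_3_eq_affine_dependent)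
  then have "\<not> collinear {0, u, v}"
    unfolding u_def v_def by (simp add: collinear_3[of "p i" "p j" "p k"])
  then have "\<bar>u \<bullet> v\<bar> \<noteq> norm u * norm v" by (simp add: norm_cauchy_schwarz_equal)
  then have "(u \<bullet> v)\<^sup>2 \<noteq> (norm u * norm v)\<^sup>2"
    by (metis abs_of_nonneg mult_nonneg_nonneg norm_ge_zero power2_eq_iff abs_minus_cancel)
  moreover have "heron (\<lambda>a b. (dist (p a) (p b))\<^sup>2) i j k = ((norm u * norm v)\<^sup>2 - (u \<bullet> v)\<^sup>2) / 4"
  proof -
    have d: "(dist (p i) (p j))\<^sup>2 = u \<bullet> u" "(dist (p j) (p k))\<^sup>2 = v \<bullet> v"
      "(dist (p k) (p i))\<^sup>2 = u \<bullet> u + v \<bullet> v - 2 * (u \<bullet> v)"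
      by (simp_all add: dist_norm u_def v_def power2_norm_eq_inner inner_diff inner_commute algebra_simps)
    show ?thesis
      unfolding heron_def d power_mult_distrib power2_norm_eq_inner
      by (simp add: field_simps power2_eq_square)
  qed
  ultimately show ?thesis by (simp add: face_area_def fields)
qed

context simplex_areas
begin

lemma localized_ringI:
  assumes "x = eval_poly A a / eval_poly A b" "a \<in> area_polys CARD('n)" "b \<in> area_polys CARD('n)"
    "\<And>p :: nat \<Rightarrow> real ^ 'n. nondegenerate_simplex p \<Longrightarrow> eval_poly (face_area p) b \<noteq> 0"
  shows "x \<in> area_localized_ring A"
  using assms unfolding area_localized_ring_def by blast

lemma rat_subalgebra_localized_ring: "rat_subalgebra (area_localized_ring A)"
proof -
  have "of_rat r \<in> area_localized_ring A" for r
    by (rule localized_ringI[of _ "Poly_Mapping.single 0 r" 1])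
      (simp_all add: eval_poly_single area_polys_def)
  moreover have "x + y \<in> area_localized_ring A \<and> x * y \<in> area_localized_ring A"
    if x: "x \<in> area_localized_ring A" and y: "y \<in> area_localized_ring A" for x y
  proof -
    from x obtain a b where ab: "x = eval_poly A a / eval_poly A b" "a \<in> area_polys CARD('n)" "b \<in> area_polys CARD('n)"
      and nb: "\<And>p :: nat \<Rightarrow> real ^ 'n. nondegenerate_simplex p \<Longrightarrow> eval_poly (face_area p) b \<noteq> 0"
      unfolding area_localized_ring_def by blast
    from y obtain c d where cd: "y = eval_poly A c / eval_poly A d" "c \<in> area_polys CARD('n)" "d \<in> area_polys CARD('n)"
      and nd: "\<And>p :: nat \<Rightarrow> real ^ 'n. nondegenerate_simplex p \<Longrightarrow> eval_poly (face_area p) d \<noteq> 0"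
      unfolding area_localized_ring_def by blast
    have "x * y \<in> area_localized_ring A"
      by (rule localized_ringI[of _ "a * c" "b * d"]) (use ab cd nb nd in \<open>simp_all add: area_polys_closed\<close>)
    moreover have "x + y \<in> area_localized_ring A"
    \<comment> \<open>A denominator that vanishes in the field makes the quotient 0.\<close>
    proof (cases "eval_poly A b = 0 \<or> eval_poly A d = 0")
      case True
      then have "x = 0 \<or> y = 0" using ab cd by auto
      then show ?thesis using x y by auto
    next
      case False
      show ?thesis
        by (rule localized_ringI[of _ "a * d + c * b" "b * d"])
          (use ab cd nb nd False in \<open>simp_all add: area_polys_closed add_frac_eq\<close>)
    qed
    ultimately show ?thesis by blast
  qed
  ultimately show ?thesis by (auto simp: rat_subalgebra_def)
qed

lemma area_laurent_subset_localized: "area_laurent_ring A \<subseteq> area_localized_ring A"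
  unfolding area_laurent_ring_def
proof (rule hull_minimal)
  show "rat_subalgebra (area_localized_ring A)" by (rule rat_subalgebra_localized_ring)
  have "x \<in> area_localized_ring A" if t: "t \<in> two_faces CARD('n)" and x: "x \<in> {A t, inverse (A t)}" for x t
  proof -
    define v where "v = (Poly_Mapping.single (Poly_Mapping.single t 1) 1 :: (nat \<times> nat \<times> nat \<Rightarrow>\<^sub>0 nat) \<Rightarrow>\<^sub>0 rat)"
    have vA: "eval_poly A v = A t" and vp: "eval_poly (face_area p) v = face_area p t" for p :: "nat \<Rightarrow> real ^ 'n"
      by (simp_all add: v_def eval_poly_single eval_monom_def)
    have mem: "v \<in> area_polys CARD('n)" "1 \<in> area_polys CARD('n)"
      using t by (simp_all add: v_def area_polys_def)
    have "A t \<in> area_localized_ring A"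
    proof (rule localized_ringI[OF _ mem])
      show "A t = eval_poly A v / eval_poly A 1" by (simp only: vA eval_poly_one div_by_1)
    qed simp
    moreover have "inverse (A t) \<in> area_localized_ring A"
    proof (rule localized_ringI[OF _ mem(2,1)])
      show "inverse (A t) = eval_poly A 1 / eval_poly A v" by (simp only: vA eval_poly_one inverse_eq_divide)
      show "eval_poly (face_area p) v \<noteq> 0" if "nondegenerate_simplex p" for p :: "nat \<Rightarrow> real ^ 'n"
        unfolding vp using that t by (rule face_area_nonzero)
    qed
    ultimately show ?thesis using x by blast
  qed
  then show "(\<Union>t \<in> two_faces CARD('n). {A t, inverse (A t)}) \<subseteq> area_localized_ring A" by blast
qed

text \<open>
  Unlike the areas, the squared areas are polynomials in the edge lengths and can be specialized.
\<close>

definition sq_area_ring :: "'n simplex_field set" where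
  "sq_area_ring = rat_subalgebra hull (\<Union>t \<in> two_faces CARD('n). {(A t)\<^sup>2, inverse ((A t)\<^sup>2)})"

text \<open>
  A valuation ring that contains the squared areas and their inverses contains the areas and their
  inverses, because it contains every element whose square it contains.
\<close>

lemma volume_sq_integral:
  assumes "integral_over (area_laurent_ring A) V"
  shows "integral_over sq_area_ring (V\<^sup>2)"
proof (rule unital_subring.integral_if_mem_valuation_rings)
  have rat: "rat_subalgebra sq_area_ring" unfolding sq_area_ring_def by (rule rat_subalgebra_hull)
  then show "unital_subring sq_area_ring" by (rule rat_subalgebra_unital_subring)
  fix B :: "'n simplex_field set" assume B: "valuation_ring B" "sq_area_ring \<subseteq> B"
  interpret char_zero_valuation_ring B by (rule rat_subalgebra_valuation_ring[OF rat B(2,1)])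
  have "area_laurent_ring A \<subseteq> B"
    unfolding area_laurent_ring_def
  proof (rule hull_minimal)
    show "rat_subalgebra B"
      unfolding rat_subalgebra_def
      by (intro conjI ballI add_mem mult_mem image_subsetI of_rat_mem)
    have "A t \<in> B \<and> inverse (A t) \<in> B" if t: "t \<in> two_faces CARD('n)" for t
    proof
      have "{(A t)\<^sup>2, inverse ((A t)\<^sup>2)} \<subseteq> sq_area_ring"
        unfolding sq_area_ring_def by (rule order_trans[OF _ hull_subset]) (use t in blast)
      with B(2) have mem: "(A t)\<^sup>2 \<in> B" "inverse ((A t)\<^sup>2) \<in> B" by auto
      show "A t \<in> B" by (rule mem_if_square_mem[OF mem(1)])
      show "inverse (A t) \<in> B"
        by (rule mem_if_square_mem) (use mem(2) in \<open>simp add: power_inverse\<close>)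
    qed
    then show "(\<Union>t \<in> two_faces CARD('n). {A t, inverse (A t)}) \<subseteq> B" by auto
  qed
  then have "V \<in> B" using assms by (intro mem_if_integral integral_over_mono[OF assms])
  then show "V\<^sup>2 \<in> B" by (rule power_mem)
qed

text \<open>
  All elements of \<open>sq_area_ring\<close> are bounded along the family \<open>degen_sq\<close>.  A monic equation for \<open>V\<^sup>2\<close> with
  coefficients in this ring would bound the specialized \<open>V\<^sup>2\<close>.
\<close>

lemma volume_not_integral:
  assumes n: "CARD('n) \<ge> 3" "CARD('n) \<le> 5"
  shows "\<not> integral_over (area_laurent_ring A) V"
proof
  assume "integral_over (area_laurent_ring A) V"
  then have int: "integral_over sq_area_ring (V\<^sup>2)" by (rule volume_sq_integral)
  interpret specialization degen_sq "TYPE('n)"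
    by unfold_locales (rule degen_sq_sym, rule degen_sq_nonneg)
  define bdd where "bdd x \<longleftrightarrow> (\<exists>g C. spec x g \<and> eventually (\<lambda>T. \<bar>g T\<bar> \<le> C) at_top)" for x
  have bdd: "sq_area_ring \<subseteq> {x. bdd x}"
    unfolding sq_area_ring_def
  proof (rule hull_minimal)
    have "bdd ((A t)\<^sup>2) \<and> bdd (inverse ((A t)\<^sup>2))" if t: "t \<in> two_faces CARD('n)" for t
    proof (cases t)
      case (fields i j k)
      with t have ijk: "(i, j, k) \<in> two_faces CARD('n)" by simp
      have sp: "spec ((A t)\<^sup>2) (\<lambda>T. heron (degen_sq T) i j k)"
        unfolding fields area_sq[OF ijk] using ijk by (intro spec_heron) (auto simp: two_faces_def)
      have t5: "(i, j, k) \<in> two_faces 5" using ijk n by (auto simp: two_faces_def)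
      have ev: "eventually (\<lambda>T. 1 / 8 \<le> heron (degen_sq T) i j k \<and> heron (degen_sq T) i j k \<le> 100) at_top"
        using eventually_ge_at_top[of 1] by eventually_elim (rule degen_face[OF t5])
      have "eventually (\<lambda>T. heron (degen_sq T) i j k \<noteq> 0) at_top"
        using ev by eventually_elim auto
      with sp have sp': "spec (inverse ((A t)\<^sup>2)) (\<lambda>T. inverse (heron (degen_sq T) i j k))"
        by (rule spec_inverse)
      have "eventually (\<lambda>T. \<bar>heron (degen_sq T) i j k\<bar> \<le> 100) at_top"
        using ev by eventually_elim auto
      moreover have "eventually (\<lambda>T. \<bar>inverse (heron (degen_sq T) i j k)\<bar> \<le> 8) at_top"
        using ev
      proof eventually_elim
        case (elim T)
        then have "inverse (heron (degen_sq T) i j k) \<le> inverse (1 / 8)"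
          by (intro le_imp_inverse_le) auto
        then show ?case using elim by auto
      qed
      ultimately show ?thesis using sp sp' unfolding bdd_def by blast
    qed
    then show "(\<Union>t \<in> two_faces CARD('n). {(A t)\<^sup>2, inverse ((A t)\<^sup>2)}) \<subseteq> {x. bdd x}" by blast
    have "bdd (of_rat r)" for r
      unfolding bdd_def by (rule exI[of _ "\<lambda>T. of_rat r"], rule exI[of _ "\<bar>of_rat r\<bar>"]) (simp add: spec_of_rat)
    moreover have "bdd (x + y) \<and> bdd (x * y)" if x: "bdd x" and y: "bdd y" for x y
    proof -
      from x y obtain g C h C' where gh: "spec x g" "spec y h"
        and ev: "eventually (\<lambda>T. \<bar>g T\<bar> \<le> C) at_top" "eventually (\<lambda>T. \<bar>h T\<bar> \<le> C') at_top"
        unfolding bdd_def by blast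
      have "eventually (\<lambda>T. \<bar>g T + h T\<bar> \<le> C + C') at_top"
        using ev by eventually_elim linarith
      moreover have "eventually (\<lambda>T. \<bar>g T * h T\<bar> \<le> C * C') at_top"
        using ev by eventually_elim (auto simp: abs_mult intro!: mult_mono)
      ultimately show ?thesis using spec_add[OF gh] spec_mult[OF gh] unfolding bdd_def by blast
    qed
    ultimately show "rat_subalgebra {x. bdd x}" by (auto simp: rat_subalgebra_def)
  qed
  define w where "w T = cayley_menger CARD('n) (degen_sq T)" for T
  have w: "spec (V\<^sup>2) w" unfolding volume_sq w_def by (rule spec_cayley_menger)
  have w_inf: "filterlim (\<lambda>T. \<bar>w T\<bar>) at_top at_top"
    unfolding w_def using n by (rule degen_cayley_menger_unbounded)
  from int obtain q where q: "Polynomial.lead_coeff q = 1" "\<And>i. Polynomial.coeff q i \<in> sq_area_ring"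
    "Polynomial.poly q (V\<^sup>2) = 0"
    by (auto simp: integral_over_def)
  define d where "d = Polynomial.degree q"
  have "\<forall>i. \<exists>g C. spec (Polynomial.coeff q i) g \<and> eventually (\<lambda>T. \<bar>g T\<bar> \<le> C) at_top"
    using subsetD[OF bdd q(2)] unfolding bdd_def by blast
  then obtain g C where g: "\<And>i. spec (Polynomial.coeff q i) (g i)"
    and C: "\<And>i. eventually (\<lambda>T. \<bar>g i T\<bar> \<le> C i) at_top" by metis
  have "0 = (\<Sum>i<d. Polynomial.coeff q i * (V\<^sup>2) ^ i) + (V\<^sup>2) ^ d"
    using q(1,3) by (simp add: poly_altdef d_def flip: lessThan_Suc_atMost)
  moreover have "spec ((\<Sum>i<d. Polynomial.coeff q i * (V\<^sup>2) ^ i) + (V\<^sup>2) ^ d) (\<lambda>T. (\<Sum>i<d. g i T * w T ^ i) + w T ^ d)"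
    by (intro spec_add spec_sum spec_mult spec_power g w)
  ultimately have "spec 0 (\<lambda>T. (\<Sum>i<d. g i T * w T ^ i) + w T ^ d)" by simp
  then have zero: "eventually (\<lambda>T. (\<Sum>i<d. g i T * w T ^ i) + w T ^ d = 0) at_top"
    by (rule spec_zero_imp)
  have Cs: "eventually (\<lambda>T. \<forall>i\<in>{..<d}. \<bar>g i T\<bar> \<le> C i) at_top"
    by (rule eventually_ball_finite) (use C in auto)
  have big: "eventually (\<lambda>T. max 1 ((\<Sum>i<d. C i) + 1) \<le> \<bar>w T\<bar>) at_top"
    using w_inf unfolding filterlim_at_top by blast
  have "eventually (\<lambda>T :: real. False) at_top"
    using zero Cs big
  proof eventually_elim
    case (elim T)
    let ?w = "\<bar>w T\<bar>"
    have w1: "1 \<le> ?w" "(\<Sum>i<d. C i) < ?w" using elim(3) by auto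
    have "w T ^ d = - (\<Sum>i<d. g i T * w T ^ i)" using elim(1) by simp
    then have "?w ^ d = \<bar>\<Sum>i<d. g i T * w T ^ i\<bar>" by (simp flip: power_abs)
    also have "\<dots> \<le> (\<Sum>i<d. \<bar>g i T * w T ^ i\<bar>)" by (rule sum_abs)
    also have "\<dots> \<le> (\<Sum>i<d. C i * ?w ^ (d - 1))"
    proof (rule sum_mono)
      fix i assume i: "i \<in> {..<d}"
      have "?w ^ i \<le> ?w ^ (d - 1)" using w1 i by (intro power_increasing) auto
      then show "\<bar>g i T * w T ^ i\<bar> \<le> C i * ?w ^ (d - 1)"
        using elim(2) i w1 unfolding abs_mult power_abs by (intro mult_mono) (auto intro: order_trans[OF abs_ge_zero])
    qed
    also have "\<dots> = (\<Sum>i<d. C i) * ?w ^ (d - 1)" by (simp add: sum_distrib_right)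
    finally have le: "?w ^ d \<le> (\<Sum>i<d. C i) * ?w ^ (d - 1)" .
    show False
    proof (cases d)
      case 0
      with le show False by simp
    next
      case (Suc d')
      have "(\<Sum>i<d. C i) * ?w ^ (d - 1) < ?w * ?w ^ (d - 1)"
        using w1 by (intro mult_strict_right_mono) auto
      with le Suc show False by simp
    qed
  qed
  then show False by simp
qed

end

theorem theorem1p7:
  fixes A :: "nat \<times> nat \<times> nat \<Rightarrow> 'n :: finite simplex_field"
    and V :: "'n simplex_field"
  assumes "CARD('n) \<ge> 3"
    and "\<And>i j k. (i, j, k) \<in> two_faces CARD('n) \<Longrightarrow> (A (i, j, k))\<^sup>2 = heron sq_length i j k"
    and "V\<^sup>2 = cayley_menger CARD('n) sq_length"
  shows "(integral_over (area_laurent_ring A) V \<longleftrightarrow> CARD('n) \<ge> 6) \<and>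
         (CARD('n) \<ge> 6 \<longrightarrow> integral_over (area_localized_ring A) V)"
proof -
  interpret simplex_areas A V
    by unfold_locales (use assms in auto)
  show ?thesis
  proof (cases "6 \<le> CARD('n)")
    case True
    then show ?thesis
      using volume_integral integral_over_mono[OF _ area_laurent_subset_localized] by blast
  next
    case False
    then have "CARD('n) \<le> 5" by simp
    with assms(1) have "\<not> integral_over (area_laurent_ring A) V" by (rule volume_not_integral)
    with False show ?thesis by blast
  qed
qed

end
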